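(* In the mixed regime described in the context ($\delta_x>0$, $\delta_y=0$), with regularization parameter $\lambda_y=\varepsilon/\Omega_y$, assume the compatibility conditions $$\zeta_\lambda=0\ \text{if}\ \beta_x^\lambda>0,\qquad\xi_\lambda=0\ \text{if}\ \beta_y^\lambda>0,\qquad\beta_x^\lambda\delta_y^\lambda\le\tfrac14,\qquad\beta_y^\lambda\delta_x^\lambda\le\tfrac14,$$ and additionally: (i) $\xi_\lambda=0$ and $\zeta_\lambda=0$; (ii) either $\mu_x>0$, or $\mathcal X$ is bounded, in which case $D_{\mathcal X}:=\sup_{u,u'\in\mathcal X}\|u-u'\|<\infty$. Let $\hat\kappa=\frac{L_{xy}^2}{\delta_x^\lambda\lambda_y}$, $\hat\kappa_\mu=\frac{L_{xy}^2}{\mu_x\lambda_y}$ (if $\mu_x>0$), and $$\varepsilon'_\star=\begin{cases}\dfrac{\varepsilon}{2(\frac16+\frac12\hat\kappa+\frac12\hat\kappa_\mu)},&\mu_x>0,\\[2ex]\min\Big\{\dfrac{\varepsilon}{4(\frac16+\frac12\hat\kappa)},\dfrac{\lambda_y\varepsilon^2}{16L_{xy}^2D_{\mathcal X}^2}\Big\},&\mu_x=0,\end{cases}$$ (the second entry of the minimum read as $+\infty$ if $D_{\mathcal X}=0$). Set $$\Psi_0:=\Psi_\lambda(z^0),\quad\Gamma:=\frac{\varepsilon}{\varepsilon'_\star},\quad\alpha_x:=\frac{1-\nu_x}{1+3\nu_x},\quad\alpha_y:=\frac{1-\nu_y}{1+3\nu_y}.$$ Let $z_\lambda^S:=z^0$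 if $\Psi_0\le\varepsilon'_\star$, and otherwise let $z_\lambda^S$ be the output of the restarted Sliding Algorithm applied to the regularized components $(f,g_\lambda,p_{3,\lambda},Q_3)$ with terminal target $\varepsilon'_\star$. Then $$\operatorname{Gap}(z_\lambda^S)\le\varepsilon$$ for the original problem, with $S=\mathcal O(1+\log_+(\Psi_0\Gamma/\varepsilon))$ restarts and with total numbers of evaluations of $f'$, of $g'$, and of products with $\mathbf B,\mathbf B^\top$ given by $$N_f^{\mathrm{tot}}=\mathcal O(\Gamma^{\alpha_x}N_f),\qquad N_g^{\mathrm{tot}}=\mathcal O(\Gamma^{\alpha_y}N_g),\qquad N_B^{\mathrm{tot}}=\mathcal O(N_B),$$ where $$N_f=\begin{cases}\mathcal O\big((\tilde H_x^\lambda)^{\frac2{1+3\nu_x}}\varepsilon^{-\alpha_x}\big),&\nu_x<1,\\\widetilde{\mathcal O}(\sqrt{\kappa_x^\lambda}),&\nu_x=1,\end{cases}\qquad N_g=\begin{cases}\mathcal O\Big(\Big(\frac{H_{y,\lambda}\Omega_y^{(1+\nu_y)/2}}{\varepsilon}\Big)^{\frac2{1+3\nu_y}}\Big),&\nu_y<1,\\\widetilde{\mathcal O}\Big(\sqrt{1+\frac{L_y\Omega_y}{\varepsilon}}\Big),&\nu_y=1,\end{cases}\qquad N_B=\widetilde{\mathcal O}\Big(L_{xy}\sqrt{\tfrac{\Omega_y}{\delta_x^\lambda\varepsilon}}\Big).$$ Moreover, $\nu_x=\nu_y=1$ implies $\alpha_x=\alpha_y=0$; and $\nu_y<1$ implies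 $\hat\kappa=\hat\kappa_\mu=\kappa_{xy}^\lambda$ and $\Gamma=\Theta(1+\kappa_{xy}^\lambda)$. (Asymptotics are as $\varepsilon\downarrow0$ with the original problem data, $y^0$ and $z^0$ fixed; $\widetilde{\mathcal O}$ hides factors logarithmic in $\Psi_0\Gamma/\varepsilon$, one factor $S$ of restarts.)
   Context: Problem. $\min_{x\in\mathcal X}\max_{y\in\mathcal Y}F(x,y)=f(x)+\langle y,\mathbf Bx\rangle-g(y)$, $\mathcal X\subseteq\mathbb R^{d_x}$, $\mathcal Y\subseteq\mathbb R^{d_y}$ nonempty, closed, convex, $\mathcal Z=\mathcal X\times\mathcal Y$; $\|\cdot\|$ Euclidean. $\partial f,\partial g$ are ambient-space subdifferentials, $f',g'$ arbitrary subgradients (conditions hold for every choice). $\operatorname{Gap}(x,y)=\max_{v\in\mathcal Y}F(x,v)-\min_{u\in\mathcal X}F(u,y)$. (A1) $f:\mathbb R^{d_x}\to\mathbb R$ convex; on $\mathcal X$, $\mu_x$-strongly convex ($\mu_x\ge0$) and $\|f'(x)-f'(x')\|\le H_x\|x-x'\|^{\nu_x}$, $0\le\nu_x\le1$, $H_x>0$. (A2) $g:\mathbb R^{d_y}\to\mathbb R$ likewise on $\mathcal Y$ with $\mu_y,H_y,\nu_y$. (A3) $L_{xy}>0$, $\mu_{xy},\mu_{yx}\ge0$, $L_{xy}>\max\{\mu_{xy},\mu_{yx}\}$, $L_{xy}^2\ge\lambda_{\max}(\mathbf B^\top\mathbf B)$; either $\mu_{xy}^2\le\lambda_{\min}(\mathbf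 B^\top\mathbf B)$, or $\mathsf R_x$ is invoked: $\partial f(x)\subseteq\operatorname{range}(\mathbf B^\top)$ for all $x\in\mathcal X$, $\mathcal X+\ker\mathbf B=\mathcal X$, and $\mu_{xy}^2\le\lambda_{\min}^+(\mathbf B^\top\mathbf B)$ (smallest positive eigenvalue); symmetrically for $\mu_{yx}$ with $\mathbf B\mathbf B^\top$, $\partial g(y)\subseteq\operatorname{range}(\mathbf B)$, $\mathcal Y+\ker\mathbf B^\top=\mathcal Y$; if both $\mu_{xy},\mu_{yx}>0$ they are equal. Ambient smoothness: if $\nu_x=1$, $\nabla f$ is $H_x$-Lipschitz on $\mathbb R^{d_x}$ and $L_x:=H_x$; if $\nu_y=1$, $\nabla g$ is $H_y$-Lipschitz on $\mathbb R^{d_y}$ and $L_y:=H_y$. $\beta_x=1/(4L_y)$ if $\nu_y=1$, else $0$; $\beta_y=1/(4L_x)$ if $\nu_x=1$, else $0$; $\delta_x=\mu_x+4\beta_x\mu_{xy}^2$, $\delta_y=\mu_y+4\beta_y\mu_{yx}^2$. Mixed regime. $\delta_x>0$, $\delta_y=0$; $\mathcal Y$ bounded; $y^0\in\mathbb R^{d_y}$ fixed; $\Omega_y=\sup_{y\in\mathcal Y}\|y-y^0\|^2>0$, $D_{\mathcal Y}=\sup_{u,v\in\mathcal Y}\|u-v\|$; $\varepsilon>0$, $\lambda_y=\varepsilon/\Omega_y$; $g_\lambda(y)=g(y)+\frac{\lambda_y}2\|y-y^0\|^2$, $g_\lambda'(y)=g'(y)+\lambda_y(y-y^0)$; $H_{y,\lambda}=H_y+\lambda_yD_{\mathcal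 Y}^{1-\nu_y}$; $\beta_x^\lambda=\frac1{4(L_y+\lambda_y)}$ if $\nu_y=1$, else $0$; $\beta_y^\lambda=\beta_y$; $\delta_x^\lambda=\mu_x+4\beta_x^\lambda\mu_{xy}^2$, $\delta_y^\lambda=\lambda_y$; $\mathbf P_\lambda=\operatorname{diag}(\delta_x^\lambda\mathbf I,\lambda_y\mathbf I)$; $\kappa_x^\lambda=L_x/\delta_x^\lambda$, $\kappa_{xy}^\lambda=L_{xy}^2/(\delta_x^\lambda\lambda_y)$, $\tilde H_x^\lambda=H_x(\delta_x^\lambda)^{-(1+\nu_x)/2}$. The regularized problem, with $F_{\lambda_y}=f(x)+\langle y,\mathbf Bx\rangle-g_\lambda(y)$, is assumed to have a saddle point $z_\lambda^*=(x_\lambda^*,y_\lambda^* )$, chosen with $x^0-x_\lambda^*\in\operatorname{range}(\mathbf B^\top)$ if $\mathsf R_x$ is invoked ($x^0$ the $x$-block of $z^0\in\mathcal Z$); subgradients and $\xi_\lambda\in N_{\mathcal X}(x_\lambda^* )$, $\zeta_\lambda\in N_{\mathcal Y}(y_\lambda^* )$ are fixed with $f'(x_\lambda^* )+\mathbf B^\top y_\lambda^*+\xi_\lambda=0$, $g_\lambda'(y_\lambda^* )-\mathbf Bx_\lambda^*+\zeta_\lambda=0$. On the regularized $y$-block one takes $\mu_{yx}=0$. $\mathrm D_f(x,x_\lambda^* )=f(x)-f(x_\lambda^* )-\langle f'(x_\lambda^* ),x-x_\lambda^*\rangle$, $\mathrm D_{g_\lambda}$ likewise; $\Psi_\lambda(z)=\|z-z_\lambda^*\|_{\mathbf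 P_\lambda}^2+12\mathrm D_f(x,x_\lambda^* )+12\mathrm D_{g_\lambda}(y,y_\lambda^* )$. Restarted Sliding Algorithm with terminal target $\varepsilon'\in(0,\Psi_0]$: $S=\lceil\log(\Psi_0/\varepsilon')/\log(4/3)\rceil$ stages; stage $s$ has input $z_{\mathrm{in}}=z^s$ and $\Omega_s=(3/4)^s\Psi_0$. In a stage, $p_1=f$, $p_2=g_\lambda$, $p_{3,\lambda}(x,y)=\frac{\beta_x^\lambda}2\|\mathbf Bx-g_\lambda'(y_{\mathrm{in}})\|^2+\frac{\beta_y^\lambda}2\|\mathbf B^\top y+f'(x_{\mathrm{in}})\|^2$, $Q_1=Q_2=0$, $Q_3(x,y)=(\mathbf B^\top y,-\mathbf Bx)$, with norm $\|\cdot\|_{\mathbf P_\lambda}$; constants $L_1=\bar L_x/\delta_x^\lambda$, $L_2=\bar L_y/\lambda_y$, $L_3=\kappa_{xy}^\lambda$, $M_1=M_2=0$, $M_3=\sqrt{\kappa_{xy}^\lambda}$, where $\bar L_x=L_x$ if $\nu_x=1$, $\bar L_x=\big[\frac{1-\nu_x}{2(1+\nu_x)\delta_f}\big]^{\frac{1-\nu_x}{1+\nu_x}}H_x^{\frac2{1+\nu_x}}$ if $\nu_x<1$, and $\bar L_y=L_y+\lambda_y$ if $\nu_y=1$, $\bar L_y=\big[\frac{1-\nu_y}{2(1+\nu_y)\delta_g}\big]^{\frac{1-\nu_y}{1+\nu_y}}H_{y,\lambda}^{\frac2{1+\nu_y}}$ if $\nu_y<1$. Budgets: $R_1=\max\{(\tilde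 H_x^\lambda)^{2/(1+3\nu_x)}\Omega_s^{-\alpha_x},1\}$, $R_2=\max\{(H_{y,\lambda}\lambda_y^{-(1+\nu_y)/2})^{2/(1+3\nu_y)}\Omega_s^{-\alpha_y},1\}$, $R_3=\max\{\sqrt{\kappa_{xy}^\lambda},1\}$; pairs are placed at levels by a permutation $\pi$ with $R_{\pi(1)}\le R_{\pi(2)}\le R_{\pi(3)}$; $A_0=1$, $T_i=\max\{1,\lceil cR_{\pi(i)}/A_{i-1}\rceil\}$, $A_i=A_{i-1}T_i$ with $c$ a large absolute constant; $\delta_f=\Omega_s/(384A_{\pi^{-1}(1)})$ if $\nu_x<1$ and $\delta_g=\Omega_s/(384A_{\pi^{-1}(2)})$ if $\nu_y<1$. The stage output is that of the following algorithm ($(p_i,Q_i),L_i,M_i$ now denoting level-$i$ data, $n=3$, exact (sub)gradients $\tilde\nabla p_i$): $\alpha_0=1$, $\alpha_{t+1}=2/(1+\sqrt{1+4/\alpha_t^2})$; $\eta^k_{\mathbf t}=L_k\prod_{\ell\le k}\alpha_{t_\ell}+M_k\prod_{\ell\le k}\alpha_{t_\ell}/\alpha_{T_\ell-1}$; $z^k_{(0,\dots,0)}=z_{\mathrm{in}}$; output $\mathrm{Rec}(0,\varnothing)$, where $\mathrm{Rec}(k,\mathbf t)$, $\mathbf t=(t_1,\dots,t_k)$, is: (a) if $k=n$, return $\operatorname{argmin}_{z\in\mathcal Z}\sum_{i=1}^n\{\langle\tilde\nabla p_i(w^i_{(t_1,\dots,t_i)})+Q_i(z^i_{(t_1,\dots,t_i)}),z\rangle+\frac12\eta^i_{(t_1,\dots,t_i)}\|z-z^i_{(t_1,\dots,t_i)}\|_{\mathbf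 P_\lambda}^2\}$; (b) if $k<n$, set $\bar z^{k+1}_{(\mathbf t,0)}=z^{k+1}_{(\mathbf t,0)}$; for $j=0,\dots,T_{k+1}-1$, $\mathbf t'=(\mathbf t,j)$, $\mathbf t''=(\mathbf t,j+1)$: $\tilde z^{k+1}_{\mathbf t'}=\mathrm{Rec}(k+1,\mathbf t')$, $\bar z^{k+1}_{\mathbf t''}=\alpha_j\tilde z^{k+1}_{\mathbf t'}+(1-\alpha_j)\bar z^{k+1}_{\mathbf t'}$, $z^{k+1}_{\mathbf t''}=\operatorname{argmin}_{z\in\mathcal Z}\{\langle Q_{k+1}(\tilde z^{k+1}_{\mathbf t'})-Q_{k+1}(z^{k+1}_{\mathbf t'}),z\rangle+\frac12\eta^{k+1}_{\mathbf t'}\|z-\tilde z^{k+1}_{\mathbf t'}\|_{\mathbf P_\lambda}^2\}$, and $z^\ell_{(\mathbf t'',0,\dots,0)}=z^\ell_{(\mathbf t',T_{k+2},0,\dots,0)}$ for $\ell\ge k+2$; return $\bar z^{k+1}_{(\mathbf t,T_{k+1})}$. Here $w^i_{(t_1,\dots,t_i)}=(a_1\circ\cdots\circ a_i)(z^i_{(t_1,\dots,t_i)})$, $a_\ell(z)=\alpha_{t_\ell}z+(1-\alpha_{t_\ell})\bar z^\ell_{(t_1,\dots,t_\ell)}$; each $\tilde\nabla p_i(w^i_{\mathbf t})$, $Q_i(z^i_{\mathbf t})$ is computed once. *)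

theory Defs
  imports "HOL-Analysis.Analysis" "HOL-Library.Landau_Symbols"
begin

section \<open>Convex-analytic and spectral notions\<close>

definition subdifferential :: "('a::real_inner \<Rightarrow> real) \<Rightarrow> 'a \<Rightarrow> 'a set" where
  "subdifferential h x = {s. \<forall>u. h x + s \<bullet> (u - x) \<le> h u}"

definition normal_cone :: "'a::real_inner set \<Rightarrow> 'a \<Rightarrow> 'a set" where
  "normal_cone S x = {n. \<forall>u\<in>S. n \<bullet> (u - x) \<le> 0}"

definition strongly_convex_on :: "'a::real_inner set \<Rightarrow> real \<Rightarrow> ('a \<Rightarrow> real) \<Rightarrow> bool" where
  "strongly_convex_on S \<mu> h \<longleftrightarrow>
     (\<forall>x\<in>S. \<forall>y\<in>S. \<forall>t\<in>{0..1}.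
        h ((1 - t) *\<^sub>R x + t *\<^sub>R y)
          \<le> (1 - t) * h x + t * h y - \<mu> / 2 * t * (1 - t) * (norm (x - y))\<^sup>2)"

text \<open>
  Real power with the convention \<open>0^0 = 1\<close> (in the library, \<open>0 powr 0 = 0\<close>).  It matters for the
  Hoelder condition with exponent \<open>0\<close>, which must read \<open>norm (f' x - f' x') \<le> H\<close> also for two
  subgradients at one point, and for \<open>D_Y ^ (1 - nu_y)\<close> with \<open>nu_y = 1\<close> and a singleton \<open>Y\<close>.
\<close>
definition rpow :: "real \<Rightarrow> real \<Rightarrow> real" where
  "rpow r a = (if a = 0 then 1 else r powr a)"

definition holder_subgradients_on ::
    "'a::real_inner set \<Rightarrow> real \<Rightarrow> real \<Rightarrow> ('a \<Rightarrow> real) \<Rightarrow> bool" where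
  "holder_subgradients_on S H \<nu> h \<longleftrightarrow>
     (\<forall>x\<in>S. \<forall>x'\<in>S. \<forall>s\<in>subdifferential h x. \<forall>s'\<in>subdifferential h x'.
        norm (s - s') \<le> H * rpow (norm (x - x')) \<nu>)"

definition eigenvalues :: "real^'n^'n \<Rightarrow> real set" where
  "eigenvalues A = {l. \<exists>v. v \<noteq> 0 \<and> A *v v = l *\<^sub>R v}"

definition lambda_max :: "real^'n^'n \<Rightarrow> real" where
  "lambda_max A = Max (eigenvalues A)"

definition lambda_min :: "real^'n^'n \<Rightarrow> real" where
  "lambda_min A = Min (eigenvalues A)"

definition lambda_min_pos :: "real^'n^'n \<Rightarrow> real" where
  "lambda_min_pos A = Min {l \<in> eigenvalues A. 0 < l}"


section \<open>The saddle-point problem\<close>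

text \<open>
  The fields \<open>fsub\<close> and \<open>gsub\<close> are the subgradient oracles \<open>f'\<close> and \<open>g'\<close>; the flags \<open>inv_Rx\<close> and
  \<open>inv_Ry\<close> say whether the range condition of the respective block is invoked.
\<close>
record ('x::finite, 'y::finite) saddle_data =
  domX :: "(real^'x) set"
  domY :: "(real^'y) set"
  fobj :: "real^'x \<Rightarrow> real"
  gobj :: "real^'y \<Rightarrow> real"
  fsub :: "real^'x \<Rightarrow> real^'x"
  gsub :: "real^'y \<Rightarrow> real^'y"
  matB :: "real^'x^'y"
  mu_x :: real
  mu_y :: real
  H_x :: real
  H_y :: real
  nu_x :: real
  nu_y :: real
  L_xy :: real
  mu_xy :: real
  mu_yx :: real
  inv_Rx :: bool
  inv_Ry :: bool
  y_ref :: "real^'y"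
  z_init :: "(real^'x) \<times> (real^'y)"

definition domZ :: "('x::finite, 'y::finite) saddle_data \<Rightarrow> ((real^'x) \<times> (real^'y)) set" where
  "domZ D = domX D \<times> domY D"

definition Fobj :: "('x::finite, 'y::finite) saddle_data \<Rightarrow> real^'x \<Rightarrow> real^'y \<Rightarrow> real" where
  "Fobj D x y = fobj D x + y \<bullet> (matB D *v x) - gobj D y"

text \<open>Extended-real valued, so that a bound on the gap includes its finiteness.\<close>
definition gap :: "('x::finite, 'y::finite) saddle_data \<Rightarrow> (real^'x) \<times> (real^'y) \<Rightarrow> ereal" where
  "gap D z = (SUP v\<in>domY D. ereal (Fobj D (fst z) v)) - (INF u\<in>domX D. ereal (Fobj D u (snd z)))"

definition range_condition ::
    "real^'a^'b \<Rightarrow> (real^'a) set \<Rightarrow> (real^'a \<Rightarrow> real) \<Rightarrow> real \<Rightarrow> bool" where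
  "range_condition A S h \<mu> \<longleftrightarrow>
     (\<forall>x\<in>S. subdifferential h x \<subseteq> range (\<lambda>v. transpose A *v v)) \<and>
     {x + k |x k. x \<in> S \<and> A *v k = 0} = S \<and>
     \<mu>\<^sup>2 \<le> lambda_min_pos (transpose A ** A)"

definition standing_assumptions :: "('x::finite, 'y::finite) saddle_data \<Rightarrow> bool" where
  "standing_assumptions D \<longleftrightarrow>
     domX D \<noteq> {} \<and> closed (domX D) \<and> convex (domX D) \<and>
     domY D \<noteq> {} \<and> closed (domY D) \<and> convex (domY D) \<and>
     (\<forall>x. fsub D x \<in> subdifferential (fobj D) x) \<and>
     (\<forall>y. gsub D y \<in> subdifferential (gobj D) y) \<and>
     convex_on UNIV (fobj D) \<and> 0 \<le> mu_x D \<and> strongly_convex_on (domX D) (mu_x D) (fobj D) \<and>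
     0 \<le> nu_x D \<and> nu_x D \<le> 1 \<and> 0 < H_x D \<and>
     holder_subgradients_on (domX D) (H_x D) (nu_x D) (fobj D) \<and>
     convex_on UNIV (gobj D) \<and> 0 \<le> mu_y D \<and> strongly_convex_on (domY D) (mu_y D) (gobj D) \<and>
     0 \<le> nu_y D \<and> nu_y D \<le> 1 \<and> 0 < H_y D \<and>
     holder_subgradients_on (domY D) (H_y D) (nu_y D) (gobj D) \<and>
     0 < L_xy D \<and> 0 \<le> mu_xy D \<and> 0 \<le> mu_yx D \<and> max (mu_xy D) (mu_yx D) < L_xy D \<and>
     lambda_max (transpose (matB D) ** matB D) \<le> (L_xy D)\<^sup>2 \<and>
     (if inv_Rx D then range_condition (matB D) (domX D) (fobj D) (mu_xy D)
      else (mu_xy D)\<^sup>2 \<le> lambda_min (transpose (matB D) ** matB D)) \<and>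
     (if inv_Ry D then range_condition (transpose (matB D)) (domY D) (gobj D) (mu_yx D)
      else (mu_yx D)\<^sup>2 \<le> lambda_min (matB D ** transpose (matB D))) \<and>
     (0 < mu_xy D \<and> 0 < mu_yx D \<longrightarrow> mu_xy D = mu_yx D) \<and>
     (nu_x D = 1 \<longrightarrow> (\<forall>x. GDERIV (fobj D) x :> fsub D x) \<and> (H_x D)-lipschitz_on UNIV (fsub D)) \<and>
     (nu_y D = 1 \<longrightarrow> (\<forall>y. GDERIV (gobj D) y :> gsub D y) \<and> (H_y D)-lipschitz_on UNIV (gsub D))"

text \<open>In the case \<open>nu = 1\<close> the smoothness constants \<open>L_x\<close>, \<open>L_y\<close> are \<open>H_x\<close>, \<open>H_y\<close>.\<close>

definition beta_x :: "('x::finite, 'y::finite) saddle_data \<Rightarrow> real" where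
  "beta_x D = (if nu_y D = 1 then 1 / (4 * H_y D) else 0)"

definition beta_y :: "('x::finite, 'y::finite) saddle_data \<Rightarrow> real" where
  "beta_y D = (if nu_x D = 1 then 1 / (4 * H_x D) else 0)"

definition delta_x :: "('x::finite, 'y::finite) saddle_data \<Rightarrow> real" where
  "delta_x D = mu_x D + 4 * beta_x D * (mu_xy D)\<^sup>2"

definition delta_y :: "('x::finite, 'y::finite) saddle_data \<Rightarrow> real" where
  "delta_y D = mu_y D + 4 * beta_y D * (mu_yx D)\<^sup>2"

definition Omega_y :: "('x::finite, 'y::finite) saddle_data \<Rightarrow> real" where
  "Omega_y D = (SUP y\<in>domY D. (norm (y - y_ref D))\<^sup>2)"

definition mixed_regime :: "('x::finite, 'y::finite) saddle_data \<Rightarrow> bool" where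
  "mixed_regime D \<longleftrightarrow> standing_assumptions D \<and> 0 < delta_x D \<and> delta_y D = 0 \<and>
     bounded (domY D) \<and> 0 < Omega_y D \<and> z_init D \<in> domZ D"


section \<open>Regularization of the second block\<close>

definition lambda_y :: "('x::finite, 'y::finite) saddle_data \<Rightarrow> real \<Rightarrow> real" where
  "lambda_y D \<epsilon> = \<epsilon> / Omega_y D"

definition g_reg :: "('x::finite, 'y::finite) saddle_data \<Rightarrow> real \<Rightarrow> real^'y \<Rightarrow> real" where
  "g_reg D \<epsilon> y = gobj D y + lambda_y D \<epsilon> / 2 * (norm (y - y_ref D))\<^sup>2"

definition g_reg_sub :: "('x::finite, 'y::finite) saddle_data \<Rightarrow> real \<Rightarrow> real^'y \<Rightarrow> real^'y" where
  "g_reg_sub D \<epsilon> y = gsub D y + lambda_y D \<epsilon> *\<^sub>R (y - y_ref D)"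

definition F_reg ::
    "('x::finite, 'y::finite) saddle_data \<Rightarrow> real \<Rightarrow> real^'x \<Rightarrow> real^'y \<Rightarrow> real" where
  "F_reg D \<epsilon> x y = fobj D x + y \<bullet> (matB D *v x) - g_reg D \<epsilon> y"

definition H_y_reg :: "('x::finite, 'y::finite) saddle_data \<Rightarrow> real \<Rightarrow> real" where
  "H_y_reg D \<epsilon> = H_y D + lambda_y D \<epsilon> * rpow (diameter (domY D)) (1 - nu_y D)"

definition beta_x_reg :: "('x::finite, 'y::finite) saddle_data \<Rightarrow> real \<Rightarrow> real" where
  "beta_x_reg D \<epsilon> = (if nu_y D = 1 then 1 / (4 * (H_y D + lambda_y D \<epsilon>)) else 0)"

definition beta_y_reg :: "('x::finite, 'y::finite) saddle_data \<Rightarrow> real \<Rightarrow> real" where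
  "beta_y_reg D \<epsilon> = beta_y D"

definition delta_x_reg :: "('x::finite, 'y::finite) saddle_data \<Rightarrow> real \<Rightarrow> real" where
  "delta_x_reg D \<epsilon> = mu_x D + 4 * beta_x_reg D \<epsilon> * (mu_xy D)\<^sup>2"

definition delta_y_reg :: "('x::finite, 'y::finite) saddle_data \<Rightarrow> real \<Rightarrow> real" where
  "delta_y_reg D \<epsilon> = lambda_y D \<epsilon>"

definition P_norm_sq ::
    "('x::finite, 'y::finite) saddle_data \<Rightarrow> real \<Rightarrow> (real^'x) \<times> (real^'y) \<Rightarrow> real" where
  "P_norm_sq D \<epsilon> z = delta_x_reg D \<epsilon> * (norm (fst z))\<^sup>2 + delta_y_reg D \<epsilon> * (norm (snd z))\<^sup>2"

definition kappa_x :: "('x::finite, 'y::finite) saddle_data \<Rightarrow> real \<Rightarrow> real" where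
  "kappa_x D \<epsilon> = H_x D / delta_x_reg D \<epsilon>"

definition kappa_xy :: "('x::finite, 'y::finite) saddle_data \<Rightarrow> real \<Rightarrow> real" where
  "kappa_xy D \<epsilon> = (L_xy D)\<^sup>2 / (delta_x_reg D \<epsilon> * lambda_y D \<epsilon>)"

definition H_x_tilde :: "('x::finite, 'y::finite) saddle_data \<Rightarrow> real \<Rightarrow> real" where
  "H_x_tilde D \<epsilon> = H_x D * delta_x_reg D \<epsilon> powr (- (1 + nu_x D) / 2)"

definition alpha_x :: "('x::finite, 'y::finite) saddle_data \<Rightarrow> real" where
  "alpha_x D = (1 - nu_x D) / (1 + 3 * nu_x D)"

definition alpha_y :: "('x::finite, 'y::finite) saddle_data \<Rightarrow> real" where
  "alpha_y D = (1 - nu_y D) / (1 + 3 * nu_y D)"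

text \<open>
  A regularized saddle point with the subgradients \<open>f'(x*)\<close>, \<open>g'(y*)\<close> and normal vectors fixed at
  it.  The subgradients need not be the ones returned by the oracles \<open>fsub\<close>, \<open>gsub\<close> at that point.
\<close>
record ('x::finite, 'y::finite) saddle_ref =
  x_star :: "real^'x"
  y_star :: "real^'y"
  f_star :: "real^'x"
  g_star :: "real^'y"
  xi_star :: "real^'x"
  zeta_star :: "real^'y"

definition g_reg_star ::
    "('x::finite, 'y::finite) saddle_data \<Rightarrow> real \<Rightarrow> ('x, 'y) saddle_ref \<Rightarrow> real^'y" where
  "g_reg_star D \<epsilon> r = g_star r + lambda_y D \<epsilon> *\<^sub>R (y_star r - y_ref D)"

definition regularized_saddle ::
    "('x::finite, 'y::finite) saddle_data \<Rightarrow> real \<Rightarrow> ('x, 'y) saddle_ref \<Rightarrow> bool" where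
  "regularized_saddle D \<epsilon> r \<longleftrightarrow>
     x_star r \<in> domX D \<and> y_star r \<in> domY D \<and>
     (\<forall>x\<in>domX D. F_reg D \<epsilon> (x_star r) (y_star r) \<le> F_reg D \<epsilon> x (y_star r)) \<and>
     (\<forall>y\<in>domY D. F_reg D \<epsilon> (x_star r) y \<le> F_reg D \<epsilon> (x_star r) (y_star r)) \<and>
     (inv_Rx D \<longrightarrow> fst (z_init D) - x_star r \<in> range (\<lambda>v. transpose (matB D) *v v)) \<and>
     f_star r \<in> subdifferential (fobj D) (x_star r) \<and>
     g_star r \<in> subdifferential (gobj D) (y_star r) \<and>
     xi_star r \<in> normal_cone (domX D) (x_star r) \<and>
     zeta_star r \<in> normal_cone (domY D) (y_star r) \<and>
     f_star r + transpose (matB D) *v y_star r + xi_star r = 0 \<and>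
     g_reg_star D \<epsilon> r - matB D *v x_star r + zeta_star r = 0"

definition compatible ::
    "('x::finite, 'y::finite) saddle_data \<Rightarrow> real \<Rightarrow> ('x, 'y) saddle_ref \<Rightarrow> bool" where
  "compatible D \<epsilon> r \<longleftrightarrow>
     (0 < beta_x_reg D \<epsilon> \<longrightarrow> zeta_star r = 0) \<and> (0 < beta_y_reg D \<epsilon> \<longrightarrow> xi_star r = 0) \<and>
     beta_x_reg D \<epsilon> * delta_y_reg D \<epsilon> \<le> 1 / 4 \<and> beta_y_reg D \<epsilon> * delta_x_reg D \<epsilon> \<le> 1 / 4"

definition bregman :: "('a::real_inner \<Rightarrow> real) \<Rightarrow> 'a \<Rightarrow> 'a \<Rightarrow> 'a \<Rightarrow> real" where
  "bregman h s u v = h u - h v - s \<bullet> (u - v)"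

definition Psi ::
    "('x::finite, 'y::finite) saddle_data \<Rightarrow> real \<Rightarrow> ('x, 'y) saddle_ref
      \<Rightarrow> (real^'x) \<times> (real^'y) \<Rightarrow> real" where
  "Psi D \<epsilon> r z =
     P_norm_sq D \<epsilon> (z - (x_star r, y_star r))
     + 12 * bregman (fobj D) (f_star r) (fst z) (x_star r)
     + 12 * bregman (g_reg D \<epsilon>) (g_reg_star D \<epsilon> r) (snd z) (y_star r)"

definition Psi0 ::
    "('x::finite, 'y::finite) saddle_data \<Rightarrow> real \<Rightarrow> ('x, 'y) saddle_ref \<Rightarrow> real" where
  "Psi0 D \<epsilon> r = Psi D \<epsilon> r (z_init D)"


section \<open>The recursive sliding scheme\<close>

text \<open>
  An oracle returns its value together with the numbers of evaluations of \<open>f'\<close>, of evaluations of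
  \<open>g'\<close>, and of products with \<open>B\<close> or its transpose that it spends.
\<close>
type_synonym calls = "nat \<times> nat \<times> nat"

record 'z component =
  grad_oracle :: "'z \<Rightarrow> 'z \<times> calls"
  Q_oracle :: "'z \<Rightarrow> 'z \<times> calls"
  smooth_const :: real
  lip_const :: real

primrec step_size :: "nat \<Rightarrow> real" where
  "step_size 0 = 1"
| "step_size (Suc t) = 2 / (1 + sqrt (1 + 4 / (step_size t)\<^sup>2))"

text \<open>
  The tuple-indexed iterates are kept as a mutable state: at any moment, \<open>idx l\<close> is the current
  \<open>t_l\<close>, and \<open>cur l\<close>, \<open>avg l\<close> are \<open>z^l\<close> and \<open>\<bar>z^l\<bar>\<close> (the averaged point) at the current tuple
  \<open>(t_1, ..., t_l)\<close>.  The carry-over rule \<open>z^l_(t'',0,...,0) = z^l_(t',T_(k+2),0,...,0)\<close> says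
  precisely that \<open>cur l\<close> is not touched when an outer index advances.  The fields \<open>gval l\<close>,
  \<open>qval l\<close> cache the oracle answers at the current \<open>(t_1, ..., t_l)\<close>, which are computed once.
\<close>
record 'z sliding_state =
  idx :: "nat \<Rightarrow> nat"
  cur :: "nat \<Rightarrow> 'z"
  avg :: "nat \<Rightarrow> 'z"
  gval :: "nat \<Rightarrow> 'z"
  qval :: "nat \<Rightarrow> 'z"
  spent :: calls

definition w_point :: "('z::real_inner) sliding_state \<Rightarrow> nat \<Rightarrow> 'z" where
  "w_point s i =
     foldr (\<lambda>l z. step_size (idx s l) *\<^sub>R z + (1 - step_size (idx s l)) *\<^sub>R avg s l)
       [1..<Suc i] (cur s i)"

definition eta :: "(nat \<Rightarrow> 'z component) \<Rightarrow> (nat \<Rightarrow> nat) \<Rightarrow> ('z::real_inner) sliding_state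
    \<Rightarrow> nat \<Rightarrow> real" where
  "eta lev T s k =
     smooth_const (lev k) * (\<Prod>l=1..k. step_size (idx s l)) +
     lip_const (lev k) * (\<Prod>l=1..k. step_size (idx s l) / step_size (T l - 1))"

definition leaf_point :: "'z set \<Rightarrow> ('z \<Rightarrow> real) \<Rightarrow> nat \<Rightarrow> (nat \<Rightarrow> 'z component) \<Rightarrow> (nat \<Rightarrow> nat)
    \<Rightarrow> ('z::real_inner) sliding_state \<Rightarrow> 'z" where
  "leaf_point Z nsq n lev T s =
     arg_min_on (\<lambda>z. \<Sum>i=1..n. (gval s i + qval s i) \<bullet> z + eta lev T s i / 2 * nsq (z - cur s i)) Z"

definition open_iteration :: "(nat \<Rightarrow> 'z component) \<Rightarrow> nat \<Rightarrow> nat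
    \<Rightarrow> ('z::real_inner) sliding_state \<Rightarrow> 'z sliding_state" where
  "open_iteration lev k j s =
     (let s1 = s\<lparr>idx := (idx s)(k := j)\<rparr>;
          (g, c1) = grad_oracle (lev k) (w_point s1 k);
          (q, c2) = Q_oracle (lev k) (cur s1 k)
      in s1\<lparr>gval := (gval s1)(k := g), qval := (qval s1)(k := q), spent := spent s1 + c1 + c2\<rparr>)"

definition close_iteration :: "'z set \<Rightarrow> ('z \<Rightarrow> real) \<Rightarrow> (nat \<Rightarrow> 'z component) \<Rightarrow> (nat \<Rightarrow> nat)
    \<Rightarrow> nat \<Rightarrow> nat \<Rightarrow> ('z::real_inner) \<times> 'z sliding_state \<Rightarrow> 'z sliding_state" where
  "close_iteration Z nsq lev T k j zs =
     (let (zt, s) = zs;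
          (qt, c) = Q_oracle (lev k) zt;
          zn = arg_min_on (\<lambda>z. (qt - qval s k) \<bullet> z + eta lev T s k / 2 * nsq (z - zt)) Z
      in s\<lparr>cur := (cur s)(k := zn),
           avg := (avg s)(k := step_size j *\<^sub>R zt + (1 - step_size j) *\<^sub>R avg s k),
           spent := spent s + c\<rparr>)"

text \<open>\<open>sliding_rec Z nsq n lev T r\<close> is \<open>Rec(n - r, t)\<close>, with \<open>t\<close> held in the state.\<close>
primrec sliding_rec :: "'z set \<Rightarrow> ('z \<Rightarrow> real) \<Rightarrow> nat \<Rightarrow> (nat \<Rightarrow> 'z component) \<Rightarrow> (nat \<Rightarrow> nat)
    \<Rightarrow> nat \<Rightarrow> ('z::real_inner) sliding_state \<Rightarrow> 'z \<times> 'z sliding_state" where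
  "sliding_rec Z nsq n lev T 0 = (\<lambda>s. (leaf_point Z nsq n lev T s, s))"
| "sliding_rec Z nsq n lev T (Suc r) = (\<lambda>s.
     let k = n - r;
         s' = fold (\<lambda>j u. close_iteration Z nsq lev T k j
                            (sliding_rec Z nsq n lev T r (open_iteration lev k j u)))
                [0..<T k] (s\<lparr>avg := (avg s)(k := cur s k)\<rparr>)
     in (avg s' k, s'))"

definition sliding :: "'z set \<Rightarrow> ('z \<Rightarrow> real) \<Rightarrow> nat \<Rightarrow> (nat \<Rightarrow> 'z component) \<Rightarrow> (nat \<Rightarrow> nat)
    \<Rightarrow> ('z::real_inner) \<Rightarrow> 'z \<times> calls" where
  "sliding Z nsq n lev T z_in =
     (let (z, s) = sliding_rec Z nsq n lev T n
            \<lparr>idx = (\<lambda>_. 0), cur = (\<lambda>_. z_in), avg = (\<lambda>_. z_in),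
             gval = (\<lambda>_. 0), qval = (\<lambda>_. 0), spent = 0\<rparr>
      in (z, spent s))"


section \<open>One stage of the restarted algorithm\<close>

definition budget :: "('x::finite, 'y::finite) saddle_data \<Rightarrow> real \<Rightarrow> real \<Rightarrow> nat \<Rightarrow> real" where
  "budget D \<epsilon> \<Omega> i =
     (if i = 1 then max (H_x_tilde D \<epsilon> powr (2 / (1 + 3 * nu_x D)) * \<Omega> powr (- alpha_x D)) 1
      else if i = 2 then
        max ((H_y_reg D \<epsilon> * lambda_y D \<epsilon> powr (- (1 + nu_y D) / 2)) powr (2 / (1 + 3 * nu_y D))
               * \<Omega> powr (- alpha_y D)) 1
      else max (sqrt (kappa_xy D \<epsilon>)) 1)"

text \<open>
  Level \<open>i\<close> carries component \<open>\<pi> i\<close>: \<open>1\<close> for \<open>f\<close>, \<open>2\<close> for the regularized \<open>g\<close>, \<open>3\<close> for the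
  bilinear part with \<open>p3\<close>.
\<close>
definition level_order ::
    "('x::finite, 'y::finite) saddle_data \<Rightarrow> real \<Rightarrow> real \<Rightarrow> (nat \<Rightarrow> nat) \<Rightarrow> bool" where
  "level_order D \<epsilon> \<Omega> \<pi> \<longleftrightarrow> \<pi> permutes {1..3} \<and>
     budget D \<epsilon> \<Omega> (\<pi> 1) \<le> budget D \<epsilon> \<Omega> (\<pi> 2) \<and> budget D \<epsilon> \<Omega> (\<pi> 2) \<le> budget D \<epsilon> \<Omega> (\<pi> 3)"

text \<open>
  Here \<open>c\<close> stands for the large absolute constant.  Results should assume an explicit numerical
  lower bound for it: an existentially quantified threshold could depend on the dimensions, which
  are types.
\<close>
primrec iter_prod :: "real \<Rightarrow> (nat \<Rightarrow> real) \<Rightarrow> nat \<Rightarrow> nat" where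
  "iter_prod c b 0 = 1"
| "iter_prod c b (Suc i) = iter_prod c b i * max 1 (nat \<lceil>c * b (Suc i) / real (iter_prod c b i)\<rceil>)"

definition iter_count :: "real \<Rightarrow> (nat \<Rightarrow> real) \<Rightarrow> nat \<Rightarrow> nat" where
  "iter_count c b i = max 1 (nat \<lceil>c * b i / real (iter_prod c b (i - 1))\<rceil>)"

text \<open>
  \<open>delta_tol\<close> is \<open>delta_f\<close> for component \<open>1\<close> and \<open>delta_g\<close> for component \<open>2\<close>;
  \<open>holder_smooth H \<nu> L \<delta>\<close> is the smoothness constant of the inexact model, \<open>L\<close> if \<open>\<nu> = 1\<close>.
\<close>
definition delta_tol :: "('x::finite, 'y::finite) saddle_data \<Rightarrow> real \<Rightarrow> real \<Rightarrow> real
    \<Rightarrow> (nat \<Rightarrow> nat) \<Rightarrow> nat \<Rightarrow> real" where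
  "delta_tol D \<epsilon> c \<Omega> \<pi> i =
     \<Omega> / (384 * real (iter_prod c (\<lambda>l. budget D \<epsilon> \<Omega> (\<pi> l)) (inv \<pi> i)))"

definition holder_smooth :: "real \<Rightarrow> real \<Rightarrow> real \<Rightarrow> real \<Rightarrow> real" where
  "holder_smooth H \<nu> L \<delta> =
     (if \<nu> = 1 then L
      else ((1 - \<nu>) / (2 * (1 + \<nu>) * \<delta>)) powr ((1 - \<nu>) / (1 + \<nu>)) * H powr (2 / (1 + \<nu>)))"

definition p3 :: "('x::finite, 'y::finite) saddle_data \<Rightarrow> real
    \<Rightarrow> (real^'x) \<times> (real^'y) \<Rightarrow> (real^'x) \<times> (real^'y) \<Rightarrow> real" where
  "p3 D \<epsilon> z_in z =
     beta_x_reg D \<epsilon> / 2 * (norm (matB D *v fst z - g_reg_sub D \<epsilon> (snd z_in)))\<^sup>2 +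
     beta_y_reg D \<epsilon> / 2 * (norm (transpose (matB D) *v snd z + fsub D (fst z_in)))\<^sup>2"

definition grad_p3 :: "('x::finite, 'y::finite) saddle_data \<Rightarrow> real
    \<Rightarrow> (real^'x) \<times> (real^'y) \<Rightarrow> (real^'x) \<times> (real^'y) \<Rightarrow> (real^'x) \<times> (real^'y)" where
  "grad_p3 D \<epsilon> z_in z =
     (beta_x_reg D \<epsilon> *\<^sub>R
        (transpose (matB D) *v (matB D *v fst z - g_reg_sub D \<epsilon> (snd z_in))),
      beta_y_reg D \<epsilon> *\<^sub>R
        (matB D *v (transpose (matB D) *v snd z + fsub D (fst z_in))))"

lemma gderiv_p3: "GDERIV (p3 D \<epsilon> z_in) z :> grad_p3 D \<epsilon> z_in z"
proof -
  have 1: "((\<lambda>z. matB D *v fst z - b) has_derivative (\<lambda>h. matB D *v fst h)) (at z)" for b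
    using has_derivative_diff[OF bounded_linear_imp_has_derivative[OF bounded_linear_compose[OF
          matrix_vector_mul_bounded_linear[of "matB D"] bounded_linear_fst]] has_derivative_const[of b]]
    by simp
  have 2: "((\<lambda>z. transpose (matB D) *v snd z + b) has_derivative
      (\<lambda>h. transpose (matB D) *v snd h)) (at z)" for b
    using has_derivative_add[OF bounded_linear_imp_has_derivative[OF bounded_linear_compose[OF
          matrix_vector_mul_bounded_linear[of "transpose (matB D)"] bounded_linear_snd]] has_derivative_const[of b]]
    by (simp del: transpose_matrix_vector)
  have adj: "(A *v v) \<bullet> u = v \<bullet> (transpose A *v u)" for A :: "real^'i^'j" and u v
    by (metis dot_lmul_matrix inner_commute vector_transpose_matrix)
  let ?u = "\<lambda>z. matB D *v fst z - g_reg_sub D \<epsilon> (snd z_in)"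
  let ?w = "\<lambda>z. transpose (matB D) *v snd z + fsub D (fst z_in)"
  have "(p3 D \<epsilon> z_in has_derivative
      (\<lambda>h. beta_x_reg D \<epsilon> / 2 * (?u z \<bullet> (matB D *v fst h) + (matB D *v fst h) \<bullet> ?u z) +
           beta_y_reg D \<epsilon> / 2 * (?w z \<bullet> (transpose (matB D) *v snd h)
             + (transpose (matB D) *v snd h) \<bullet> ?w z))) (at z)"
    unfolding p3_def power2_norm_eq_inner
    by (intro has_derivative_add has_derivative_mult_right has_derivative_inner 1 2)
  moreover have "beta_x_reg D \<epsilon> / 2 * (?u z \<bullet> (matB D *v fst h) + (matB D *v fst h) \<bullet> ?u z) +
      beta_y_reg D \<epsilon> / 2 * (?w z \<bullet> (transpose (matB D) *v snd h)
        + (transpose (matB D) *v snd h) \<bullet> ?w z) = h \<bullet> grad_p3 D \<epsilon> z_in z" for h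
    by (simp only: inner_commute[of "?u z"] inner_commute[of "?w z"] adj transpose_transpose
        grad_p3_def inner_prod_def fst_conv snd_conv inner_scaleR_right) (simp only: field_simps, simp)
  ultimately show ?thesis
    unfolding gderiv_def by (simp only:)
qed

text \<open>
  Costs: one evaluation of \<open>f'\<close> or \<open>g'\<close> for the first two components, four products for
  \<open>grad_p3\<close> (given the stored \<open>g_reg_sub D \<epsilon> y_in\<close> and \<open>fsub D x_in\<close>), two for \<open>Q_3\<close>.
\<close>
definition stage_component :: "('x::finite, 'y::finite) saddle_data \<Rightarrow> real \<Rightarrow> real \<Rightarrow> real
    \<Rightarrow> (nat \<Rightarrow> nat) \<Rightarrow> (real^'x) \<times> (real^'y) \<Rightarrow> nat \<Rightarrow> ((real^'x) \<times> (real^'y)) component" where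
  "stage_component D \<epsilon> c \<Omega> \<pi> z_in i =
     (if i = 1 then
        \<lparr>grad_oracle = (\<lambda>z. ((fsub D (fst z), 0), (1, 0, 0))),
         Q_oracle = (\<lambda>z. (0, 0)),
         smooth_const =
           holder_smooth (H_x D) (nu_x D) (H_x D) (delta_tol D \<epsilon> c \<Omega> \<pi> 1) / delta_x_reg D \<epsilon>,
         lip_const = 0\<rparr>
      else if i = 2 then
        \<lparr>grad_oracle = (\<lambda>z. ((0, g_reg_sub D \<epsilon> (snd z)), (0, 1, 0))),
         Q_oracle = (\<lambda>z. (0, 0)),
         smooth_const =
           holder_smooth (H_y_reg D \<epsilon>) (nu_y D) (H_y D + lambda_y D \<epsilon>) (delta_tol D \<epsilon> c \<Omega> \<pi> 2)
             / lambda_y D \<epsilon>,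
         lip_const = 0\<rparr>
      else
        \<lparr>grad_oracle = (\<lambda>z. (grad_p3 D \<epsilon> z_in z, (0, 0, 4))),
         Q_oracle = (\<lambda>z. ((transpose (matB D) *v snd z, - (matB D *v fst z)), (0, 0, 2))),
         smooth_const = kappa_xy D \<epsilon>,
         lip_const = sqrt (kappa_xy D \<epsilon>)\<rparr>)"

text \<open>
  The additional cost \<open>(1, 1, 0)\<close> is for \<open>fsub D x_in\<close> and \<open>gsub D y_in\<close>, which enter
  \<open>grad_p3\<close>; it is charged even if \<open>beta_y_reg\<close> or \<open>beta_x_reg\<close> vanishes.
\<close>
definition stage :: "('x::finite, 'y::finite) saddle_data \<Rightarrow> real \<Rightarrow> real \<Rightarrow> real
    \<Rightarrow> (nat \<Rightarrow> nat) \<Rightarrow> (real^'x) \<times> (real^'y) \<Rightarrow> ((real^'x) \<times> (real^'y)) \<times> calls" where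
  "stage D \<epsilon> c \<Omega> \<pi> z_in =
     (let (z, k) = sliding (domZ D) (P_norm_sq D \<epsilon>) 3
                     (\<lambda>l. stage_component D \<epsilon> c \<Omega> \<pi> z_in (\<pi> l))
                     (iter_count c (\<lambda>l. budget D \<epsilon> \<Omega> (\<pi> l))) z_in
      in (z, k + (1, 1, 0)))"


section \<open>The restarted algorithm\<close>

definition kappa_hat :: "('x::finite, 'y::finite) saddle_data \<Rightarrow> real \<Rightarrow> real" where
  "kappa_hat D \<epsilon> = (L_xy D)\<^sup>2 / (delta_x_reg D \<epsilon> * lambda_y D \<epsilon>)"

definition kappa_hat_mu :: "('x::finite, 'y::finite) saddle_data \<Rightarrow> real \<Rightarrow> real" where
  "kappa_hat_mu D \<epsilon> = (L_xy D)\<^sup>2 / (mu_x D * lambda_y D \<epsilon>)"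

definition eps_star :: "('x::finite, 'y::finite) saddle_data \<Rightarrow> real \<Rightarrow> real" where
  "eps_star D \<epsilon> =
     (if 0 < mu_x D then \<epsilon> / (2 * (1/6 + 1/2 * kappa_hat D \<epsilon> + 1/2 * kappa_hat_mu D \<epsilon>))
      else if diameter (domX D) = 0 then \<epsilon> / (4 * (1/6 + 1/2 * kappa_hat D \<epsilon>))
      else min (\<epsilon> / (4 * (1/6 + 1/2 * kappa_hat D \<epsilon>)))
               (lambda_y D \<epsilon> * \<epsilon>\<^sup>2 / (16 * (L_xy D)\<^sup>2 * (diameter (domX D))\<^sup>2)))"

definition Gamma_ratio :: "('x::finite, 'y::finite) saddle_data \<Rightarrow> real \<Rightarrow> real" where
  "Gamma_ratio D \<epsilon> = \<epsilon> / eps_star D \<epsilon>"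

definition restarts ::
    "('x::finite, 'y::finite) saddle_data \<Rightarrow> real \<Rightarrow> ('x, 'y) saddle_ref \<Rightarrow> nat" where
  "restarts D \<epsilon> r =
     (if Psi0 D \<epsilon> r \<le> eps_star D \<epsilon> then 0
      else nat \<lceil>ln (Psi0 D \<epsilon> r / eps_star D \<epsilon>) / ln (4 / 3)\<rceil>)"

definition stage_Omega ::
    "('x::finite, 'y::finite) saddle_data \<Rightarrow> real \<Rightarrow> ('x, 'y) saddle_ref \<Rightarrow> nat \<Rightarrow> real" where
  "stage_Omega D \<epsilon> r s = (3 / 4) ^ s * Psi0 D \<epsilon> r"

primrec run_stages :: "('x::finite, 'y::finite) saddle_data \<Rightarrow> real \<Rightarrow> real \<Rightarrow> ('x, 'y) saddle_ref
    \<Rightarrow> (nat \<Rightarrow> nat \<Rightarrow> nat) \<Rightarrow> nat \<Rightarrow> ((real^'x) \<times> (real^'y)) \<times> calls" where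
  "run_stages D \<epsilon> c r \<pi> 0 = (z_init D, 0)"
| "run_stages D \<epsilon> c r \<pi> (Suc s) =
     (let (z, k) = run_stages D \<epsilon> c r \<pi> s;
          (z', k') = stage D \<epsilon> c (stage_Omega D \<epsilon> r s) (\<pi> s) z
      in (z', k + k'))"

definition restarted_sliding :: "('x::finite, 'y::finite) saddle_data \<Rightarrow> real \<Rightarrow> real
    \<Rightarrow> ('x, 'y) saddle_ref \<Rightarrow> (nat \<Rightarrow> nat \<Rightarrow> nat) \<Rightarrow> ((real^'x) \<times> (real^'y)) \<times> calls" where
  "restarted_sliding D \<epsilon> c r \<pi> = run_stages D \<epsilon> c r \<pi> (restarts D \<epsilon> r)"

definition output_point :: "('x::finite, 'y::finite) saddle_data \<Rightarrow> real \<Rightarrow> real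
    \<Rightarrow> ('x, 'y) saddle_ref \<Rightarrow> (nat \<Rightarrow> nat \<Rightarrow> nat) \<Rightarrow> (real^'x) \<times> (real^'y)" where
  "output_point D \<epsilon> c r \<pi> = fst (restarted_sliding D \<epsilon> c r \<pi>)"

definition N_f_tot :: "('x::finite, 'y::finite) saddle_data \<Rightarrow> real \<Rightarrow> real
    \<Rightarrow> ('x, 'y) saddle_ref \<Rightarrow> (nat \<Rightarrow> nat \<Rightarrow> nat) \<Rightarrow> nat" where
  "N_f_tot D \<epsilon> c r \<pi> = fst (snd (restarted_sliding D \<epsilon> c r \<pi>))"

definition N_g_tot :: "('x::finite, 'y::finite) saddle_data \<Rightarrow> real \<Rightarrow> real
    \<Rightarrow> ('x, 'y) saddle_ref \<Rightarrow> (nat \<Rightarrow> nat \<Rightarrow> nat) \<Rightarrow> nat" where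
  "N_g_tot D \<epsilon> c r \<pi> = fst (snd (snd (restarted_sliding D \<epsilon> c r \<pi>)))"

definition N_B_tot :: "('x::finite, 'y::finite) saddle_data \<Rightarrow> real \<Rightarrow> real
    \<Rightarrow> ('x, 'y) saddle_ref \<Rightarrow> (nat \<Rightarrow> nat \<Rightarrow> nat) \<Rightarrow> nat" where
  "N_B_tot D \<epsilon> c r \<pi> = snd (snd (snd (restarted_sliding D \<epsilon> c r \<pi>)))"


section \<open>Complexity bounds\<close>

text \<open>\<open>log_factor\<close> is the factor hidden by the soft-O notation.\<close>
definition log_factor ::
    "('x::finite, 'y::finite) saddle_data \<Rightarrow> real \<Rightarrow> ('x, 'y) saddle_ref \<Rightarrow> real" where
  "log_factor D \<epsilon> r = 1 + max 0 (ln (Psi0 D \<epsilon> r * Gamma_ratio D \<epsilon> / \<epsilon>))"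

definition N_f :: "('x::finite, 'y::finite) saddle_data \<Rightarrow> real \<Rightarrow> ('x, 'y) saddle_ref \<Rightarrow> real" where
  "N_f D \<epsilon> r =
     (if nu_x D < 1 then H_x_tilde D \<epsilon> powr (2 / (1 + 3 * nu_x D)) * \<epsilon> powr (- alpha_x D)
      else sqrt (kappa_x D \<epsilon>) * log_factor D \<epsilon> r)"

definition N_g :: "('x::finite, 'y::finite) saddle_data \<Rightarrow> real \<Rightarrow> ('x, 'y) saddle_ref \<Rightarrow> real" where
  "N_g D \<epsilon> r =
     (if nu_y D < 1 then
        (H_y_reg D \<epsilon> * Omega_y D powr ((1 + nu_y D) / 2) / \<epsilon>) powr (2 / (1 + 3 * nu_y D))
      else sqrt (1 + H_y D * Omega_y D / \<epsilon>) * log_factor D \<epsilon> r)"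

definition N_B :: "('x::finite, 'y::finite) saddle_data \<Rightarrow> real \<Rightarrow> ('x, 'y) saddle_ref \<Rightarrow> real" where
  "N_B D \<epsilon> r = L_xy D * sqrt (Omega_y D / (delta_x_reg D \<epsilon> * \<epsilon>)) * log_factor D \<epsilon> r"

end

theory Submission
  imports Defs
begin

text \<open>
  The gap bound rests on one contraction: a stage started at a point with potential at most
  \<open>\<Omega>\<close> ends at a point with potential at most \<open>3/4 * \<Omega>\<close> (\<open>stage_contraction\<close>).

  The contraction has two ingredients.  The first concerns the sliding scheme for arbitrary
  components and any number of levels (\<open>sliding_rec_bound\<close>).  With the outer levels
  held fixed, a recursive call at level \<open>k\<close> is an inexact prox step: its result obeys the
  three-point inequality of the linearized components of the levels up to \<open>k\<close>, plus the function
  gaps of the deeper components, up to a difference of squared distances which telescopes over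
  successive calls, because the prox centres of the deeper levels are carried over.  One level is
  peeled off by the usual estimate for an accelerated gradient step combined with an
  extragradient step (\<open>accelerated_step\<close>).  In the end component \<open>i\<close> costs \<open>O(L_i / A_i^2 + M_i / A_i)\<close>
  times the squared distance of the starting point, plus \<open>A_i\<close> times its inexactness, where \<open>A_i\<close>
  is the number of passes through level \<open>i\<close>.  The budgets are chosen to make these terms small.

  The second ingredient explains the component \<open>p3\<close>.  By cocoercivity of the two gradients, its
  value at the saddle point is at most a quarter of the Bregman distances of the starting point,
  while its value at the output bounds \<open>norm (B (x - x*))\<close> squared up to that quantity and so
  supplies the missing strong convexity in \<open>x\<close>.  If the range condition is invoked, this needs
  \<open>x - x*\<close> to stay in the range of the transpose of \<open>B\<close>; prox steps preserve this because the domain is invariant under the kernel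
  of \<open>B\<close> and all gradients lie in that range (\<open>prox_step\<close>).

  The potential bounds the gap: the regularized Lagrangian differs from its saddle value by Bregman
  distances and a bilinear term, which Young's inequality or boundedness absorbs (\<open>gap_bound\<close>), and the
  regularization changes the objective by at most \<open>\<epsilon> / 2\<close>.

  For the complexity, component \<open>j\<close> is evaluated \<open>A\<close> times per stage up to a constant factor, and \<open>A\<close>
  is at most a multiple of its budget because the levels are sorted (\<open>iter_prod_le\<close>).  Stage targets
  decrease geometrically and stay above the terminal target, so budgets with a positive exponent sum
  to a multiple of the last one and the others give the factor of the number of stages.  The bound
  \<open>1\<close> from below in the budgets contributes the number of stages, which is logarithmic in \<open>1 / \<epsilon>\<close>
  because the initial potential is bounded uniformly in \<open>\<epsilon>\<close> (\<open>Psi0_bounded\<close>).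
\<close>

section \<open>Proximal steps\<close>

lemma linear_coeff_nonneg:
  fixes a b :: real
  assumes "\<And>t. 0 < t \<Longrightarrow> t \<le> 1 \<Longrightarrow> 0 \<le> t * a + t\<^sup>2 * b"
  shows "0 \<le> a"
proof (rule tendsto_lowerbound)
  show "((\<lambda>t. a + t * b) \<longlongrightarrow> a) (at_right 0)"
    by (auto intro!: tendsto_eq_intros)
  have "0 \<le> a + t * b" if "0 < t" "t \<le> 1" for t
  proof -
    have "0 \<le> t * (a + t * b)" using assms[OF that] by (simp add: algebra_simps power2_eq_square)
    then show ?thesis using that by (simp add: zero_le_mult_iff)
  qed
  then show "\<forall>\<^sub>F t in at_right 0. 0 \<le> a + t * b"
    unfolding eventually_at_right_field by (intro exI[of _ 1]) auto
qed simp

lemma coercive_attains_min: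
  fixes \<phi> :: "'a::euclidean_space \<Rightarrow> real"
  assumes Z: "closed Z" "Z \<noteq> {}" and cont: "continuous_on UNIV \<phi>" and a: "0 < a"
    and low: "\<And>z. a * (norm z)\<^sup>2 - K * norm z - C \<le> \<phi> z"
  shows "\<exists>x\<in>Z. \<forall>y\<in>Z. \<phi> x \<le> \<phi> y"
proof -
  obtain z0 where z0: "z0 \<in> Z" using Z by blast
  define \<rho> where "\<rho> = 1 + (\<bar>K\<bar> + \<bar>C\<bar> + \<bar>\<phi> z0\<bar>) / a + norm z0"
  have big: "\<phi> z0 < \<phi> z" if "\<rho> < norm z" for z
  proof -
    have "(\<bar>K\<bar> + \<bar>C\<bar> + \<bar>\<phi> z0\<bar>) / a < norm z" "1 < norm z"
      using that a unfolding \<rho>_def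
      by (smt (verit) divide_nonneg_pos norm_ge_zero abs_ge_zero)+
    then have 1: "\<bar>K\<bar> + \<bar>C\<bar> + \<bar>\<phi> z0\<bar> < a * norm z" and 2: "1 < norm z"
      using a by (simp_all add: field_simps)
    have "\<bar>C\<bar> + \<bar>\<phi> z0\<bar> < a * norm z - K" using 1 by linarith
    also have "\<dots> \<le> norm z * (a * norm z - K)"
      using 1 2 by (smt (verit) mult_le_cancel_right1 abs_ge_zero)
    also have "\<dots> = a * (norm z)\<^sup>2 - K * norm z" by (simp add: algebra_simps power2_eq_square)
    finally show ?thesis using low[of z] by linarith
  qed
  have "compact (Z \<inter> cball 0 \<rho>)" using Z by (simp add: closed_Int_compact)
  moreover have "norm z0 \<le> \<rho>" unfolding \<rho>_def using a
    by (smt (verit) divide_nonneg_pos abs_ge_zero)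
  then have "z0 \<in> Z \<inter> cball 0 \<rho>" using z0 by simp
  ultimately obtain x where x: "x \<in> Z \<inter> cball 0 \<rho>" "\<forall>y\<in>Z \<inter> cball 0 \<rho>. \<phi> x \<le> \<phi> y"
    using continuous_attains_inf[of "Z \<inter> cball 0 \<rho>" \<phi>] cont
    by (metis continuous_on_subset empty_iff top_greatest)
  have "\<phi> x \<le> \<phi> y" if "y \<in> Z" for y
  proof (cases "norm y \<le> \<rho>")
    case True then show ?thesis using x that by simp
  next
    case False then show ?thesis using big[of y] x(2) \<open>z0 \<in> Z \<inter> cball 0 \<rho>\<close>
      by (meson less_le_not_le linorder_le_cases not_le order_trans)
  qed
  then show ?thesis using x by blast
qed

text \<open>
  The norm of the prox steps is \<open>norm (G z)\<close>.  The iterates live in \<open>zref + R\<close>; the last two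
  assumptions say that moving orthogonally to \<open>R\<close> stays in \<open>Z\<close> and is also orthogonal for the prox
  norm.  The case without a range condition is \<open>R = UNIV\<close>, where such a move is zero.
\<close>
locale prox_geometry =
  fixes Z :: "'z::euclidean_space set" and G :: "'z \<Rightarrow> 'z" and R :: "'z set" and zref :: 'z
  assumes closed_Z: "closed Z" and convex_Z: "convex Z" and Z_ne: "Z \<noteq> {}"
    and linear_G: "linear G" and inj_G: "inj G"
    and subspace_R: "subspace R"
    and Z_shift: "\<And>z k. z \<in> Z \<Longrightarrow> (\<And>u. u \<in> R \<Longrightarrow> k \<bullet> u = 0) \<Longrightarrow> z + k \<in> Z"
    and G_orth: "\<And>u k. u \<in> R \<Longrightarrow> (\<And>u. u \<in> R \<Longrightarrow> k \<bullet> u = 0) \<Longrightarrow> G u \<bullet> G k = 0"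
begin

definition nsq :: "'z \<Rightarrow> real" where
  "nsq z = (norm (G z))\<^sup>2"

definition ZR :: "'z set" where
  "ZR = {z \<in> Z. z - zref \<in> R}"

lemma nsq_nonneg [simp]: "0 \<le> nsq z"
  by (simp add: nsq_def)

lemma nsq_inner: "nsq z = G z \<bullet> G z"
  by (simp add: nsq_def power2_norm_eq_inner)

lemmas G_lin = linear_add[OF linear_G] linear_diff[OF linear_G] linear_cmul[OF linear_G] linear_neg[OF linear_G]

lemma nsq_minus_commute: "nsq (u - v) = nsq (v - u)"
  unfolding nsq_def by (simp add: G_lin norm_minus_commute)

lemma nsq_scale: "nsq (t *\<^sub>R u) = t\<^sup>2 * nsq u"
  by (simp add: nsq_def G_lin power_mult_distrib)

lemma nsq_three_point:
  "2 * (G (x - c) \<bullet> G (z - x)) = nsq (z - c) - nsq (x - c) - nsq (z - x)"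
  by (simp add: nsq_inner G_lin inner_diff_left inner_diff_right inner_commute algebra_simps)

lemma nsq_convex:
  assumes "0 \<le> t" "t \<le> 1"
  shows "nsq (t *\<^sub>R u + (1 - t) *\<^sub>R v - c) \<le> t * nsq (u - c) + (1 - t) * nsq (v - c)"
proof -
  have "t * nsq (u - c) + (1 - t) * nsq (v - c) - nsq (t *\<^sub>R u + (1 - t) *\<^sub>R v - c)
      = t * (1 - t) * nsq (u - v)"
    by (simp add: nsq_inner G_lin inner_diff_left inner_diff_right inner_add_left inner_add_right
        inner_commute algebra_simps)
  then show ?thesis using assms
    by (smt (verit) mult_nonneg_nonneg nsq_nonneg)
qed

lemma ZR_convex: "convex ZR"
proof -
  have "ZR = Z \<inter> (\<lambda>z. z - zref) -` R" by (auto simp: ZR_def)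
  moreover have "(\<lambda>z. z - zref) -` R = (+) zref ` R"
    by (auto simp: image_iff) (metis add.commute diff_add_cancel)
  ultimately show ?thesis
    using convex_Int[OF convex_Z] convex_translation[OF subspace_imp_convex[OF subspace_R], of zref]
    by simp
qed

lemma ZR_convexD: "u \<in> ZR \<Longrightarrow> v \<in> ZR \<Longrightarrow> 0 \<le> t \<Longrightarrow> t \<le> 1 \<Longrightarrow> t *\<^sub>R u + (1 - t) *\<^sub>R v \<in> ZR"
  using ZR_convex unfolding convex_def by simp

text \<open>
  The inequality is the first-order optimality condition \<open>vi\<close> at the minimizer, rewritten by the
  three-point identity.  For the membership, the component of \<open>x - zref\<close> orthogonal to \<open>R\<close> can be
  removed without leaving \<open>Z\<close>, and optimality in that direction forces it to vanish.
\<close>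
lemma prox_step:
  fixes v c :: "'i \<Rightarrow> 'z" and \<eta> :: "'i \<Rightarrow> real"
  assumes fin: "finite I" and \<eta>: "\<And>i. i \<in> I \<Longrightarrow> 0 \<le> \<eta> i" and pos: "0 < sum \<eta> I"
    and x_def: "x = arg_min_on (\<lambda>z. \<Sum>i\<in>I. v i \<bullet> z + \<eta> i / 2 * nsq (z - c i)) Z"
  shows prox_ineq: "\<And>z. z \<in> Z \<Longrightarrow>
      (\<Sum>i\<in>I. v i \<bullet> (x - z) + \<eta> i / 2 * (nsq (x - c i) + nsq (x - z) - nsq (z - c i))) \<le> 0"
    and prox_ZR: "(\<And>i. i \<in> I \<Longrightarrow> v i \<in> R) \<Longrightarrow> (\<And>i. i \<in> I \<Longrightarrow> c i \<in> ZR) \<Longrightarrow> x \<in> ZR"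
proof -
  define \<phi> where "\<phi> = (\<lambda>z. \<Sum>i\<in>I. v i \<bullet> z + \<eta> i / 2 * nsq (z - c i))"
  obtain m where m: "0 < m" "\<And>z. m * norm z \<le> norm (G z)"
    using linear_inj_bounded_below_pos[OF linear_G inj_G] by (metis mult.commute)
  have "\<exists>x\<in>Z. \<forall>y\<in>Z. \<phi> x \<le> \<phi> y"
  proof (rule coercive_attains_min[OF closed_Z Z_ne])
    show "continuous_on UNIV \<phi>"
      unfolding \<phi>_def nsq_def
      by (intro continuous_intros linear_continuous_on_compose[OF _ linear_G])
    show "0 < sum \<eta> I / 4 * m\<^sup>2" using pos m by simp
    show "sum \<eta> I / 4 * m\<^sup>2 * (norm z)\<^sup>2 - (\<Sum>i\<in>I. norm (v i)) * norm z
        - (\<Sum>i\<in>I. \<eta> i / 2 * nsq (c i)) \<le> \<phi> z" for z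
    proof -
      have "\<eta> i / 4 * m\<^sup>2 * (norm z)\<^sup>2 - norm (v i) * norm z - \<eta> i / 2 * nsq (c i)
          \<le> v i \<bullet> z + \<eta> i / 2 * nsq (z - c i)" if i: "i \<in> I" for i
      proof -
        have 1: "- (norm (v i) * norm z) \<le> v i \<bullet> z"
          using Cauchy_Schwarz_ineq2[of "v i" z] by linarith
        have "0 \<le> (norm (G z - 2 *\<^sub>R G (c i)))\<^sup>2" by simp
        then have 2: "nsq z / 2 - nsq (c i) \<le> nsq (z - c i)"
          by (simp add: nsq_inner G_lin power2_norm_eq_inner inner_diff_left inner_diff_right
              inner_commute)
        have "m\<^sup>2 * (norm z)\<^sup>2 \<le> nsq z"
          unfolding nsq_def using power_mono[OF m(2)[of z], of 2] m(1)
          by (simp add: power_mult_distrib)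
        then have "m\<^sup>2 * (norm z)\<^sup>2 / 2 - nsq (c i) \<le> nsq (z - c i)" using 2 by linarith
        then have "\<eta> i / 2 * (m\<^sup>2 * (norm z)\<^sup>2 / 2 - nsq (c i)) \<le> \<eta> i / 2 * nsq (z - c i)"
          by (intro mult_left_mono) (use \<eta> i in auto)
        then show ?thesis using 1 by (simp add: algebra_simps)
      qed
      then have "(\<Sum>i\<in>I. \<eta> i / 4 * m\<^sup>2 * (norm z)\<^sup>2 - norm (v i) * norm z - \<eta> i / 2 * nsq (c i))
          \<le> \<phi> z"
        unfolding \<phi>_def by (intro sum_mono)
      then show ?thesis
        by (simp add: sum_subtractf sum_distrib_right[symmetric] sum_divide_distrib[symmetric])
    qed
  qed
  then have "\<exists>x. is_arg_min \<phi> (\<lambda>z. z \<in> Z) x"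
    by (auto simp: is_arg_min_linorder)
  then have "is_arg_min \<phi> (\<lambda>z. z \<in> Z) x"
    unfolding x_def \<phi>_def[symmetric] arg_min_on_def arg_min_def by (rule someI_ex)
  then have x: "x \<in> Z" and min: "\<And>z. z \<in> Z \<Longrightarrow> \<phi> x \<le> \<phi> z"
    by (auto simp: is_arg_min_linorder)
  define S where "S = sum \<eta> I"
  have vi: "0 \<le> (\<Sum>i\<in>I. v i \<bullet> (z - x) + \<eta> i * (G (x - c i) \<bullet> G (z - x)))" (is "0 \<le> ?L")
    if z: "z \<in> Z" for z
  proof (rule linear_coeff_nonneg)
    show "0 \<le> t * ?L + t\<^sup>2 * (S / 2 * nsq (z - x))" if t: "0 < t" "t \<le> 1" for t
    proof -
      have "x + t *\<^sub>R (z - x) = (1 - t) *\<^sub>R x + t *\<^sub>R z" by (simp add: algebra_simps)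
      then have "x + t *\<^sub>R (z - x) \<in> Z"
        using convexD[OF convex_Z x z, of "1 - t" t] t by simp
      then have "0 \<le> \<phi> (x + t *\<^sub>R (z - x)) - \<phi> x" using min by simp
      also have "\<dots> = (\<Sum>i\<in>I. t * (v i \<bullet> (z - x) + \<eta> i * (G (x - c i) \<bullet> G (z - x)))
           + t\<^sup>2 * (\<eta> i / 2 * nsq (z - x)))"
        unfolding \<phi>_def sum_subtractf[symmetric]
      proof (rule sum.cong[OF refl])
        fix i
        have "nsq (x + t *\<^sub>R (z - x) - c i)
            = nsq (x - c i) + 2 * t * (G (x - c i) \<bullet> G (z - x)) + t\<^sup>2 * nsq (z - x)"
          by (simp add: nsq_inner G_lin inner_diff_left inner_diff_right inner_add_left
              inner_add_right inner_commute algebra_simps power2_eq_square)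
        then show "v i \<bullet> (x + t *\<^sub>R (z - x)) + \<eta> i / 2 * nsq (x + t *\<^sub>R (z - x) - c i)
            - (v i \<bullet> x + \<eta> i / 2 * nsq (x - c i))
            = t * (v i \<bullet> (z - x) + \<eta> i * (G (x - c i) \<bullet> G (z - x))) + t\<^sup>2 * (\<eta> i / 2 * nsq (z - x))"
          by (simp add: inner_add_right algebra_simps)
      qed
      also have "\<dots> = t * ?L + t\<^sup>2 * (S / 2 * nsq (z - x))"
        unfolding S_def sum.distrib[of "\<lambda>i. t * _ i"]
        by (simp only: sum_distrib_left[symmetric] sum_distrib_right[symmetric]
            sum_divide_distrib[symmetric])
      finally show ?thesis .
    qed
  qed
  show "(\<Sum>i\<in>I. v i \<bullet> (x - z) + \<eta> i / 2 * (nsq (x - c i) + nsq (x - z) - nsq (z - c i))) \<le> 0"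
    if z: "z \<in> Z" for z
  proof -
    have "(\<Sum>i\<in>I. v i \<bullet> (x - z) + \<eta> i / 2 * (nsq (x - c i) + nsq (x - z) - nsq (z - c i)))
        = (\<Sum>i\<in>I. - (v i \<bullet> (z - x) + \<eta> i * (G (x - c i) \<bullet> G (z - x))))"
    proof (rule sum.cong[OF refl])
      fix i
      have "nsq (x - c i) + nsq (x - z) - nsq (z - c i) = - 2 * (G (x - c i) \<bullet> G (z - x))"
        using nsq_three_point[of x "c i" z] nsq_minus_commute[of x z] by simp
      then show "v i \<bullet> (x - z) + \<eta> i / 2 * (nsq (x - c i) + nsq (x - z) - nsq (z - c i))
          = - (v i \<bullet> (z - x) + \<eta> i * (G (x - c i) \<bullet> G (z - x)))"
        by (simp add: inner_diff_right)
    qed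
    then show ?thesis using vi[OF z] by (simp only: sum_negf neg_le_0_iff_le)
  qed
  show "x \<in> ZR" if vR: "\<And>i. i \<in> I \<Longrightarrow> v i \<in> R" and cR: "\<And>i. i \<in> I \<Longrightarrow> c i \<in> ZR"
  proof -
    obtain a k where ak: "a \<in> span R" "\<And>w. w \<in> span R \<Longrightarrow> orthogonal k w" "x - zref = a + k"
      using orthogonal_subspace_decomp_exists[of R "x - zref"] by metis
    have a: "a \<in> R" using ak(1) span_eq_iff subspace_R by blast
    have k: "k \<bullet> u = 0" if "u \<in> R" for u
      using ak(2)[of u] that by (simp add: orthogonal_def span_base)
    have mem: "x - k \<in> Z" using Z_shift[OF x, of "- k"] k by simp
    have "v i \<bullet> (x - k - x) + \<eta> i * (G (x - c i) \<bullet> G (x - k - x)) = - (\<eta> i * nsq k)" if i: "i \<in> I" for i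
    proof -
      have "v i \<bullet> k = 0" using k[OF vR[OF i]] by (simp add: inner_commute)
      have "a - (c i - zref) \<in> R" using a cR[OF i] subspace_diff[OF subspace_R] by (auto simp: ZR_def)
      then have "G (a - (c i - zref)) \<bullet> G k = 0" using G_orth k by blast
      moreover have "x - c i = (a - (c i - zref)) + k" using ak(3) by (simp add: algebra_simps)
      ultimately have "G (x - c i) \<bullet> G k = nsq k"
        by (simp only: nsq_inner G_lin(1) inner_add_left)
      then show ?thesis using \<open>v i \<bullet> k = 0\<close> by (simp add: G_lin)
    qed
    then have "0 \<le> (\<Sum>i\<in>I. - (\<eta> i * nsq k))" using vi[OF mem] by simp
    then have "sum \<eta> I * nsq k \<le> 0" by (simp add: sum_negf sum_distrib_right)
    then have "nsq k = 0" using pos nsq_nonneg[of k]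
      by (smt (verit) mult_pos_pos)
    then have "G k = G 0" using linear_0[OF linear_G] by (simp add: nsq_def)
    then have "k = 0" using inj_G by (simp add: inj_def)
    then show ?thesis using ak(3) a x by (simp add: ZR_def)
  qed
qed

end

section \<open>The step sizes\<close>

lemma step_size_pos: "0 < step_size t"
proof (induction t)
  case (Suc t)
  have "0 \<le> sqrt (1 + 4 / (step_size t)\<^sup>2)" by simp
  then show ?case by (simp add: add_pos_nonneg)
qed simp

lemma step_size_inverse_Suc:
  "1 / step_size (Suc t) = (1 + sqrt (1 + 4 * (1 / step_size t)\<^sup>2)) / 2"
  by (simp add: power_one_over)

text \<open>With \<open>\<tau> = 1 / step_size\<close> this is \<open>\<tau>'\<^sup>2 - \<tau>' = \<tau>\<^sup>2\<close>, so that \<open>\<tau>\<^sup>2\<close> is the sum of the \<open>\<tau>\<close> up to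
  the current index.\<close>
lemma step_size_recurrence:
  "(1 - step_size (Suc t)) / (step_size (Suc t))\<^sup>2 = 1 / (step_size t)\<^sup>2"
proof -
  define \<tau> where "\<tau> = 1 / step_size t"
  define \<tau>' where "\<tau>' = 1 / step_size (Suc t)"
  have e: "\<tau>' = (1 + sqrt (1 + 4 * \<tau>\<^sup>2)) / 2"
    unfolding \<tau>_def \<tau>'_def by (rule step_size_inverse_Suc)
  have "(sqrt (1 + 4 * \<tau>\<^sup>2))\<^sup>2 = 1 + 4 * \<tau>\<^sup>2" by simp
  then have "\<tau>'\<^sup>2 - \<tau>' = \<tau>\<^sup>2"
    unfolding e by (simp add: power2_eq_square field_simps)
  moreover have "(1 - step_size (Suc t)) / (step_size (Suc t))\<^sup>2 = \<tau>'\<^sup>2 - \<tau>'"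
    using step_size_pos[of "Suc t"] unfolding \<tau>'_def by (simp add: field_simps power2_eq_square del: step_size.simps)
  ultimately show ?thesis by (simp add: \<tau>_def power_one_over)
qed

lemma step_size_inverse_ge: "(real t + 2) / 2 \<le> 1 / step_size t"
proof (induction t)
  case (Suc t)
  have "2 * (1 / step_size t) \<le> sqrt (1 + 4 * (1 / step_size t)\<^sup>2)"
    by (rule real_le_rsqrt) (simp add: power_divide)
  then show ?case using Suc unfolding step_size_inverse_Suc by simp
qed simp

lemma step_size_le: "step_size t \<le> 2 / (real t + 2)"
  using step_size_inverse_ge[of t] step_size_pos[of t] by (simp add: field_simps)

lemma step_size_le_1: "step_size t \<le> 1"
  using step_size_le[of t] by (smt (verit) divide_le_eq_1 of_nat_0_le_iff)

lemma step_size_decseq: "s \<le> t \<Longrightarrow> step_size t \<le> step_size s"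
proof (induction t rule: dec_induct)
  case (step t)
  have "1 / step_size t \<le> 1 / step_size (Suc t)"
  proof -
    have "2 * (1 / step_size t) \<le> sqrt (1 + 4 * (1 / step_size t)\<^sup>2)"
      by (rule real_le_rsqrt) (simp add: power_divide)
    then show ?thesis unfolding step_size_inverse_Suc by simp
  qed
  then have "step_size (Suc t) \<le> step_size t"
    using step_size_pos[of t] step_size_pos[of "Suc t"] by (simp add: field_simps del: step_size.simps)
  then show ?case using step by simp
qed simp


section \<open>Convergence of the recursive sliding scheme\<close>

locale sliding_problem = prox_geometry Z G R zref
  for Z :: "'z::euclidean_space set" and G R zref +
  fixes n :: nat and lev :: "nat \<Rightarrow> 'z component" and T :: "nat \<Rightarrow> nat"
    and p :: "nat \<Rightarrow> 'z \<Rightarrow> real" and d :: "nat \<Rightarrow> real"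
  assumes n_pos: "1 \<le> n"
    and T_pos: "\<And>i. 1 \<le> T i"
    and L_pos: "\<And>i. i \<in> {1..n} \<Longrightarrow> 0 < smooth_const (lev i)"
    and M_nonneg: "\<And>i. i \<in> {1..n} \<Longrightarrow> 0 \<le> lip_const (lev i)"
    and d_nonneg: "\<And>i. i \<in> {1..n} \<Longrightarrow> 0 \<le> d i"
    and p_subgradient: "\<And>i w z. i \<in> {1..n} \<Longrightarrow> w \<in> ZR \<Longrightarrow> z \<in> ZR \<Longrightarrow>
      p i w + fst (grad_oracle (lev i) w) \<bullet> (z - w) \<le> p i z"
    and p_smooth: "\<And>i w u. i \<in> {1..n} \<Longrightarrow> w \<in> ZR \<Longrightarrow> u \<in> ZR \<Longrightarrow>
      p i u \<le> p i w + fst (grad_oracle (lev i) w) \<bullet> (u - w)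
                + smooth_const (lev i) / 2 * nsq (u - w) + d i"
    and grad_R: "\<And>i w. i \<in> {1..n} \<Longrightarrow> w \<in> ZR \<Longrightarrow> fst (grad_oracle (lev i) w) \<in> R"
    and Q_R: "\<And>i z. i \<in> {1..n} \<Longrightarrow> z \<in> ZR \<Longrightarrow> fst (Q_oracle (lev i) z) \<in> R"
    and Q_mono: "\<And>i u v. i \<in> {1..n} \<Longrightarrow> u \<in> ZR \<Longrightarrow> v \<in> ZR \<Longrightarrow>
      0 \<le> (fst (Q_oracle (lev i) u) - fst (Q_oracle (lev i) v)) \<bullet> (u - v)"
    and Q_lip: "\<And>i u v h. i \<in> {1..n} \<Longrightarrow> u \<in> ZR \<Longrightarrow> v \<in> ZR \<Longrightarrow>
      (fst (Q_oracle (lev i) u) - fst (Q_oracle (lev i) v)) \<bullet> h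
        \<le> lip_const (lev i) * norm (G (u - v)) * norm (G h)"
begin

abbreviation "grad i w \<equiv> fst (grad_oracle (lev i) w)"
abbreviation "Q i z \<equiv> fst (Q_oracle (lev i) z)"
abbreviation "L i \<equiv> smooth_const (lev i)"
abbreviation "M i \<equiv> lip_const (lev i)"

text \<open>
  \<open>A\<close> is the averaging map of the outer levels, which scales by \<open>\<pi>\<close>, so the scaled function is
  \<open>p i (A z) / \<pi>\<close>.  The point \<open>zt\<close> is the result of the inner call and \<open>zn\<close> the extragradient
  correction.  The part \<open>L i * \<pi> * \<alpha>\<close> of \<open>\<eta>\<close> pays for the smoothness error of the accelerated step
  and the part \<open>m\<close> for the Lipschitz error of the operator; both are errors in \<open>nsq (zt - c)\<close>.
\<close>
lemma accelerated_step:
  assumes i: "i \<in> {1..n}" and \<pi>: "0 < \<pi>" and \<alpha>: "0 < \<alpha>" "\<alpha> \<le> 1"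
    and mem: "v \<in> ZR" "c \<in> ZR" "zt \<in> ZR" "z \<in> ZR" "zn \<in> ZR"
    and A_mem: "\<And>u. u \<in> ZR \<Longrightarrow> A u \<in> ZR"
    and A_diff: "\<And>u u'. A u - A u' = \<pi> *\<^sub>R (u - u')"
    and M: "M i \<le> m" and \<eta>: "\<eta> = L i * \<pi> * \<alpha> + m"
    and zn: "(Q i zt - Q i c) \<bullet> (zn - z) + \<eta> / 2 * (nsq (zn - zt) + nsq (zn - z) - nsq (z - zt)) \<le> 0"
    and w: "w = A (\<alpha> *\<^sub>R c + (1 - \<alpha>) *\<^sub>R v)" and v': "v' = \<alpha> *\<^sub>R zt + (1 - \<alpha>) *\<^sub>R v"
  shows "(p i (A v') - p i (A z)) / \<pi> + Q i z \<bullet> (v' - z)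
    \<le> (1 - \<alpha>) * ((p i (A v) - p i (A z)) / \<pi> + Q i z \<bullet> (v - z))
      + \<alpha> * ((grad i w + Q i c) \<bullet> (zt - z) + \<eta> / 2 * (nsq (zt - c) + nsq (zt - z) - nsq (z - c)))
      + \<alpha> * (\<eta> / 2 * (nsq (c - z) - nsq (zn - z))) + d i / \<pi>"
proof -
  define g where "g = grad i w"
  define N where "N = nsq (zt - c)"
  have wm: "w \<in> ZR" and v'm: "v' \<in> ZR"
    unfolding w v' using \<alpha> mem by (auto intro!: A_mem ZR_convexD)
  have Av': "A v' - w = (\<pi> * \<alpha>) *\<^sub>R (zt - c)"
    unfolding w A_diff v' by (simp add: algebra_simps)
  have Azt: "A v' - w = (1 - \<alpha>) *\<^sub>R (A v - w) + \<alpha> *\<^sub>R ((A z - w) + \<pi> *\<^sub>R (zt - z))"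
    unfolding w A_diff v' by (simp add: algebra_simps)
  have "p i (A v') \<le> p i w + g \<bullet> (A v' - w) + L i / 2 * nsq (A v' - w) + d i"
    unfolding g_def by (rule p_smooth[OF i wm A_mem[OF v'm]])
  also have "nsq (A v' - w) = \<pi>\<^sup>2 * \<alpha>\<^sup>2 * N"
    unfolding Av' nsq_scale N_def by (simp add: power_mult_distrib)
  also have "p i w + g \<bullet> (A v' - w) = (1 - \<alpha>) * (p i w + g \<bullet> (A v - w))
      + \<alpha> * (p i w + g \<bullet> (A z - w)) + \<alpha> * \<pi> * (g \<bullet> (zt - z))"
    unfolding Azt by (simp add: inner_add_right algebra_simps)
  also have "(1 - \<alpha>) * (p i w + g \<bullet> (A v - w)) \<le> (1 - \<alpha>) * p i (A v)"
    unfolding g_def by (intro mult_left_mono p_subgradient[OF i wm A_mem[OF mem(1)]]) (use \<alpha> in simp)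
  also have "\<alpha> * (p i w + g \<bullet> (A z - w)) \<le> \<alpha> * p i (A z)"
    unfolding g_def by (intro mult_left_mono p_subgradient[OF i wm A_mem[OF mem(4)]]) (use \<alpha> in simp)
  finally have "p i (A v') - p i (A z) \<le> (1 - \<alpha>) * (p i (A v) - p i (A z))
      + \<alpha> * \<pi> * (g \<bullet> (zt - z)) + L i / 2 * (\<pi>\<^sup>2 * \<alpha>\<^sup>2 * N) + d i"
    by (simp add: algebra_simps)
  then have "(p i (A v') - p i (A z)) / \<pi> \<le> ((1 - \<alpha>) * (p i (A v) - p i (A z))
      + \<alpha> * \<pi> * (g \<bullet> (zt - z)) + L i / 2 * (\<pi>\<^sup>2 * \<alpha>\<^sup>2 * N) + d i) / \<pi>"
    using \<pi> by (intro divide_right_mono) auto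
  also have "\<dots> = (1 - \<alpha>) * ((p i (A v) - p i (A z)) / \<pi>) + \<alpha> * (g \<bullet> (zt - z))
      + L i * \<pi> * \<alpha>\<^sup>2 * N / 2 + d i / \<pi>"
    using \<pi> by (simp add: field_simps power2_eq_square)
  finally have 1: "(p i (A v') - p i (A z)) / \<pi> \<le> (1 - \<alpha>) * ((p i (A v) - p i (A z)) / \<pi>)
      + \<alpha> * (g \<bullet> (zt - z)) + L i * \<pi> * \<alpha>\<^sup>2 * N / 2 + d i / \<pi>" .
  define a b where "a = norm (G (zt - c))" and "b = norm (G (zt - zn))"
  have N: "N = a\<^sup>2" "nsq (zn - zt) = b\<^sup>2"
    unfolding N_def a_def b_def nsq_def by (simp_all add: G_lin norm_minus_commute)
  have m0: "0 \<le> m" using M M_nonneg[OF i] by linarith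
  have m\<eta>: "m \<le> \<eta>" unfolding \<eta> using L_pos[OF i] \<pi> \<alpha> by simp
  have "(Q i zt - Q i c) \<bullet> (zt - zn) \<le> M i * a * b"
    unfolding a_def b_def by (rule Q_lip[OF i mem(3,2)])
  also have "\<dots> \<le> m * a * b" unfolding a_def b_def by (intro mult_right_mono M) auto
  also have "\<dots> \<le> m / 2 * (a\<^sup>2 + b\<^sup>2)"
    using mult_left_mono[OF sum_squares_bound[of a b] m0] by (simp add: algebra_simps)
  also have "\<dots> \<le> m / 2 * a\<^sup>2 + \<eta> / 2 * b\<^sup>2"
    using mult_right_mono[OF m\<eta>, of "b\<^sup>2"] by (simp add: algebra_simps)
  finally have lip: "(Q i zt - Q i c) \<bullet> (zt - zn) \<le> m / 2 * a\<^sup>2 + \<eta> / 2 * b\<^sup>2" .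
  have "Q i z \<bullet> (zt - z) \<le> Q i zt \<bullet> (zt - z)"
    using Q_mono[OF i mem(3,4)] by (simp add: inner_diff_left)
  also have "\<dots> = Q i c \<bullet> (zt - z) + (Q i zt - Q i c) \<bullet> (zn - z) + (Q i zt - Q i c) \<bullet> (zt - zn)"
    by (simp add: inner_diff_left inner_diff_right)
  also have "\<dots> \<le> Q i c \<bullet> (zt - z) + \<eta> / 2 * (nsq (zt - z) - nsq (zn - z)) + m / 2 * N"
    using zn lip unfolding N nsq_minus_commute[of z zt] by (simp add: algebra_simps)
  finally have 2: "Q i z \<bullet> (zt - z)
      \<le> Q i c \<bullet> (zt - z) + \<eta> / 2 * (nsq (zt - z) - nsq (zn - z)) + m / 2 * N" .
  have "Q i z \<bullet> (v' - z) = (1 - \<alpha>) * (Q i z \<bullet> (v - z)) + \<alpha> * (Q i z \<bullet> (zt - z))"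
    unfolding v' by (simp add: inner_diff_right inner_add_right algebra_simps)
  also have "\<dots> \<le> (1 - \<alpha>) * (Q i z \<bullet> (v - z)) + \<alpha> * (Q i c \<bullet> (zt - z)
      + \<eta> / 2 * (nsq (zt - z) - nsq (zn - z)) + m / 2 * N)"
    using mult_left_mono[OF 2, of \<alpha>] \<alpha> by simp
  finally have 3: "Q i z \<bullet> (v' - z) \<le> (1 - \<alpha>) * (Q i z \<bullet> (v - z)) + \<alpha> * (Q i c \<bullet> (zt - z)
      + \<eta> / 2 * (nsq (zt - z) - nsq (zn - z)) + m / 2 * N)" .
  define P P' where "P = (p i (A v) - p i (A z)) / \<pi>" and "P' = (p i (A v') - p i (A z)) / \<pi>"
  have 4: "\<alpha> * (m / 2 * N) = \<alpha> * (\<eta> / 2 * N) - L i * \<pi> * \<alpha>\<^sup>2 * N / 2"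
    unfolding \<eta> by (simp add: algebra_simps power2_eq_square)
  have "P' + Q i z \<bullet> (v' - z) \<le> (1 - \<alpha>) * (P + Q i z \<bullet> (v - z)) + \<alpha> * (g \<bullet> (zt - z) + Q i c \<bullet> (zt - z)
       + \<eta> / 2 * (N + nsq (zt - z) - nsq (zn - z))) + d i / \<pi>"
    using 1 3 4 unfolding P_def[symmetric] P'_def[symmetric]
    by (simp only: distrib_left right_diff_distrib)
  then show ?thesis
    unfolding g_def[symmetric] N_def[symmetric] nsq_minus_commute[of c z] P_def[symmetric] P'_def[symmetric]
    by (simp add: inner_add_left algebra_simps)
qed

definition outer_map :: "nat \<Rightarrow> 'z sliding_state \<Rightarrow> 'z \<Rightarrow> 'z" where
  "outer_map k s z =
     foldr (\<lambda>l z. step_size (idx s l) *\<^sub>R z + (1 - step_size (idx s l)) *\<^sub>R avg s l) [1..<Suc k] z"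

definition outer_weight :: "nat \<Rightarrow> 'z sliding_state \<Rightarrow> real" where
  "outer_weight k s = (\<Prod>l=1..k. step_size (idx s l))"

lemma w_point_outer_map: "w_point s k = outer_map k s (cur s k)"
  by (simp add: w_point_def outer_map_def)

lemma outer_map_0 [simp]: "outer_map 0 s z = z"
  by (simp add: outer_map_def)

lemma outer_map_Suc: "outer_map (Suc k) s z =
   outer_map k s (step_size (idx s (Suc k)) *\<^sub>R z + (1 - step_size (idx s (Suc k))) *\<^sub>R avg s (Suc k))"
  by (simp add: outer_map_def)

lemma outer_weight_0 [simp]: "outer_weight 0 s = 1"
  by (simp add: outer_weight_def)

lemma outer_weight_Suc: "outer_weight (Suc k) s = outer_weight k s * step_size (idx s (Suc k))"
  by (simp add: outer_weight_def)

lemma outer_weight_pos: "0 < outer_weight k s"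
  unfolding outer_weight_def by (intro prod_pos) (simp add: step_size_pos)

lemma outer_map_diff: "outer_map k s u - outer_map k s v = outer_weight k s *\<^sub>R (u - v)"
proof (induction k arbitrary: u v)
  case (Suc k)
  show ?case unfolding outer_map_Suc Suc outer_weight_Suc by (simp add: algebra_simps)
qed simp

lemma outer_map_affine:
  "outer_map k s (t *\<^sub>R u + (1 - t) *\<^sub>R v) = t *\<^sub>R outer_map k s u + (1 - t) *\<^sub>R outer_map k s v"
proof -
  have "outer_map k s (t *\<^sub>R u + (1 - t) *\<^sub>R v)
      = outer_map k s v + outer_weight k s *\<^sub>R ((t *\<^sub>R u + (1 - t) *\<^sub>R v) - v)"
    using outer_map_diff[of k s "t *\<^sub>R u + (1 - t) *\<^sub>R v" v] by (simp add: algebra_simps)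
  also have "\<dots> = outer_map k s v + t *\<^sub>R (outer_weight k s *\<^sub>R (u - v))"
    by (simp add: algebra_simps)
  also have "\<dots> = t *\<^sub>R outer_map k s u + (1 - t) *\<^sub>R outer_map k s v"
    unfolding outer_map_diff[symmetric] by (simp add: algebra_simps)
  finally show ?thesis .
qed

lemma outer_map_ZR:
  assumes "\<And>l. l \<in> {1..k} \<Longrightarrow> avg s l \<in> ZR" "z \<in> ZR"
  shows "outer_map k s z \<in> ZR"
  using assms
proof (induction k arbitrary: z)
  case (Suc k)
  have "step_size (idx s (Suc k)) *\<^sub>R z + (1 - step_size (idx s (Suc k))) *\<^sub>R avg s (Suc k) \<in> ZR"
    using Suc.prems step_size_pos[of "idx s (Suc k)"] step_size_le_1[of "idx s (Suc k)"]
    by (intro ZR_convexD) auto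
  then show ?case unfolding outer_map_Suc using Suc by simp
qed simp

text \<open>Levels up to \<open>k\<close> are read only while the recursion works on deeper levels.\<close>
definition same_outer :: "nat \<Rightarrow> 'z sliding_state \<Rightarrow> 'z sliding_state \<Rightarrow> bool" where
  "same_outer k s s' \<longleftrightarrow> (\<forall>l\<le>k. idx s' l = idx s l \<and> cur s' l = cur s l \<and> avg s' l = avg s l
     \<and> gval s' l = gval s l \<and> qval s' l = qval s l)"

lemma same_outer_outer_map: "same_outer k s s' \<Longrightarrow> outer_map k s' z = outer_map k s z"
  unfolding outer_map_def same_outer_def by (rule foldr_cong) auto

lemma same_outer_outer_weight: "same_outer k s s' \<Longrightarrow> outer_weight k s' = outer_weight k s"
  unfolding outer_weight_def same_outer_def by (rule prod.cong) auto

lemma same_outer_eta: "same_outer k s s' \<Longrightarrow> i \<le> k \<Longrightarrow> eta lev T s' i = eta lev T s i"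
  unfolding eta_def same_outer_def by (intro arg_cong2[where f="(+)"] arg_cong2[where f="(*)"] prod.cong) auto

definition admissible :: "nat \<Rightarrow> 'z sliding_state \<Rightarrow> bool" where
  "admissible k s \<longleftrightarrow> (\<forall>l\<in>{1..n}. cur s l \<in> ZR) \<and>
     (\<forall>l\<in>{1..k}. avg s l \<in> ZR \<and> gval s l \<in> R \<and> qval s l \<in> R \<and> idx s l < T l)"

text \<open>
  A merit function for a call at level \<open>k\<close>: the components of the levels up to \<open>k\<close> enter as the
  linearized prox terms that the call has to solve (\<open>lin_term\<close>), the deeper ones as function and operator
  gaps, seen through the averaging of the outer levels (\<open>fun_term\<close>).  \<open>dist_coeff\<close> and \<open>err_coeff\<close>
  are the factors with which component \<open>i\<close> pays for the distance to its prox centre and for its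
  inexactness: they are such that \<open>dist_coeff\<close> at level \<open>k + 1\<close>, divided by the step size of that level,
  is the same for all its iterations.
\<close>
definition lin_term :: "'z sliding_state \<Rightarrow> 'z \<Rightarrow> 'z \<Rightarrow> nat \<Rightarrow> real" where
  "lin_term s v z i = (gval s i + qval s i) \<bullet> (v - z)
     + eta lev T s i / 2 * (nsq (v - cur s i) + nsq (v - z) - nsq (z - cur s i))"

definition fun_term :: "nat \<Rightarrow> 'z sliding_state \<Rightarrow> 'z \<Rightarrow> 'z \<Rightarrow> nat \<Rightarrow> real" where
  "fun_term k s v z i = (p i (outer_map k s v) - p i (outer_map k s z)) / outer_weight k s
     + Q i z \<bullet> (v - z)"

definition dist_coeff :: "nat \<Rightarrow> 'z sliding_state \<Rightarrow> nat \<Rightarrow> real" where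
  "dist_coeff k s i =
     (L i * outer_weight k s * (\<Prod>l=Suc k..i. (step_size (T l - 1))\<^sup>2)
      + M i * (\<Prod>l=1..k. step_size (idx s l) / step_size (T l - 1))
          * (\<Prod>l=Suc k..i. step_size (T l - 1))) / 2"

definition err_coeff :: "nat \<Rightarrow> 'z sliding_state \<Rightarrow> nat \<Rightarrow> real" where
  "err_coeff k s i = d i / outer_weight k s * (\<Prod>l=Suc k..i. real (T l))"

definition merit :: "nat \<Rightarrow> 'z sliding_state \<Rightarrow> 'z \<Rightarrow> 'z \<Rightarrow> real" where
  "merit k s v z = (\<Sum>i=1..k. lin_term s v z i) + (\<Sum>i=Suc k..n. fun_term k s v z i)"

lemma eta_pos: "i \<in> {1..n} \<Longrightarrow> 0 < eta lev T s i"
  unfolding eta_def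
  by (intro add_pos_nonneg mult_pos_pos mult_nonneg_nonneg L_pos M_nonneg prod_pos prod_nonneg ballI
      divide_nonneg_nonneg less_imp_le[OF step_size_pos] step_size_pos)

lemma lin_term_convex:
  assumes "i \<in> {1..n}" "0 \<le> t" "t \<le> 1"
  shows "lin_term s (t *\<^sub>R u + (1 - t) *\<^sub>R v) z i \<le> t * lin_term s u z i + (1 - t) * lin_term s v z i"
proof -
  let ?x = "t *\<^sub>R u + (1 - t) *\<^sub>R v"
  have 1: "nsq (?x - c) \<le> t * nsq (u - c) + (1 - t) * nsq (v - c)" for c
    by (rule nsq_convex[OF assms(2,3)])
  have alg: "e / 2 * ((t * a + (1 - t) * b) + (t * a' + (1 - t) * b') - n)
      = t * (e / 2 * (a + a' - n)) + (1 - t) * (e / 2 * (b + b' - n))" for e a b a' b' n :: real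
    by (simp add: field_simps)
  have "eta lev T s i / 2 * (nsq (?x - cur s i) + nsq (?x - z) - nsq (z - cur s i))
     \<le> eta lev T s i / 2 * ((t * nsq (u - cur s i) + (1 - t) * nsq (v - cur s i))
        + (t * nsq (u - z) + (1 - t) * nsq (v - z)) - nsq (z - cur s i))"
    by (intro mult_left_mono diff_mono add_mono 1) (use eta_pos[OF assms(1)] in \<open>auto intro: less_imp_le\<close>)
  also have "\<dots> = t * (eta lev T s i / 2 * (nsq (u - cur s i) + nsq (u - z) - nsq (z - cur s i)))
      + (1 - t) * (eta lev T s i / 2 * (nsq (v - cur s i) + nsq (v - z) - nsq (z - cur s i)))"
    by (rule alg)
  finally have 2: "eta lev T s i / 2 * (nsq (?x - cur s i) + nsq (?x - z) - nsq (z - cur s i)) \<le> \<dots>" .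
  have "h \<bullet> (?x - z) = t * (h \<bullet> (u - z)) + (1 - t) * (h \<bullet> (v - z))" for h
    by (simp add: inner_add_right inner_diff_right algebra_simps)
  with 2 show ?thesis unfolding lin_term_def
    by (simp only: distrib_left)
qed

end

context sliding_problem
begin

lemma same_outer_lin_term: "same_outer k s s' \<Longrightarrow> i \<le> k \<Longrightarrow> lin_term s' v z i = lin_term s v z i"
  unfolding lin_term_def using same_outer_eta[of k s s' i] by (auto simp: same_outer_def)

lemma same_outer_merit: "same_outer k s s' \<Longrightarrow> merit k s' v z = merit k s v z"
  unfolding merit_def fun_term_def
  by (simp add: same_outer_outer_map same_outer_outer_weight same_outer_lin_term)

text \<open>
  A function with a subgradient at every point of a convex set is convex there.
\<close>
lemma p_convex:
  assumes i: "i \<in> {1..n}"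
  shows "convex_on ZR (p i)"
proof (rule convex_onI[OF _ ZR_convex])
  fix t :: real and u v assume t: "0 < t" "t < 1" and uv: "u \<in> ZR" "v \<in> ZR"
  define w where "w = (1 - t) *\<^sub>R u + t *\<^sub>R v"
  have w: "w \<in> ZR" using ZR_convexD[OF uv, of "1 - t"] t by (simp add: w_def)
  let ?g = "fst (grad_oracle (lev i) w)"
  have "(1 - t) * (p i w + ?g \<bullet> (u - w)) + t * (p i w + ?g \<bullet> (v - w)) \<le> (1 - t) * p i u + t * p i v"
    using t by (intro add_mono mult_left_mono p_subgradient[OF i w] uv) auto
  moreover have "(1 - t) * (?g \<bullet> (u - w)) + t * (?g \<bullet> (v - w)) = 0"
  proof -
    have "(1 - t) *\<^sub>R (u - w) + t *\<^sub>R (v - w) = 0" by (simp add: w_def algebra_simps)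
    then show ?thesis by (metis inner_add_right inner_scaleR_right inner_zero_right)
  qed
  moreover have "(1 - t) * p i w + t * p i w = p i w" by (simp add: algebra_simps)
  ultimately show "p i ((1 - t) *\<^sub>R u + t *\<^sub>R v) \<le> (1 - t) * p i u + t * p i v"
    unfolding w_def[symmetric] by (simp only: distrib_left)
qed

text \<open>
  One iteration at level \<open>Suc k\<close>.  The three groups of terms of the merit function are treated
  separately: levels up to \<open>k\<close> by convexity in the average (\<open>lin\<close>), the level itself by
  \<open>accelerated_step\<close> (\<open>main\<close>), and deeper levels by convexity of the components (\<open>deep\<close>).
\<close>
lemma iteration_bound:
  fixes u k j z
  defines "\<alpha> \<equiv> step_size j" and "m \<equiv> Suc k" and "v \<equiv> avg u (Suc k)"
  defines "o' \<equiv> open_iteration lev m j u"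
  assumes m: "Suc k \<le> n" and adm: "admissible k u" and v: "avg u (Suc k) \<in> ZR" and j: "j < T (Suc k)"
    and IH_all: "admissible m o' \<longrightarrow> zt \<in> ZR \<and> same_outer m o' s' \<and> admissible m s' \<and>
      (\<forall>z\<in>ZR. merit m o' zt z \<le> (\<Sum>i=Suc m..n.
         dist_coeff m o' i * (nsq (cur o' i - z) - nsq (cur s' i - z)) + err_coeff m o' i))"
    and u': "u' = close_iteration Z nsq lev T m j (zt, s')"
  shows iteration_frame: "same_outer k u u'"
    and iteration_admissible: "admissible k u'"
    and iteration_avg: "avg u' m = \<alpha> *\<^sub>R zt + (1 - \<alpha>) *\<^sub>R v" "avg u' m \<in> ZR"
    and iteration_merit: "\<And>z. z \<in> ZR \<Longrightarrow> merit k u (avg u' m) z \<le> (1 - \<alpha>) * merit k u v z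
      + \<alpha>\<^sup>2 / (step_size (T m - 1))\<^sup>2
          * (\<Sum>i=m..n. dist_coeff k u i * (nsq (cur u i - z) - nsq (cur u' i - z)))
      + (\<Sum>i=m..n. d i / outer_weight k u * (\<Prod>l=Suc m..i. real (T l)))"
proof -
  have \<alpha>: "0 < \<alpha>" "\<alpha> \<le> 1" unfolding \<alpha>_def by (rule step_size_pos step_size_le_1)+
  have min: "m \<in> {1..n}" and mk: "m \<noteq> 0" "k < m" using m by (auto simp: m_def)
  define a where "a = step_size (T m - 1)"
  have a: "0 < a" unfolding a_def by (rule step_size_pos)
  define c where "c = cur u m"
  define w where "w = outer_map k u (\<alpha> *\<^sub>R c + (1 - \<alpha>) *\<^sub>R v)"
  define s1 where "s1 = u\<lparr>idx := (idx u)(m := j)\<rparr>"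
  have so1: "same_outer k u s1" unfolding s1_def same_outer_def by (auto simp: m_def)
  have w1: "w_point s1 m = w"
    unfolding w_point_outer_map w_def m_def outer_map_Suc same_outer_outer_map[OF so1]
    by (simp add: s1_def c_def \<alpha>_def m_def v_def)
  have o'_eq: "idx o' = (idx u)(m := j)" "cur o' = cur u" "avg o' = avg u"
      "gval o' = (gval u)(m := grad m w)" "qval o' = (qval u)(m := Q m c)"
    unfolding o'_def open_iteration_def Let_def s1_def[symmetric] w1
    by (auto simp: s1_def c_def split: prod.splits)
  have so: "same_outer k u o'" unfolding same_outer_def o'_eq by (auto simp: m_def)
  have c_mem: "c \<in> ZR" unfolding c_def using adm min by (auto simp: admissible_def)
  have v_mem: "v \<in> ZR" using v by (simp add: v_def)
  have avg_u: "avg u l \<in> ZR" if "l \<in> {1..k}" for l using adm that by (auto simp: admissible_def)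
  have A_mem: "outer_map k u y \<in> ZR" if "y \<in> ZR" for y
    using outer_map_ZR[OF avg_u that] by blast
  have w_mem: "w \<in> ZR" unfolding w_def using \<alpha> c_mem v_mem by (intro A_mem ZR_convexD) auto
  have adm_o: "admissible m o'"
    unfolding admissible_def o'_eq using adm j v_mem grad_R[OF min w_mem] Q_R[OF min c_mem]
    by (auto simp: admissible_def m_def v_def le_Suc_eq)
  have zt_mem: "zt \<in> ZR" and frame: "same_outer m o' s'" and adm_s: "admissible m s'"
    and IH: "\<And>z. z \<in> ZR \<Longrightarrow> merit m o' zt z \<le> (\<Sum>i=Suc m..n.
         dist_coeff m o' i * (nsq (cur o' i - z) - nsq (cur s' i - z)) + err_coeff m o' i)"
    using IH_all adm_o by auto
  have ow: "0 < outer_weight k u" by (rule outer_weight_pos)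
  have ow_m: "outer_weight m o' = outer_weight k u * \<alpha>"
    unfolding m_def outer_weight_Suc same_outer_outer_weight[OF so]
    by (simp add: o'_eq \<alpha>_def m_def)
  have A_m: "outer_map m o' y = outer_map k u (\<alpha> *\<^sub>R y + (1 - \<alpha>) *\<^sub>R v)" for y
    unfolding m_def outer_map_Suc same_outer_outer_map[OF so]
    by (simp add: o'_eq \<alpha>_def m_def v_def)
  define q where "q = (\<Prod>l=1..k. step_size (idx u l) / step_size (T l - 1))"
  have q_m: "(\<Prod>l=1..m. step_size (idx o' l) / step_size (T l - 1)) = q * (\<alpha> / a)"
    unfolding q_def m_def a_def \<alpha>_def by (simp add: o'_eq m_def)
  define \<eta> where "\<eta> = eta lev T s' m"
  have \<eta>_o: "eta lev T o' m = \<eta>" unfolding \<eta>_def using same_outer_eta[OF frame, of m] by simp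
  have \<eta>: "\<eta> = L m * outer_weight k u * \<alpha> + M m * (q * (\<alpha> / a))"
    unfolding \<eta>_o[symmetric] eta_def q_m outer_weight_def[symmetric] ow_m by simp
  \<comment> \<open>The step sizes decrease, so the prox parameter is at least the Lipschitz constant.\<close>
  have ratio: "1 \<le> q * (\<alpha> / a)"
  proof -
    have "1 \<le> step_size (idx o' l) / step_size (T l - 1)" if "l \<in> {1..m}" for l
    proof -
      have "idx o' l < T l" using adm_o that by (auto simp: admissible_def)
      then have "step_size (T l - 1) \<le> step_size (idx o' l)" by (intro step_size_decseq) simp
      then show ?thesis using step_size_pos[of "T l - 1"] by (simp add: field_simps)
    qed
    then show ?thesis unfolding q_m[symmetric] by (intro prod_ge_1) auto
  qed
  have M_le: "M m \<le> M m * (q * (\<alpha> / a))" using mult_left_mono[OF ratio M_nonneg[OF min]] by simp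
  define zn where "zn = arg_min_on (\<lambda>z. (Q m zt - Q m c) \<bullet> z + \<eta> / 2 * nsq (z - zt)) Z"
  have \<eta>_pos: "0 < \<eta>" unfolding \<eta>_def by (rule eta_pos[OF min])
  have qv: "qval s' m = Q m c" using frame by (auto simp: same_outer_def o'_eq)
  have av: "avg s' m = v" using frame by (auto simp: same_outer_def o'_eq v_def m_def)
  have u'_eq: "idx u' = idx s'" "cur u' = (cur s')(m := zn)"
      "avg u' = (avg s')(m := \<alpha> *\<^sub>R zt + (1 - \<alpha>) *\<^sub>R v)" "gval u' = gval s'" "qval u' = qval s'"
    unfolding u' close_iteration_def Let_def zn_def \<eta>_def qv av \<alpha>_def
    by (auto split: prod.splits simp: qv av)
  have prox: "\<And>z. z \<in> Z \<Longrightarrow>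
      (Q m zt - Q m c) \<bullet> (zn - z) + \<eta> / 2 * (nsq (zn - zt) + nsq (zn - z) - nsq (z - zt)) \<le> 0"
    and zn_mem: "zn \<in> ZR"
    using prox_ineq[of "{()}" "\<lambda>_. \<eta>" zn "\<lambda>_. Q m zt - Q m c" "\<lambda>_. zt"]
      prox_ZR[of "{()}" "\<lambda>_. \<eta>" zn "\<lambda>_. Q m zt - Q m c" "\<lambda>_. zt"]
      \<eta>_pos zt_mem subspace_diff[OF subspace_R Q_R[OF min zt_mem] Q_R[OF min c_mem]]
    unfolding zn_def by auto
  show "same_outer k u u'"
    using frame so unfolding same_outer_def u'_eq using mk by auto
  show avg_eq: "avg u' m = \<alpha> *\<^sub>R zt + (1 - \<alpha>) *\<^sub>R v" by (simp add: u'_eq)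
  show avg_mem: "avg u' m \<in> ZR"
    unfolding avg_eq using \<alpha> zt_mem v_mem by (intro ZR_convexD) auto
  show "admissible k u'"
    using adm_s zn_mem unfolding admissible_def u'_eq by (auto simp: m_def)
  show "merit k u (avg u' m) z \<le> (1 - \<alpha>) * merit k u v z
      + \<alpha>\<^sup>2 / (step_size (T m - 1))\<^sup>2
          * (\<Sum>i=m..n. dist_coeff k u i * (nsq (cur u i - z) - nsq (cur u' i - z)))
      + (\<Sum>i=m..n. d i / outer_weight k u * (\<Prod>l=Suc m..i. real (T l)))" if z: "z \<in> ZR" for z
  proof -
    define v' where "v' = \<alpha> *\<^sub>R zt + (1 - \<alpha>) *\<^sub>R v"
    have zZ: "z \<in> Z" using z by (simp add: ZR_def)
    have lin: "(\<Sum>i=1..k. lin_term u v' z i)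
        \<le> \<alpha> * (\<Sum>i=1..k. lin_term o' zt z i) + (1 - \<alpha>) * (\<Sum>i=1..k. lin_term u v z i)"
      unfolding sum_distrib_left sum.distrib[symmetric] v'_def
    proof (rule sum_mono)
      fix i assume "i \<in> {1..k}"
      then have "i \<in> {1..n}" "i \<le> k" using m by auto
      then show "lin_term u (\<alpha> *\<^sub>R zt + (1 - \<alpha>) *\<^sub>R v) z i
          \<le> \<alpha> * lin_term o' zt z i + (1 - \<alpha>) * lin_term u v z i"
        unfolding same_outer_lin_term[OF so \<open>i \<le> k\<close>] using \<alpha> by (intro lin_term_convex) auto
    qed
    have main: "fun_term k u v' z m \<le> (1 - \<alpha>) * fun_term k u v z m + \<alpha> * lin_term o' zt z m
        + \<alpha> * (\<eta> / 2 * (nsq (c - z) - nsq (zn - z))) + d m / outer_weight k u"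
      unfolding fun_term_def lin_term_def \<eta>_o
      using accelerated_step[OF min ow \<alpha> v_mem c_mem zt_mem z zn_mem A_mem outer_map_diff M_le \<eta>
          prox[OF zZ] w_def v'_def]
      by (simp add: o'_eq c_def)
    have deep: "fun_term k u v' z i \<le> (1 - \<alpha>) * fun_term k u v z i + \<alpha> * fun_term m o' zt z i"
      if i: "i \<in> {Suc m..n}" for i
    proof -
      have i': "i \<in> {1..n}" using i by auto
      have "outer_map k u (\<alpha> *\<^sub>R z + (1 - \<alpha>) *\<^sub>R v)
          = (1 - \<alpha>) *\<^sub>R outer_map k u v + \<alpha> *\<^sub>R outer_map k u z"
        by (simp add: outer_map_affine)
      then have "p i (outer_map k u (\<alpha> *\<^sub>R z + (1 - \<alpha>) *\<^sub>R v))
          \<le> (1 - \<alpha>) * p i (outer_map k u v) + \<alpha> * p i (outer_map k u z)"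
        using convex_onD[OF p_convex[OF i'], of \<alpha> "outer_map k u v" "outer_map k u z"]
          \<alpha> A_mem[OF v_mem] A_mem[OF z] by simp
      moreover have split: "(x - ((1 - \<alpha>) * y + \<alpha> * y')) / outer_weight k u
          = (x - y') / outer_weight k u - (1 - \<alpha>) * ((y - y') / outer_weight k u)" for x y y'
        using ow by (simp add: field_simps)
      ultimately have "(p i (outer_map k u v') - ((1 - \<alpha>) * p i (outer_map k u v) + \<alpha> * p i (outer_map k u z)))
            / outer_weight k u
          \<le> (p i (outer_map k u v') - p i (outer_map k u (\<alpha> *\<^sub>R z + (1 - \<alpha>) *\<^sub>R v))) / outer_weight k u"
        using ow by (intro divide_right_mono) auto
      also have "\<dots> = \<alpha> * ((p i (outer_map m o' zt) - p i (outer_map m o' z)) / outer_weight m o')"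
        unfolding A_m ow_m v'_def[symmetric] using \<alpha> ow by simp
      finally have 1: "(p i (outer_map k u v') - p i (outer_map k u z)) / outer_weight k u
          \<le> (1 - \<alpha>) * ((p i (outer_map k u v) - p i (outer_map k u z)) / outer_weight k u)
            + \<alpha> * ((p i (outer_map m o' zt) - p i (outer_map m o' z)) / outer_weight m o')"
        unfolding split by linarith
      have 2: "Q i z \<bullet> (v' - z) = (1 - \<alpha>) * (Q i z \<bullet> (v - z)) + \<alpha> * (Q i z \<bullet> (zt - z))"
        unfolding v'_def by (simp add: inner_diff_right inner_add_right algebra_simps)
      show ?thesis unfolding fun_term_def 2 using 1 by (simp add: distrib_left)
    qed
    have "(\<Sum>i=Suc m..n. fun_term k u v' z i)
        \<le> (1 - \<alpha>) * (\<Sum>i=Suc m..n. fun_term k u v z i) + \<alpha> * (\<Sum>i=Suc m..n. fun_term m o' zt z i)"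
      unfolding sum_distrib_left sum.distrib[symmetric] by (rule sum_mono[OF deep])
    then have "merit k u v' z \<le> (1 - \<alpha>) * merit k u v z + \<alpha> * merit m o' zt z
        + \<alpha> * (\<eta> / 2 * (nsq (c - z) - nsq (zn - z))) + d m / outer_weight k u"
    proof -
      have s: "(\<Sum>i=Suc k..n. h i) = h m + (\<Sum>i=Suc m..n. h i)" for h :: "nat \<Rightarrow> real"
        using m sum.atLeast_Suc_atMost[of "Suc k" n h] by (simp add: m_def)
      have t: "(\<Sum>i=1..m. h i) = (\<Sum>i=1..k. h i) + h m" for h :: "nat \<Rightarrow> real"
        by (simp add: m_def)
      assume "(\<Sum>i=Suc m..n. fun_term k u v' z i)
        \<le> (1 - \<alpha>) * (\<Sum>i=Suc m..n. fun_term k u v z i) + \<alpha> * (\<Sum>i=Suc m..n. fun_term m o' zt z i)"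
      then show ?thesis using lin main unfolding merit_def s t
        by (simp only: distrib_left)
    qed
    also have "\<alpha> * merit m o' zt z \<le> \<alpha> *
      (\<Sum>i=Suc m..n. dist_coeff m o' i * (nsq (cur o' i - z) - nsq (cur s' i - z)) + err_coeff m o' i)"
      using IH[OF z] \<alpha> by (intro mult_left_mono) auto
    also have "\<dots> = (\<Sum>i=Suc m..n. \<alpha>\<^sup>2 / a\<^sup>2 * (dist_coeff k u i * (nsq (cur u i - z) - nsq (cur u' i - z)))
        + d i / outer_weight k u * (\<Prod>l=Suc m..i. real (T l)))"
      unfolding sum_distrib_left
    proof (rule sum.cong[OF refl])
      fix i assume i: "i \<in> {Suc m..n}"
      have p: "(\<Prod>l=Suc k..i. h l) = h m * (\<Prod>l=Suc m..i. h l)" for h :: "nat \<Rightarrow> real"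
        using i prod.atLeast_Suc_atMost[of "Suc k" i h] by (simp add: m_def)
      have "\<alpha> * dist_coeff m o' i = \<alpha>\<^sup>2 / a\<^sup>2 * dist_coeff k u i"
        unfolding dist_coeff_def ow_m q_m p q_def[symmetric] a_def[symmetric] using a
        by (simp add: field_simps power2_eq_square)
      moreover have "\<alpha> * err_coeff m o' i = d i / outer_weight k u * (\<Prod>l=Suc m..i. real (T l))"
        unfolding err_coeff_def ow_m using \<alpha> by simp
      moreover have "cur o' i = cur u i" "cur u' i = cur s' i" using i by (auto simp: o'_eq u'_eq)
      ultimately show "\<alpha> * (dist_coeff m o' i * (nsq (cur o' i - z) - nsq (cur s' i - z)) + err_coeff m o' i)
        = \<alpha>\<^sup>2 / a\<^sup>2 * (dist_coeff k u i * (nsq (cur u i - z) - nsq (cur u' i - z)))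
        + d i / outer_weight k u * (\<Prod>l=Suc m..i. real (T l))"
        by (simp only: distrib_left mult.assoc[symmetric])
    qed
    also have "\<alpha> * (\<eta> / 2 * (nsq (c - z) - nsq (zn - z)))
        = \<alpha>\<^sup>2 / a\<^sup>2 * (dist_coeff k u m * (nsq (cur u m - z) - nsq (cur u' m - z)))"
    proof -
      have "\<alpha> * (\<eta> / 2) = \<alpha>\<^sup>2 / a\<^sup>2 * dist_coeff k u m"
      proof -
        have a': "step_size (T (Suc k) - Suc 0) = a" by (simp add: a_def m_def)
        show ?thesis unfolding dist_coeff_def \<eta> q_def[symmetric] using a
          by (simp add: m_def field_simps power2_eq_square a')
      qed
      moreover have "cur u m = c" "cur u' m = zn" by (simp_all add: c_def u'_eq)
      ultimately show ?thesis by (simp only: mult.assoc[symmetric])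
    qed
    finally show ?thesis
      unfolding avg_eq v'_def[symmetric] a_def[symmetric]
        sum.atLeast_Suc_atMost[of m n, OF m[folded m_def]] distrib_left sum_distrib_left sum.distrib
      by (simp add: algebra_simps)
  qed
qed


text \<open>
  Induction from the innermost level outwards.  With weights \<open>W J\<close>, the sums of the inverse step
  sizes, the bounds of the iterations of one level add up: the merit of the average is a telescoping sum,
  and so are the squared distances, since every call starts from the prox centres left by the
  preceding one.
\<close>
theorem sliding_rec_bound:
  assumes "r \<le> n" "k = n - r" "admissible k s" "sliding_rec Z nsq n lev T r s = (zt, s')"
  shows "zt \<in> ZR \<and> same_outer k s s' \<and> admissible k s' \<and>
    (\<forall>z\<in>ZR. merit k s zt z \<le>
      (\<Sum>i=Suc k..n. dist_coeff k s i * (nsq (cur s i - z) - nsq (cur s' i - z)) + err_coeff k s i))"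
  using assms
proof (induction r arbitrary: k s zt s')
  case 0
  have k: "k = n" and s': "s' = s" and zt: "zt = leaf_point Z nsq n lev T s" using 0 by auto
  have pos: "0 < sum (eta lev T s) {1..n}"
    using n_pos eta_pos by (intro sum_pos) auto
  have nonneg: "0 \<le> eta lev T s i" if "i \<in> {1..n}" for i using eta_pos[OF that] by (rule less_imp_le)
  note prox = prox_step[of "{1..n}" "eta lev T s", OF _ nonneg pos zt[unfolded leaf_point_def]]
  have "zt \<in> ZR"
    using 0(3) by (intro prox(2)) (auto simp: admissible_def k intro!: subspace_add[OF subspace_R])
  moreover have "merit n s zt z \<le> 0" if "z \<in> ZR" for z
    using prox(1)[of z] that unfolding merit_def lin_term_def by (simp add: ZR_def)
  ultimately show ?case using 0(3) by (auto simp: k s' same_outer_def)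
next
  case (Suc r)
  note outer_IH = Suc.IH
  define m where "m = n - r"
  have m: "m = Suc k" "m \<le> n" "Suc k \<le> n" using Suc.prems by (auto simp: m_def)
  have nr: "n - r = Suc k" using m by (simp add: m_def)
  define s0 where "s0 = s\<lparr>avg := (avg s)(m := cur s m)\<rparr>"
  define body where "body = (\<lambda>j u. close_iteration Z nsq lev T m j
     (sliding_rec Z nsq n lev T r (open_iteration lev m j u)))"
  define it where "it J = fold body [0..<J] s0" for J
  define a where "a = step_size (T m - 1)"
  define W where "W J = (case J of 0 \<Rightarrow> 0 | Suc j \<Rightarrow> 1 / (step_size j)\<^sup>2)" for J
  define e where "e = (\<Sum>i=m..n. d i / outer_weight k s * (\<Prod>l=Suc m..i. real (T l)))"
  have a: "0 < a" unfolding a_def by (rule step_size_pos)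
  have e0: "0 \<le> e" unfolding e_def
    by (intro sum_nonneg mult_nonneg_nonneg divide_nonneg_nonneg d_nonneg prod_nonneg
        less_imp_le[OF outer_weight_pos]) (use m in auto)
  have s': "s' = it (T m)" and zt: "zt = avg (it (T m)) m"
    using Suc.prems(4) by (auto simp: it_def body_def s0_def m_def Let_def)
  have "same_outer k s (it J) \<and> admissible k (it J) \<and> avg (it J) m \<in> ZR \<and>
     (\<forall>z\<in>ZR. W J * merit k s (avg (it J) m) z \<le>
        1 / a\<^sup>2 * (\<Sum>i=m..n. dist_coeff k s i * (nsq (cur s i - z) - nsq (cur (it J) i - z)))
        + real J * (e / a\<^sup>2))" if "J \<le> T m" for J
    using that
  proof (induction J)
    case 0
    have "cur s m \<in> ZR" using Suc.prems(3) m by (auto simp: admissible_def)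
    moreover have "admissible k s0" using Suc.prems(3) m by (auto simp: admissible_def s0_def)
    ultimately show ?case by (auto simp: it_def s0_def same_outer_def W_def m)
  next
    case (Suc J)
    define u where "u = it J"
    obtain zt1 s1 where rec: "sliding_rec Z nsq n lev T r (open_iteration lev m J u) = (zt1, s1)"
      by fastforce
    define \<alpha> where "\<alpha> = step_size J"
    have \<alpha>: "0 < \<alpha>" unfolding \<alpha>_def by (rule step_size_pos)
    have itS: "it (Suc J) = close_iteration Z nsq lev T m J (zt1, s1)"
    proof -
      have "it (Suc J) = body J u" by (simp add: it_def u_def)
      then show ?thesis by (simp add: body_def rec)
    qed
    have J: "J < T (Suc k)" using Suc.prems m by simp
    have so: "same_outer k s u" and adm: "admissible k u" and av: "avg u (Suc k) \<in> ZR"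
      and old: "\<And>z. z \<in> ZR \<Longrightarrow> W J * merit k s (avg u m) z \<le>
        1 / a\<^sup>2 * (\<Sum>i=m..n. dist_coeff k s i * (nsq (cur s i - z) - nsq (cur u i - z)))
        + real J * (e / a\<^sup>2)"
      using Suc.IH Suc.prems unfolding u_def m(1) by auto
    let ?o = "open_iteration lev (Suc k) J u"
    have rec': "sliding_rec Z nsq n lev T r ?o = (zt1, s1)" using rec m by simp
    have r: "r \<le> n" using \<open>Suc r \<le> n\<close> by simp
    have IH: "admissible (Suc k) ?o \<longrightarrow> zt1 \<in> ZR \<and> same_outer (Suc k) ?o s1 \<and> admissible (Suc k) s1 \<and>
      (\<forall>z\<in>ZR. merit (Suc k) ?o zt1 z \<le> (\<Sum>i=Suc (Suc k)..n.
         dist_coeff (Suc k) ?o i * (nsq (cur ?o i - z) - nsq (cur s1 i - z)) + err_coeff (Suc k) ?o i))"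
      using outer_IH[OF r nr[symmetric] _ rec'] by blast
    have itS': "it (Suc J) = close_iteration Z nsq lev T (Suc k) J (zt1, s1)" using itS m by simp
    note step = iteration_bound[OF m(3) adm av J IH itS', folded m(1), folded \<alpha>_def a_def]
    have WS: "W (Suc J) = 1 / \<alpha>\<^sup>2" by (simp add: W_def \<alpha>_def)
    have W_step: "(1 - \<alpha>) / \<alpha>\<^sup>2 = W J"
      unfolding \<alpha>_def W_def using step_size_recurrence by (cases J) (simp_all del: step_size.simps(2))
    have W_le: "1 / \<alpha>\<^sup>2 \<le> 1 / a\<^sup>2"
    proof -
      have "a \<le> \<alpha>" unfolding a_def \<alpha>_def using J m by (intro step_size_decseq) auto
      then show ?thesis using a \<alpha> by (intro divide_left_mono power_mono) auto
    qed
    have "W (Suc J) * merit k s (avg (it (Suc J)) m) z \<le>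
        1 / a\<^sup>2 * (\<Sum>i=m..n. dist_coeff k s i * (nsq (cur s i - z) - nsq (cur (it (Suc J)) i - z)))
        + real (Suc J) * (e / a\<^sup>2)" if z: "z \<in> ZR" for z
    proof -
      have du: "dist_coeff k u i = dist_coeff k s i" for i
        unfolding dist_coeff_def same_outer_outer_weight[OF so]
        by (intro arg_cong2[where f="(/)"] arg_cong2[where f="(+)"] arg_cong2[where f="(*)"] refl prod.cong)
          (use so in \<open>auto simp: same_outer_def\<close>)
      have "merit k s (avg (it (Suc J)) m) z \<le> (1 - \<alpha>) * merit k s (avg u m) z
        + \<alpha>\<^sup>2 / a\<^sup>2 * (\<Sum>i=m..n. dist_coeff k s i * (nsq (cur u i - z) - nsq (cur (it (Suc J)) i - z))) + e"
        using step(5)[OF z] unfolding same_outer_merit[OF so] same_outer_outer_weight[OF so] e_def du .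
      then have "1 / \<alpha>\<^sup>2 * merit k s (avg (it (Suc J)) m) z \<le> 1 / \<alpha>\<^sup>2 * ((1 - \<alpha>) * merit k s (avg u m) z
        + \<alpha>\<^sup>2 / a\<^sup>2 * (\<Sum>i=m..n. dist_coeff k s i * (nsq (cur u i - z) - nsq (cur (it (Suc J)) i - z))) + e)"
        using \<alpha> by (intro mult_left_mono) auto
      also have "\<dots> = (1 - \<alpha>) / \<alpha>\<^sup>2 * merit k s (avg u m) z
        + 1 / a\<^sup>2 * (\<Sum>i=m..n. dist_coeff k s i * (nsq (cur u i - z) - nsq (cur (it (Suc J)) i - z))) + 1 / \<alpha>\<^sup>2 * e"
        using \<alpha> by (simp add: distrib_left)
      also have "\<dots> \<le> 1 / a\<^sup>2 * (\<Sum>i=m..n. dist_coeff k s i * (nsq (cur s i - z) - nsq (cur u i - z)))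
        + real J * (e / a\<^sup>2)
        + 1 / a\<^sup>2 * (\<Sum>i=m..n. dist_coeff k s i * (nsq (cur u i - z) - nsq (cur (it (Suc J)) i - z))) + 1 / a\<^sup>2 * e"
        unfolding W_step by (intro add_mono old[OF z] mult_right_mono[OF W_le e0] order_refl)
      also have "\<dots> = 1 / a\<^sup>2 * ((\<Sum>i=m..n. dist_coeff k s i * (nsq (cur s i - z) - nsq (cur u i - z)))
          + (\<Sum>i=m..n. dist_coeff k s i * (nsq (cur u i - z) - nsq (cur (it (Suc J)) i - z))))
        + real (Suc J) * (e / a\<^sup>2)"
        by (simp add: algebra_simps add_divide_distrib)
      also have "(\<Sum>i=m..n. dist_coeff k s i * (nsq (cur s i - z) - nsq (cur u i - z)))
          + (\<Sum>i=m..n. dist_coeff k s i * (nsq (cur u i - z) - nsq (cur (it (Suc J)) i - z)))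
          = (\<Sum>i=m..n. dist_coeff k s i * (nsq (cur s i - z) - nsq (cur (it (Suc J)) i - z)))"
        unfolding sum.distrib[symmetric] by (intro sum.cong refl) (simp add: algebra_simps)
      finally show ?thesis unfolding WS .
    qed
    moreover have "same_outer k s (it (Suc J))"
      using so step(1) by (simp add: same_outer_def)
    ultimately show ?case using step(2,4) by blast
  qed
  from this[of "T m"] have fin: "same_outer k s s'" "admissible k s'" "zt \<in> ZR"
     "\<And>z. z \<in> ZR \<Longrightarrow> W (T m) * merit k s zt z \<le>
        1 / a\<^sup>2 * (\<Sum>i=m..n. dist_coeff k s i * (nsq (cur s i - z) - nsq (cur s' i - z)))
        + real (T m) * (e / a\<^sup>2)"
    unfolding s' zt by auto
  have WT: "W (T m) = 1 / a\<^sup>2" using T_pos[of m] by (simp add: W_def a_def split: nat.split)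
  have err: "real (T m) * e = (\<Sum>i=Suc k..n. err_coeff k s i)"
    unfolding e_def sum_distrib_left m(1)
  proof (rule sum.cong[OF refl])
    fix i assume "i \<in> {Suc k..n}"
    then show "real (T (Suc k)) * (d i / outer_weight k s * (\<Prod>l=Suc (Suc k)..i. real (T l))) = err_coeff k s i"
      unfolding err_coeff_def using prod.atLeast_Suc_atMost[of "Suc k" i "\<lambda>l. real (T l)"] by simp
  qed
  have "merit k s zt z \<le> (\<Sum>i=Suc k..n. dist_coeff k s i * (nsq (cur s i - z) - nsq (cur s' i - z)) + err_coeff k s i)"
    if z: "z \<in> ZR" for z
  proof -
    have "a\<^sup>2 * (1 / a\<^sup>2 * merit k s zt z) \<le> a\<^sup>2 * (
        1 / a\<^sup>2 * (\<Sum>i=m..n. dist_coeff k s i * (nsq (cur s i - z) - nsq (cur s' i - z)))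
        + real (T m) * (e / a\<^sup>2))"
      using fin(4)[OF z] unfolding WT by (intro mult_left_mono) auto
    also have "\<dots> = (\<Sum>i=m..n. dist_coeff k s i * (nsq (cur s i - z) - nsq (cur s' i - z))) + real (T m) * e"
      using a by (simp add: field_simps)
    finally show ?thesis using a unfolding err sum.distrib by (simp add: m(1))
  qed
  then show ?case using fin by blast
qed


corollary sliding_bound:
  assumes z_in: "z_in \<in> ZR" and run: "sliding Z nsq n lev T z_in = (zt, calls)"
  shows "zt \<in> ZR"
    and "\<And>z. z \<in> ZR \<Longrightarrow> (\<Sum>i=1..n. p i zt - p i z + Q i z \<bullet> (zt - z)) \<le>
      (\<Sum>i=1..n. (L i * (\<Prod>l=1..i. (step_size (T l - 1))\<^sup>2) + M i * (\<Prod>l=1..i. step_size (T l - 1))) / 2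
           * nsq (z_in - z) + d i * (\<Prod>l=1..i. real (T l)))"
proof -
  define s :: "'z sliding_state" where "s = \<lparr>idx = (\<lambda>_. 0), cur = (\<lambda>_. z_in), avg = (\<lambda>_. z_in),
             gval = (\<lambda>_. 0), qval = (\<lambda>_. 0), spent = 0\<rparr>"
  obtain s' where s': "sliding_rec Z nsq n lev T n s = (zt, s')"
    using run unfolding sliding_def s_def[symmetric] by (auto split: prod.splits)
  have adm: "admissible 0 s" using z_in by (auto simp: admissible_def s_def)
  note B = sliding_rec_bound[OF order_refl _ adm s', simplified]
  show "zt \<in> ZR" using B by blast
  fix z assume z: "z \<in> ZR"
  have "(\<Sum>i=1..n. p i zt - p i z + Q i z \<bullet> (zt - z)) = merit 0 s zt z"
    by (simp add: merit_def fun_term_def)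
  also have "\<dots> \<le> (\<Sum>i=1..n. dist_coeff 0 s i * (nsq (cur s i - z) - nsq (cur s' i - z)) + err_coeff 0 s i)"
    using B z by simp
  also have "\<dots> \<le> (\<Sum>i=1..n. dist_coeff 0 s i * nsq (z_in - z) + d i * (\<Prod>l=1..i. real (T l)))"
  proof (rule sum_mono)
    fix i assume i: "i \<in> {1..n}"
    have "0 \<le> dist_coeff 0 s i"
      unfolding dist_coeff_def using i
      by (auto intro!: add_nonneg_nonneg mult_nonneg_nonneg prod_nonneg M_nonneg less_imp_le[OF L_pos]
          less_imp_le[OF step_size_pos])
    then have "dist_coeff 0 s i * (nsq (cur s i - z) - nsq (cur s' i - z)) \<le> dist_coeff 0 s i * nsq (z_in - z)"
      by (intro mult_left_mono) (simp_all add: s_def)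
    then show "dist_coeff 0 s i * (nsq (cur s i - z) - nsq (cur s' i - z)) + err_coeff 0 s i
        \<le> dist_coeff 0 s i * nsq (z_in - z) + d i * (\<Prod>l=1..i. real (T l))"
      by (simp add: err_coeff_def)
  qed
  also have "\<dots> = (\<Sum>i=1..n. (L i * (\<Prod>l=1..i. (step_size (T l - 1))\<^sup>2) + M i * (\<Prod>l=1..i. step_size (T l - 1))) / 2
           * nsq (z_in - z) + d i * (\<Prod>l=1..i. real (T l)))"
    by (simp add: dist_coeff_def)
  finally show "(\<Sum>i=1..n. p i zt - p i z + Q i z \<bullet> (zt - z)) \<le> \<dots>" .
qed

end


section \<open>Oracle calls of the sliding scheme\<close>

text \<open>
  The functional \<open>\<phi>\<close> selects one kind of oracle; all that matters is that it is additive.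
\<close>
lemma sliding_rec_calls:
  fixes \<phi> :: "calls \<Rightarrow> nat"
  assumes add: "\<And>a b. \<phi> (a + b) = \<phi> a + \<phi> b"
    and cost: "\<And>i z. snd (grad_oracle (lev i) z) = cg i" "\<And>i z. snd (Q_oracle (lev i) z) = cq i"
    and "r \<le> n" "k = n - r"
  shows "\<phi> (spent (snd (sliding_rec Z nsq n lev T r s)))
    = \<phi> (spent s) + (\<Sum>i=Suc k..n. (\<Prod>l=Suc k..i. T l) * (\<phi> (cg i) + 2 * \<phi> (cq i)))"
  using assms(4,5)
proof (induction r arbitrary: k s)
  case 0
  then show ?case by simp
next
  case (Suc r)
  note outer_IH = Suc.IH
  have r: "r \<le> n" using Suc.prems by simp
  have m: "n - r = Suc k" using Suc.prems by simp
  define c where "c i = \<phi> (cg i) + 2 * \<phi> (cq i)" for i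
  define body where "body = (\<lambda>j u. close_iteration Z nsq lev T (Suc k) j
     (sliding_rec Z nsq n lev T r (open_iteration lev (Suc k) j u)))"
  define s0 where "s0 = s\<lparr>avg := (avg s)(Suc k := cur s (Suc k))\<rparr>"
  define K where "K = c (Suc k) + (\<Sum>i=Suc (Suc k)..n. (\<Prod>l=Suc (Suc k)..i. T l) * c i)"
  have body: "\<phi> (spent (body j u)) = \<phi> (spent u) + K" for j u
  proof -
    obtain zt s1 where rec: "sliding_rec Z nsq n lev T r (open_iteration lev (Suc k) j u) = (zt, s1)"
      by fastforce
    have "\<phi> (spent (open_iteration lev (Suc k) j u)) = \<phi> (spent u) + \<phi> (cg (Suc k)) + \<phi> (cq (Suc k))"
      unfolding open_iteration_def Let_def
      by (simp add: case_prod_beta add cost)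
    moreover have "\<phi> (spent (body j u)) = \<phi> (spent s1) + \<phi> (cq (Suc k))"
      unfolding body_def rec close_iteration_def Let_def
      by (simp add: case_prod_beta add cost)
    moreover have "\<phi> (spent s1) = \<phi> (spent (open_iteration lev (Suc k) j u))
        + (\<Sum>i=Suc (Suc k)..n. (\<Prod>l=Suc (Suc k)..i. T l) * c i)"
      using outer_IH[OF r m[symmetric], of "open_iteration lev (Suc k) j u"]
      unfolding c_def rec by simp
    ultimately show ?thesis by (simp add: K_def c_def)
  qed
  have "\<phi> (spent (fold body [0..<J] s0)) = \<phi> (spent s) + J * K" for J
    by (induction J) (simp_all add: body s0_def)
  moreover have "spent (snd (sliding_rec Z nsq n lev T (Suc r) s)) = spent (fold body [0..<T (Suc k)] s0)"
    by (simp add: Let_def m body_def s0_def)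
  moreover have "T (Suc k) * K = (\<Sum>i=Suc k..n. (\<Prod>l=Suc k..i. T l) * c i)"
  proof -
    have p: "(\<Prod>l=Suc k..i. T l) = T (Suc k) * (\<Prod>l=Suc (Suc k)..i. T l)" if "Suc k \<le> i" for i
      using prod.atLeast_Suc_atMost[OF that, of T] .
    have "Suc k \<le> n" using Suc.prems by simp
    then have "(\<Sum>i=Suc k..n. (\<Prod>l=Suc k..i. T l) * c i)
        = T (Suc k) * c (Suc k) + (\<Sum>i=Suc (Suc k)..n. T (Suc k) * ((\<Prod>l=Suc (Suc k)..i. T l) * c i))"
      by (subst sum.atLeast_Suc_atMost) (auto simp: p intro!: sum.cong)
    then show ?thesis by (simp add: K_def distrib_left sum_distrib_left)
  qed
  ultimately show ?case by (simp add: c_def)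
qed

corollary sliding_calls:
  fixes \<phi> :: "calls \<Rightarrow> nat"
  assumes "\<And>a b. \<phi> (a + b) = \<phi> a + \<phi> b"
    and "\<And>i z. snd (grad_oracle (lev i) z) = cg i" "\<And>i z. snd (Q_oracle (lev i) z) = cq i"
  shows "\<phi> (snd (sliding Z nsq n lev T z_in)) = (\<Sum>i=1..n. (\<Prod>l=1..i. T l) * (\<phi> (cg i) + 2 * \<phi> (cq i)))"
proof -
  have "\<phi> 0 = 0" using assms(1)[of 0 0] by simp
  then show ?thesis
    unfolding sliding_def Let_def case_prod_beta snd_conv
    using sliding_rec_calls[OF assms order_refl refl] by simp
qed

section \<open>Extreme eigenvalues of a Gram matrix\<close>

lemma matrix_adjoint: "(A *v v) \<bullet> u = v \<bullet> (transpose A *v u)" for A :: "real^'i^'j"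
  by (metis dot_lmul_matrix inner_commute vector_transpose_matrix)

lemma gram_inner: "((transpose A ** A) *v u) \<bullet> v = (A *v u) \<bullet> (A *v v)" for A :: "real^'i^'j"
  unfolding matrix_vector_mul_assoc[symmetric] inner_commute[of _ v] matrix_adjoint[symmetric]
  by (rule inner_commute)

lemma finite_eigenvalues_symmetric:
  fixes S :: "real^'n^'n"
  assumes sym: "\<And>u v. (S *v u) \<bullet> v = u \<bullet> (S *v v)"
  shows "finite (eigenvalues S)"
proof -
  define e where "e l = (SOME v. v \<noteq> 0 \<and> S *v v = l *\<^sub>R v)" for l
  have e: "e l \<noteq> 0" "S *v e l = l *\<^sub>R e l" if "l \<in> eigenvalues S" for l
    using someI_ex[of "\<lambda>v. v \<noteq> 0 \<and> S *v v = l *\<^sub>R v"] that unfolding eigenvalues_def e_def by auto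
  have orth: "e l \<bullet> e l' = 0" if "l \<in> eigenvalues S" "l' \<in> eigenvalues S" "l \<noteq> l'" for l l'
    using sym[of "e l" "e l'"] e[OF that(1)] e[OF that(2)] that(3) by simp
  have inj: "inj_on e (eigenvalues S)"
    using orth e by (intro inj_onI) (metis inner_eq_zero_iff)
  have "pairwise orthogonal (e ` eigenvalues S)" "0 \<notin> e ` eigenvalues S"
    using orth e by (auto simp: pairwise_def orthogonal_def)
  then have "finite (e ` eigenvalues S)"
    using pairwise_orthogonal_independent independent_imp_finite by blast
  then show ?thesis using inj by (simp add: finite_image_iff)
qed

text \<open>A minimizer of the Rayleigh quotient on an invariant subspace is an eigenvector.\<close>
lemma rayleigh_minimum:
  fixes S :: "real^'n^'n"
  assumes sym: "\<And>u v. (S *v u) \<bullet> v = u \<bullet> (S *v v)"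
    and U: "subspace U" "\<And>u. u \<in> U \<Longrightarrow> S *v u \<in> U" and ne: "x \<in> U" "x \<noteq> 0"
  shows "\<exists>l\<in>eigenvalues S. (\<exists>v\<in>U. v \<noteq> 0 \<and> S *v v = l *\<^sub>R v) \<and>
    (\<forall>u\<in>U. l * (norm u)\<^sup>2 \<le> u \<bullet> (S *v u))"
proof -
  have "compact (U \<inter> sphere 0 1)" using closed_subspace[OF U(1)] by (simp add: closed_Int_compact)
  moreover have "(1 / norm x) *\<^sub>R x \<in> U \<inter> sphere 0 1" using ne subspace_scale[OF U(1)] by simp
  then have "U \<inter> sphere 0 1 \<noteq> {}" by blast
  moreover have "continuous_on (U \<inter> sphere 0 1) (\<lambda>u. u \<bullet> (S *v u))"
    by (intro continuous_intros linear_continuous_on_compose[OF _ matrix_vector_mul_linear])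
  ultimately have "\<exists>v\<in>U \<inter> sphere 0 1. \<forall>u\<in>U \<inter> sphere 0 1. v \<bullet> (S *v v) \<le> u \<bullet> (S *v u)"
    by (rule continuous_attains_inf)
  then obtain v where v: "v \<in> U" "norm v = 1"
    and min: "\<And>u. u \<in> U \<Longrightarrow> norm u = 1 \<Longrightarrow> v \<bullet> (S *v v) \<le> u \<bullet> (S *v u)"
    by auto
  define l where "l = v \<bullet> (S *v v)"
  have low: "l * (norm u)\<^sup>2 \<le> u \<bullet> (S *v u)" if u: "u \<in> U" for u
  proof (cases "u = 0")
    case False
    define w where "w = (1 / norm u) *\<^sub>R u"
    have w: "w \<in> U" "norm w = 1" using u False subspace_scale[OF U(1)] by (auto simp: w_def)
    have "u = norm u *\<^sub>R w" using False by (simp add: w_def)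
    then have "u \<bullet> (S *v u) = (norm u *\<^sub>R w) \<bullet> (S *v (norm u *\<^sub>R w))" by simp
    also have "\<dots> = (norm u)\<^sup>2 * (w \<bullet> (S *v w))"
      by (simp add: matrix_vector_mult_scaleR power2_eq_square)
    finally show ?thesis using mult_right_mono[OF min[OF w], of "(norm u)\<^sup>2"]
      by (simp add: l_def mult.commute)
  qed simp
  have ortho: "0 \<le> w \<bullet> (S *v v - l *\<^sub>R v)" if w: "w \<in> U" for w
  proof -
    have "0 \<le> 2 * (w \<bullet> (S *v v - l *\<^sub>R v))"
    proof (rule linear_coeff_nonneg)
      fix t :: real
      have "v + t *\<^sub>R w \<in> U" using v w by (intro subspace_add[OF U(1)] subspace_scale[OF U(1)])
      then have "0 \<le> (v + t *\<^sub>R w) \<bullet> (S *v (v + t *\<^sub>R w)) - l * (norm (v + t *\<^sub>R w))\<^sup>2"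
        using low by simp
      also have "(norm (v + t *\<^sub>R w))\<^sup>2 = (norm v)\<^sup>2 + 2 * t * (w \<bullet> v) + t\<^sup>2 * (norm w)\<^sup>2"
        by (simp only: power2_norm_eq_inner inner_add_left inner_add_right inner_scaleR_left
            inner_scaleR_right inner_commute[of v w]) (simp add: algebra_simps power2_eq_square)
      also have "(v + t *\<^sub>R w) \<bullet> (S *v (v + t *\<^sub>R w))
          = v \<bullet> (S *v v) + 2 * t * (w \<bullet> (S *v v)) + t\<^sup>2 * (w \<bullet> (S *v w))"
        using sym[of v w]
        by (simp add: matrix_vector_right_distrib matrix_vector_mult_scaleR inner_add_left
            inner_add_right power2_eq_square inner_commute algebra_simps)
      finally show "0 \<le> t * (2 * (w \<bullet> (S *v v - l *\<^sub>R v))) + t\<^sup>2 * (w \<bullet> (S *v w) - l * (norm w)\<^sup>2)"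
        by (simp add: v l_def[symmetric] inner_diff_right algebra_simps)
    qed
    then show ?thesis by simp
  qed
  have "S *v v - l *\<^sub>R v \<in> U" using v U by (intro subspace_diff subspace_scale) auto
  then have "- (S *v v - l *\<^sub>R v) \<in> U" using subspace_neg[OF U(1)] by blast
  then have "(S *v v - l *\<^sub>R v) \<bullet> (S *v v - l *\<^sub>R v) \<le> 0" using ortho[of "- (S *v v - l *\<^sub>R v)"]
    unfolding inner_minus_left by linarith
  then have "S *v v - l *\<^sub>R v = 0" by (metis inner_eq_zero_iff inner_ge_zero order_antisym)
  then have "S *v v = l *\<^sub>R v" by simp
  moreover have "v \<noteq> 0" using v by auto
  ultimately show ?thesis using low v(1) by (auto simp: eigenvalues_def)
qed

lemma gram_symmetric: "((transpose A ** A) *v u) \<bullet> v = u \<bullet> ((transpose A ** A) *v v)"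
  for A :: "real^'i^'j"
  unfolding gram_inner inner_commute[of u] by (rule inner_commute)

lemma gram_quadratic: "u \<bullet> ((transpose A ** A) *v u) = (norm (A *v u))\<^sup>2" for A :: "real^'i^'j"
  unfolding inner_commute[of u] gram_inner power2_norm_eq_inner ..

lemma lambda_max_bound:
  fixes A :: "real^'i^'j"
  assumes max: "lambda_max (transpose A ** A) \<le> L\<^sup>2" and L: "0 \<le> L"
  shows "norm (A *v u) \<le> L * norm u"
proof (cases "u = 0")
  case False
  define S where "S = transpose A ** A"
  have neg: "(- S) *v w = - (S *v w)" for w
    by (simp add: matrix_vector_mult_def vec_eq_iff sum_negf)
  have sym: "((- S) *v u) \<bullet> v = u \<bullet> ((- S) *v v)" for u v
    unfolding neg inner_minus_left inner_minus_right using gram_symmetric[of A u v] by (simp only: S_def)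
  obtain l v where lv: "v \<noteq> 0" "(- S) *v v = l *\<^sub>R v" "\<And>u. l * (norm u)\<^sup>2 \<le> u \<bullet> ((- S) *v u)"
    using rayleigh_minimum[OF sym subspace_UNIV UNIV_I UNIV_I False] by blast
  have "S *v v = (- l) *\<^sub>R v" using arg_cong[OF lv(2), of uminus] unfolding neg by simp
  then have "- l \<in> eigenvalues S" using lv(1) unfolding eigenvalues_def by blast
  moreover have "finite (eigenvalues S)"
    unfolding S_def by (rule finite_eigenvalues_symmetric[OF gram_symmetric])
  ultimately have "- l \<le> lambda_max S" unfolding lambda_max_def by (intro Max_ge)
  then have "- l \<le> L\<^sup>2" using max unfolding S_def by linarith
  then have "- l * (norm u)\<^sup>2 \<le> L\<^sup>2 * (norm u)\<^sup>2" by (rule mult_right_mono) simp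
  moreover have "(norm (A *v u))\<^sup>2 \<le> - l * (norm u)\<^sup>2"
    using lv(3)[of u] unfolding neg inner_minus_right unfolding S_def gram_quadratic by simp
  ultimately have "(norm (A *v u))\<^sup>2 \<le> (L * norm u)\<^sup>2" by (simp add: power_mult_distrib)
  then show ?thesis by (rule power2_le_imp_le) (simp add: L)
qed simp

lemma lambda_min_bound:
  fixes A :: "real^'i^'j"
  assumes min: "\<mu>\<^sup>2 \<le> lambda_min (transpose A ** A)"
  shows "\<mu>\<^sup>2 * (norm u)\<^sup>2 \<le> (norm (A *v u))\<^sup>2"
proof (cases "u = 0")
  case False
  obtain l where l: "l \<in> eigenvalues (transpose A ** A)"
      "\<And>u. l * (norm u)\<^sup>2 \<le> u \<bullet> ((transpose A ** A) *v u)"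
    using rayleigh_minimum[OF gram_symmetric subspace_UNIV UNIV_I UNIV_I False] by blast
  have "lambda_min (transpose A ** A) \<le> l"
    unfolding lambda_min_def by (rule Min_le[OF finite_eigenvalues_symmetric[OF gram_symmetric] l(1)])
  then have "\<mu>\<^sup>2 * (norm u)\<^sup>2 \<le> l * (norm u)\<^sup>2" using min by (intro mult_right_mono) auto
  then show ?thesis using l(2)[of u] unfolding gram_quadratic by linarith
qed simp

text \<open>
  On the range of the transpose the Gram matrix is positive definite, so the smallest eigenvalue there
  is one of the positive eigenvalues.
\<close>
lemma lambda_min_pos_bound:
  fixes A :: "real^'i^'j"
  assumes \<mu>: "\<mu>\<^sup>2 \<le> lambda_min_pos (transpose A ** A)" and u: "u \<in> range (\<lambda>v. transpose A *v v)"
  shows "\<mu>\<^sup>2 * (norm u)\<^sup>2 \<le> (norm (A *v u))\<^sup>2"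
proof (cases "u = 0")
  case False
  let ?U = "range (\<lambda>v. transpose A *v v)"
  have U: "subspace ?U"
    using linear_subspace_image[OF matrix_vector_mul_linear subspace_UNIV] .
  have inv: "(transpose A ** A) *v w \<in> ?U" for w
    unfolding matrix_vector_mul_assoc[symmetric] by (rule rangeI)
  obtain l v where l: "l \<in> eigenvalues (transpose A ** A)" "v \<in> ?U" "v \<noteq> 0"
      "(transpose A ** A) *v v = l *\<^sub>R v"
      "\<And>u. u \<in> ?U \<Longrightarrow> l * (norm u)\<^sup>2 \<le> u \<bullet> ((transpose A ** A) *v u)"
    using rayleigh_minimum[OF gram_symmetric U inv u False] by blast
  obtain w where w: "v = transpose A *v w" using l(2) by blast
  have "v \<bullet> v = w \<bullet> (A *v v)"
    using matrix_adjoint[of A v w] unfolding w[symmetric] inner_commute[of w] by (rule sym)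
  then have "A *v v \<noteq> 0" using l(3) by auto
  moreover have "l * (norm v)\<^sup>2 = (norm (A *v v))\<^sup>2"
    using gram_quadratic[of v A] unfolding l(4) by (simp add: power2_norm_eq_inner)
  ultimately have "0 < l * (norm v)\<^sup>2" by simp
  then have "0 < l" by (simp add: zero_less_mult_iff)
  then have "Min {l \<in> eigenvalues (transpose A ** A). 0 < l} \<le> l"
    using l(1) finite_eigenvalues_symmetric[OF gram_symmetric[of A]] by (intro Min_le) auto
  then have "\<mu>\<^sup>2 \<le> l" using \<mu> unfolding lambda_min_pos_def by (rule order_trans[rotated])
  then have "\<mu>\<^sup>2 * (norm u)\<^sup>2 \<le> l * (norm u)\<^sup>2" by (rule mult_right_mono) simp
  then show ?thesis using l(5)[OF u] unfolding gram_quadratic by linarith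
qed simp


section \<open>Hoelder continuous subgradients\<close>

text \<open>
  A comparison of the sum with the integral of \<open>t powr \<nu>\<close>.
\<close>
lemma sum_powr_le:
  fixes \<nu> :: real
  assumes "0 < \<nu>"
  shows "(\<Sum>k=1..N. real k powr \<nu>) \<le> real (Suc N) powr (1 + \<nu>) / (1 + \<nu>)"
proof (induction N)
  case (Suc N)
  have divide_step: "x + y / (1 + \<nu>) \<le> z / (1 + \<nu>)" if "(1 + \<nu>) * x \<le> z - y" for x y z
  proof -
    have "x \<le> (z - y) / (1 + \<nu>)" using that assms by (simp add: pos_le_divide_eq mult.commute)
    then show ?thesis by (simp add: diff_divide_distrib)
  qed
  have "\<exists>z. real (Suc N) < z \<and> z < real (Suc (Suc N)) \<and>
      real (Suc (Suc N)) powr (1 + \<nu>) - real (Suc N) powr (1 + \<nu>)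
      = (real (Suc (Suc N)) - real (Suc N)) * ((1 + \<nu>) * z powr \<nu>)"
    by (rule MVT2) (auto intro!: derivative_eq_intros)
  then obtain z where z: "real (Suc N) < z"
      "real (Suc (Suc N)) powr (1 + \<nu>) - real (Suc N) powr (1 + \<nu>) = (1 + \<nu>) * z powr \<nu>"
    by auto
  have "real (Suc N) powr \<nu> \<le> z powr \<nu>" using z assms by (intro powr_mono2) auto
  then have "(1 + \<nu>) * real (Suc N) powr \<nu> \<le> real (Suc (Suc N)) powr (1 + \<nu>) - real (Suc N) powr (1 + \<nu>)"
    unfolding z(2) using assms by (intro mult_left_mono) auto
  then have "real (Suc N) powr \<nu> + real (Suc N) powr (1 + \<nu>) / (1 + \<nu>) \<le> real (Suc (Suc N)) powr (1 + \<nu>) / (1 + \<nu>)"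
    by (rule divide_step)
  then show ?case using Suc by simp
qed (use assms in simp)

text \<open>
  For a smooth \<open>h\<close> one would integrate the gradient along the segment.  Here a subdivision of the segment
  into \<open>N\<close> pieces, with the subgradient inequality on each of them, replaces the integral by a Riemann
  sum; the sharp constant \<open>1 / (1 + \<nu>)\<close> appears for \<open>N\<close> going to infinity.
\<close>
lemma holder_descent:
  fixes h :: "'a::real_inner \<Rightarrow> real" and s :: "'a \<Rightarrow> 'a"
  assumes S: "convex S" and sub: "\<And>x u. x \<in> S \<Longrightarrow> u \<in> S \<Longrightarrow> h x + s x \<bullet> (u - x) \<le> h u"
    and holder: "\<And>x u. x \<in> S \<Longrightarrow> u \<in> S \<Longrightarrow> norm (s x - s u) \<le> H * rpow (norm (x - u)) \<nu>"
    and \<nu>: "0 \<le> \<nu>" and w: "w \<in> S" and u: "u \<in> S"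
  shows "h u \<le> h w + s w \<bullet> (u - w) + H / (1 + \<nu>) * norm (u - w) powr (1 + \<nu>)"
proof -
  define r where "r = norm (u - w)"
  have slope: "s x \<bullet> (u - w) \<le> s w \<bullet> (u - w) + H * rpow (norm (x - w)) \<nu> * r" if "x \<in> S" for x
  proof -
    have "s x \<bullet> (u - w) = s w \<bullet> (u - w) + (s x - s w) \<bullet> (u - w)" by (simp add: inner_diff_left)
    also have "(s x - s w) \<bullet> (u - w) \<le> norm (s x - s w) * r"
      unfolding r_def by (rule norm_cauchy_schwarz)
    also have "\<dots> \<le> H * rpow (norm (x - w)) \<nu> * r"
      using holder[OF that w] unfolding r_def by (intro mult_right_mono) auto
    finally show ?thesis by simp
  qed
  show ?thesis
  proof (cases "\<nu> = 0")
    case True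
    have "h u + s u \<bullet> (w - u) \<le> h w" by (rule sub[OF u w])
    then have "h u \<le> h w + s u \<bullet> (u - w)" by (simp add: inner_diff_right)
    then show ?thesis using slope[OF u] True by (simp add: rpow_def r_def)
  next
    case False
    then have \<nu>: "0 < \<nu>" using \<nu> by simp
    have H: "0 \<le> H * r powr (1 + \<nu>)"
    proof -
      have "0 \<le> H * r powr \<nu>" using order_trans[OF norm_ge_zero holder[OF u w]] False
        by (simp add: rpow_def r_def)
      then have "0 \<le> (H * r powr \<nu>) * r" by (rule mult_nonneg_nonneg) (simp add: r_def)
      moreover have "r powr \<nu> * r = r powr (1 + \<nu>)"
        by (cases "r = 0") (simp_all add: powr_add r_def)
      ultimately show ?thesis by (simp only: mult.assoc)
    qed
    have bound: "h u - h w - s w \<bullet> (u - w)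
        \<le> H * r powr (1 + \<nu>) / (1 + \<nu>) * (1 + 1 / real N) powr (1 + \<nu>)" if N: "1 \<le> N" for N :: nat
    proof -
      define x where "x k = w + (real k / real N) *\<^sub>R (u - w)" for k
      have xS: "x k \<in> S" if "k \<le> N" for k
      proof -
        have "x k = (1 - real k / real N) *\<^sub>R w + (real k / real N) *\<^sub>R u"
          by (simp add: x_def algebra_simps)
        then show ?thesis using that N by (auto intro!: convexD[OF S w u])
      qed
      have inc: "h (x (Suc k)) - h (x k) \<le> 1 / real N * (s w \<bullet> (u - w))
          + H * r powr (1 + \<nu>) / real N powr (1 + \<nu>) * real (Suc k) powr \<nu>" if k: "k < N" for k
      proof -
        have d: "x (Suc k) - x k = (1 / real N) *\<^sub>R (u - w)"
          by (simp add: x_def scaleR_diff_left[symmetric] diff_divide_distrib[symmetric])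
        have "h (x (Suc k)) + s (x (Suc k)) \<bullet> (x k - x (Suc k)) \<le> h (x k)"
          using k by (intro sub xS) auto
        then have "h (x (Suc k)) - h (x k) \<le> s (x (Suc k)) \<bullet> (x (Suc k) - x k)"
          by (simp add: inner_diff_right)
        also have "\<dots> = 1 / real N * (s (x (Suc k)) \<bullet> (u - w))" unfolding d by simp
        also have "\<dots> \<le> 1 / real N * (s w \<bullet> (u - w) + H * rpow (norm (x (Suc k) - w)) \<nu> * r)"
          using k by (intro mult_left_mono slope xS) auto
        also have "norm (x (Suc k) - w) = real (Suc k) / real N * r"
          by (simp add: x_def r_def)
        also have "rpow (real (Suc k) / real N * r) \<nu> = real (Suc k) powr \<nu> / real N powr \<nu> * r powr \<nu>"
          using False N by (simp add: rpow_def powr_mult powr_divide r_def)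
        also have "1 / real N * (s w \<bullet> (u - w) + H * (real (Suc k) powr \<nu> / real N powr \<nu> * r powr \<nu>) * r)
           = 1 / real N * (s w \<bullet> (u - w)) + H * (r powr \<nu> * r) / (real N powr \<nu> * real N) * real (Suc k) powr \<nu>"
          by (simp add: distrib_left mult_ac)
        also have "r powr \<nu> * r = r powr (1 + \<nu>)"
          by (cases "r = 0") (simp_all add: powr_add r_def)
        also have "real N powr \<nu> * real N = real N powr (1 + \<nu>)"
          using N by (simp add: powr_add)
        finally show ?thesis .
      qed
      have "h u - h w = (\<Sum>k<N. h (x (Suc k)) - h (x k))"
        using N by (subst sum_lessThan_telescope) (simp add: x_def)
      also have "\<dots> \<le> (\<Sum>k<N. 1 / real N * (s w \<bullet> (u - w))
          + H * r powr (1 + \<nu>) / real N powr (1 + \<nu>) * real (Suc k) powr \<nu>)"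
        by (intro sum_mono inc) simp
      also have "\<dots> = s w \<bullet> (u - w) + H * r powr (1 + \<nu>) / real N powr (1 + \<nu>) * (\<Sum>k<N. real (Suc k) powr \<nu>)"
        using N by (simp add: sum.distrib sum_distrib_left)
      also have "(\<Sum>k<N. real (Suc k) powr \<nu>) = (\<Sum>k=1..N. real k powr \<nu>)"
        by (rule sum.reindex_bij_witness[of _ "\<lambda>k. k - 1" Suc]) auto
      also have "H * r powr (1 + \<nu>) / real N powr (1 + \<nu>) * (\<Sum>k=1..N. real k powr \<nu>)
         \<le> H * r powr (1 + \<nu>) / real N powr (1 + \<nu>) * (real (Suc N) powr (1 + \<nu>) / (1 + \<nu>))"
        using H by (intro mult_left_mono sum_powr_le[OF \<nu>]) auto
      also have "\<dots> = H * r powr (1 + \<nu>) / (1 + \<nu>) * (real (Suc N) powr (1 + \<nu>) / real N powr (1 + \<nu>))"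
        by simp
      also have "real (Suc N) powr (1 + \<nu>) / real N powr (1 + \<nu>) = (1 + 1 / real N) powr (1 + \<nu>)"
        using N by (subst powr_divide[symmetric]) (simp_all add: field_simps)
      finally show ?thesis by simp
    qed
    have "(\<lambda>N. 1 / real N) \<longlonglongrightarrow> 0" by (rule lim_1_over_n)
    then have "(\<lambda>N. H * r powr (1 + \<nu>) / (1 + \<nu>) * (1 + 1 / real N) powr (1 + \<nu>))
        \<longlonglongrightarrow> H * r powr (1 + \<nu>) / (1 + \<nu>) * (1 + 0) powr (1 + \<nu>)"
      by (intro tendsto_intros) simp_all
    then have "h u - h w - s w \<bullet> (u - w) \<le> H * r powr (1 + \<nu>) / (1 + \<nu>) * (1 + 0) powr (1 + \<nu>)"
      by (rule LIMSEQ_le_const) (use bound in auto)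
    then show ?thesis by (simp add: r_def)
  qed
qed

text \<open>Weighted Young inequality between the exponents \<open>2 / (1 + \<nu>)\<close> and \<open>2 / (1 - \<nu>)\<close>; the smoothness
  constant is the one that makes the remainder equal to \<open>\<delta>\<close>.\<close>
lemma holder_smooth_young:
  assumes \<nu>: "0 \<le> \<nu>" "\<nu> < 1" and H: "0 < H" and \<delta>: "0 < \<delta>" and r: "0 \<le> r"
  shows "H / (1 + \<nu>) * r powr (1 + \<nu>) \<le> holder_smooth H \<nu> L \<delta> / 2 * r\<^sup>2 + \<delta>"
proof (cases "r = 0")
  case True then show ?thesis using \<delta> by simp
next
  case False
  then have r: "0 < r" using r by simp
  define q where "q = (1 - \<nu>) / (1 + \<nu>)"
  define B where "B = (1 - \<nu>) / (2 * (1 + \<nu>) * \<delta>)"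
  define R where "R = 1 / (H * B)"
  define r0 where "r0 = R powr (1 / (1 + \<nu>))"
  have B: "0 < B" and R: "0 < R" using \<nu> \<delta> H by (simp_all add: B_def R_def)
  have r0: "0 < r0" using R by (simp add: r0_def)
  have e1: "r0 powr (1 + \<nu>) = R" using R \<nu> by (simp add: r0_def powr_powr)
  have e2: "r0 powr (\<nu> - 1) = (H * B) powr q"
  proof -
    have "r0 powr (\<nu> - 1) = R powr (- q)"
    proof -
      have "1 / (1 + \<nu>) * (\<nu> - 1) = - q" by (simp add: q_def minus_divide_left)
      then show ?thesis by (simp only: r0_def powr_powr)
    qed
    then show ?thesis using H B by (simp add: R_def powr_minus powr_divide)
  qed
  have "(r\<^sup>2) powr ((1 + \<nu>) / 2) * (r0\<^sup>2) powr ((1 - \<nu>) / 2)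
      \<le> (1 + \<nu>) / 2 * r\<^sup>2 + (1 - \<nu>) / 2 * r0\<^sup>2"
    using \<nu> r r0 by (intro Youngs_inequality_0) (auto simp: field_simps)
  moreover have sq: "(x\<^sup>2) powr (e / 2) = x powr e" if "0 < x" for x e :: real
    using powr_powr[of x 2 "e / 2"] that by simp
  have "(r\<^sup>2) powr ((1 + \<nu>) / 2) = r powr (1 + \<nu>)"
    "(r0\<^sup>2) powr ((1 - \<nu>) / 2) = r0 powr (1 - \<nu>)"
    using r r0 by (simp_all only: sq)
  ultimately have "r powr (1 + \<nu>) * r0 powr (1 - \<nu>) \<le> (1 + \<nu>) / 2 * r\<^sup>2 + (1 - \<nu>) / 2 * r0\<^sup>2" by simp
  then have young: "H / (1 + \<nu>) * r0 powr (\<nu> - 1) * (r powr (1 + \<nu>) * r0 powr (1 - \<nu>))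
     \<le> H / (1 + \<nu>) * r0 powr (\<nu> - 1) * ((1 + \<nu>) / 2 * r\<^sup>2 + (1 - \<nu>) / 2 * r0\<^sup>2)"
    using H \<nu> by (intro mult_left_mono) auto
  have "r0 powr (\<nu> - 1) * r0 powr (1 - \<nu>) = 1"
    using r0 by (simp flip: powr_add)
  then have lhs: "H / (1 + \<nu>) * r0 powr (\<nu> - 1) * (r powr (1 + \<nu>) * r0 powr (1 - \<nu>)) = H / (1 + \<nu>) * r powr (1 + \<nu>)"
    by (simp add: mult.assoc mult.left_commute)
  have sqR: "r0 powr (\<nu> - 1) * r0\<^sup>2 = R"
    unfolding e1[symmetric] using r0 powr_add[of r0 "\<nu> - 1" 2] by simp
  have expand: "a / (1 + \<nu>) * b * ((1 + \<nu>) / 2 * x + (1 - \<nu>) / 2 * y)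
      = a * b / 2 * x + a * ((1 - \<nu>) / (2 * (1 + \<nu>))) * (b * y)" for a b x y :: real
    using \<nu> by (simp add: field_simps)
  have \<delta>_eq: "H * ((1 - \<nu>) / (2 * (1 + \<nu>))) * R = \<delta>"
    using H \<nu> \<delta> by (simp add: R_def B_def)
  have L_eq: "H * r0 powr (\<nu> - 1) = holder_smooth H \<nu> L \<delta>"
  proof -
    have "1 + q = 2 / (1 + \<nu>)" using \<nu> by (simp add: q_def field_simps)
    then have "H * H powr q = H powr (2 / (1 + \<nu>))" using H by (metis powr_add powr_one less_imp_le)
    then show ?thesis unfolding e2 holder_smooth_def B_def[symmetric] q_def[symmetric]
      using H B \<nu> by (simp add: powr_mult)
  qed
  show ?thesis using young unfolding lhs expand sqR \<delta>_eq L_eq .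
qed

lemma holder_smooth_descent:
  fixes h :: "'a::real_inner \<Rightarrow> real" and s :: "'a \<Rightarrow> 'a"
  assumes S: "convex S" and sub: "\<And>x u. x \<in> S \<Longrightarrow> u \<in> S \<Longrightarrow> h x + s x \<bullet> (u - x) \<le> h u"
    and holder: "\<And>x u. x \<in> S \<Longrightarrow> u \<in> S \<Longrightarrow> norm (s x - s u) \<le> H * rpow (norm (x - u)) \<nu>"
    and \<nu>: "0 \<le> \<nu>" "\<nu> \<le> 1" and H: "0 < H" and w: "w \<in> S" and u: "u \<in> S"
    and \<delta>: "0 < \<delta>"
  shows "h u \<le> h w + s w \<bullet> (u - w) + holder_smooth H \<nu> H \<delta> / 2 * (norm (u - w))\<^sup>2
     + (if \<nu> = 1 then 0 else \<delta>)"
proof -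
  note 1 = holder_descent[OF S sub holder \<nu>(1) w u]
  show ?thesis
  proof (cases "\<nu> = 1")
    case True
    have "norm (u - w) powr 2 = (norm (u - w))\<^sup>2" by (cases "u = w") simp_all
    then show ?thesis using 1 True by (simp add: holder_smooth_def)
  next
    case False
    then show ?thesis using 1 holder_smooth_young[of \<nu> H \<delta> "norm (u - w)" H] \<nu> H \<delta> by simp
  qed
qed

lemma holder_smooth_pos: "0 < H \<Longrightarrow> 0 < L \<Longrightarrow> 0 < \<delta> \<Longrightarrow> 0 \<le> \<nu> \<Longrightarrow> \<nu> \<le> 1 \<Longrightarrow> 0 < holder_smooth H \<nu> L \<delta>"
  by (auto simp: holder_smooth_def)


section \<open>Bregman distances\<close>

lemma bregman_nonneg: "s \<in> subdifferential h v \<Longrightarrow> 0 \<le> bregman h s u v"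
  unfolding subdifferential_def bregman_def by (simp add: algebra_simps)

lemma bregman_le_inner:
  assumes "s' \<in> subdifferential h u"
  shows "bregman h s u v \<le> (s' - s) \<bullet> (u - v)"
proof -
  have "h u + s' \<bullet> (v - u) \<le> h v" using assms by (simp add: subdifferential_def)
  then show ?thesis by (simp add: bregman_def inner_diff_left inner_diff_right)
qed

text \<open>
  Strong convexity along the segment from \<open>v\<close> to \<open>u\<close>, to first order at \<open>v\<close>.
\<close>
lemma strongly_convex_bregman:
  assumes sc: "strongly_convex_on S \<mu> h" and mem: "u \<in> S" "v \<in> S" and s: "s \<in> subdifferential h v"
  shows "\<mu> / 2 * (norm (u - v))\<^sup>2 \<le> bregman h s u v"
proof -
  define N where "N = (norm (u - v))\<^sup>2"
  have "0 \<le> bregman h s u v - \<mu> / 2 * N"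
  proof (rule linear_coeff_nonneg)
    fix t :: real assume t: "0 < t" "t \<le> 1"
    have "h v + s \<bullet> (((1 - t) *\<^sub>R v + t *\<^sub>R u) - v) \<le> h ((1 - t) *\<^sub>R v + t *\<^sub>R u)"
      using s by (simp add: subdifferential_def)
    also have "\<dots> \<le> (1 - t) * h v + t * h u - \<mu> / 2 * t * (1 - t) * N"
      using sc mem t unfolding strongly_convex_on_def N_def norm_minus_commute[of u v] by auto
    also have "((1 - t) *\<^sub>R v + t *\<^sub>R u) - v = t *\<^sub>R (u - v)" by (simp add: algebra_simps)
    finally show "0 \<le> t * (bregman h s u v - \<mu> / 2 * N) + t\<^sup>2 * (\<mu> / 2 * N)"
      by (simp add: bregman_def algebra_simps power2_eq_square diff_divide_distrib)
  qed
  then show ?thesis by (simp add: N_def)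
qed

text \<open>
  The function minus its linearization at \<open>v\<close> is nonnegative, in particular after one gradient step
  of length \<open>1 / L\<close> from \<open>u\<close>; the descent inequality bounds what that step gains.  The
  subgradient at \<open>v\<close> may be arbitrary.
\<close>
lemma cocoercive:
  fixes h :: "'a::real_inner \<Rightarrow> real" and s :: "'a \<Rightarrow> 'a"
  assumes sub: "\<And>x. s x \<in> subdifferential h x" and lip: "L-lipschitz_on UNIV s" and L: "0 < L"
    and sv: "sv \<in> subdifferential h v"
  shows "(norm (s u - sv))\<^sup>2 \<le> 2 * L * bregman h sv u v"
proof -
  define g where "g = s u - sv"
  define y where "y = u - (1 / L) *\<^sub>R g"
  have "h y \<le> h u + s u \<bullet> (y - u) + L / (1 + 1) * norm (y - u) powr (1 + 1)"
  proof (rule holder_descent[of UNIV])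
    show "norm (s x - s u) \<le> L * rpow (norm (x - u)) 1" for x u
      using lipschitz_onD[OF lip, of x u] by (cases "x = u") (simp_all add: rpow_def dist_norm)
  qed (use sub in \<open>auto simp: subdifferential_def\<close>)
  also have "L / (1 + 1) * norm (y - u) powr (1 + 1) = L / 2 * (norm (y - u))\<^sup>2"
    by (cases "y = u") simp_all
  also have "y - u = - (1 / L) *\<^sub>R g" by (simp add: y_def)
  finally have 1: "h y \<le> h u - s u \<bullet> g / L + (norm g)\<^sup>2 / (2 * L)"
    using L by (simp add: power_mult_distrib power2_eq_square)
  have "h v + sv \<bullet> (y - v) \<le> h y" using sv by (simp add: subdifferential_def)
  also have "sv \<bullet> (y - v) = sv \<bullet> (u - v) - sv \<bullet> g / L"
    by (simp add: y_def inner_diff_right)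
  finally have "0 \<le> bregman h sv u v - (s u \<bullet> g - sv \<bullet> g) / L + (norm g)\<^sup>2 / (2 * L)"
    using 1 by (simp add: bregman_def diff_divide_distrib)
  also have "s u \<bullet> g - sv \<bullet> g = (norm g)\<^sup>2" by (simp add: g_def power2_norm_eq_inner inner_diff_left)
  finally show ?thesis using L by (simp add: g_def field_simps)
qed

section \<open>The regularized problem\<close>

lemma rpow_nonneg: "0 \<le> r \<Longrightarrow> 0 \<le> rpow r a"
  by (simp add: rpow_def)

locale regularized_problem =
  fixes D :: "('x::finite, 'y::finite) saddle_data" and \<epsilon> :: real and r :: "('x, 'y) saddle_ref"
  assumes mixed: "mixed_regime D" and \<epsilon>: "0 < \<epsilon>"
    and saddle: "regularized_saddle D \<epsilon> r" and compat: "compatible D \<epsilon> r"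
    and xi0: "xi_star r = 0" and zeta0: "zeta_star r = 0"
begin

abbreviation "B \<equiv> matB D"
abbreviation "Bt \<equiv> transpose (matB D)"
abbreviation "\<Lambda> \<equiv> lambda_y D \<epsilon>"
abbreviation "\<delta> \<equiv> delta_x_reg D \<epsilon>"
abbreviation "xs \<equiv> x_star r"
abbreviation "ys \<equiv> y_star r"
abbreviation "fs \<equiv> f_star r"
abbreviation "gs \<equiv> g_reg_star D \<epsilon> r"

lemma standing: "standing_assumptions D"
  using mixed by (simp add: mixed_regime_def)

lemma X_props: "domX D \<noteq> {}" "closed (domX D)" "convex (domX D)"
  and Y_props: "domY D \<noteq> {}" "closed (domY D)" "convex (domY D)"
  and f_sub: "fsub D x \<in> subdifferential (fobj D) x"
  and g_sub: "gsub D y \<in> subdifferential (gobj D) y"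
  and mu_x_nonneg: "0 \<le> mu_x D" and f_strong: "strongly_convex_on (domX D) (mu_x D) (fobj D)"
  and nu_x: "0 \<le> nu_x D" "nu_x D \<le> 1" and H_x_pos: "0 < H_x D"
  and f_holder: "holder_subgradients_on (domX D) (H_x D) (nu_x D) (fobj D)"
  and nu_y: "0 \<le> nu_y D" "nu_y D \<le> 1" and H_y_pos: "0 < H_y D"
  and g_holder: "holder_subgradients_on (domY D) (H_y D) (nu_y D) (gobj D)"
  and L_xy_pos: "0 < L_xy D"
  and lambda_max_B: "lambda_max (Bt ** B) \<le> (L_xy D)\<^sup>2"
  and f_lip: "nu_x D = 1 \<Longrightarrow> (H_x D)-lipschitz_on UNIV (fsub D)"
  and g_lip: "nu_y D = 1 \<Longrightarrow> (H_y D)-lipschitz_on UNIV (gsub D)"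
  using standing unfolding standing_assumptions_def by simp_all

lemma lower_spectrum: "if inv_Rx D then range_condition B (domX D) (fobj D) (mu_xy D)
      else (mu_xy D)\<^sup>2 \<le> lambda_min (Bt ** B)"
  using standing unfolding standing_assumptions_def by blast

lemma Omega_pos: "0 < Omega_y D" and Y_bounded: "bounded (domY D)" and z_init: "z_init D \<in> domZ D"
  and delta_pos: "0 < delta_x D"
  using mixed by (simp_all add: mixed_regime_def)

lemma lam_pos: "0 < \<Lambda>"
  using \<epsilon> Omega_pos by (simp add: lambda_y_def)

lemma beta_x_nonneg: "0 \<le> beta_x_reg D \<epsilon>" and beta_y_nonneg: "0 \<le> beta_y_reg D \<epsilon>"
  using H_y_pos H_x_pos lam_pos by (simp_all add: beta_x_reg_def beta_y_reg_def beta_y_def)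

lemma del_pos: "0 < \<delta>"
proof (cases "nu_y D = 1")
  case True
  then have "0 < mu_x D \<or> mu_xy D \<noteq> 0"
    using delta_pos mu_x_nonneg H_y_pos by (auto simp: delta_x_def beta_x_def)
  moreover have "0 < beta_x_reg D \<epsilon>" using True H_y_pos lam_pos by (simp add: beta_x_reg_def)
  ultimately show ?thesis using mu_x_nonneg unfolding delta_x_reg_def
    by (auto intro: add_pos_nonneg add_nonneg_pos)
next
  case False
  then show ?thesis using delta_pos by (simp add: delta_x_reg_def beta_x_reg_def delta_x_def beta_x_def)
qed

lemma del_le: "\<delta> \<le> delta_x D"
proof -
  have "beta_x_reg D \<epsilon> \<le> beta_x D"
    using H_y_pos lam_pos by (auto simp: beta_x_reg_def beta_x_def intro!: divide_left_mono)
  then show ?thesis unfolding delta_x_reg_def delta_x_def by (simp add: mult_right_mono)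
qed

lemma B_bound: "norm (B *v u) \<le> L_xy D * norm u"
  by (rule lambda_max_bound[OF lambda_max_B]) (use L_xy_pos in simp)

lemma Bt_bound: "norm (Bt *v v) \<le> L_xy D * norm v"
proof -
  have "(norm (Bt *v v))\<^sup>2 = v \<bullet> (B *v (Bt *v v))"
    using matrix_adjoint[of B "Bt *v v" v] by (simp only: power2_norm_eq_inner inner_commute)
  also have "\<dots> \<le> norm v * (L_xy D * norm (Bt *v v))"
    by (rule order_trans[OF norm_cauchy_schwarz mult_left_mono[OF B_bound norm_ge_zero]])
  finally have "norm (Bt *v v) * norm (Bt *v v) \<le> (L_xy D * norm v) * norm (Bt *v v)"
    by (simp only: power2_eq_square) (simp only: mult_ac)
  then show ?thesis using L_xy_pos
    by (cases "norm (Bt *v v) = 0") (auto dest: mult_right_le_imp_le)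
qed

lemma saddle_mem: "xs \<in> domX D" "ys \<in> domY D"
  and fs_sub: "fs \<in> subdifferential (fobj D) xs"
  and gstar_sub: "g_star r \<in> subdifferential (gobj D) ys"
  and fs_eq: "fs = - (Bt *v ys)" and gs_eq: "gs = B *v xs"
  and init_range: "inv_Rx D \<Longrightarrow> fst (z_init D) - xs \<in> range (\<lambda>v. Bt *v v)"
  using saddle xi0 zeta0 unfolding regularized_saddle_def by (auto simp: eq_neg_iff_add_eq_0)

lemma quadratic_expansion:
  "(norm (u - c))\<^sup>2 = (norm (w - c))\<^sup>2 + 2 * ((w - c) \<bullet> (u - w)) + (norm (u - w))\<^sup>2"
  for u w c :: "'a::real_inner"
  by (simp add: power2_norm_eq_inner inner_diff_left inner_diff_right inner_commute)

lemma g_reg_expansion: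
  "g_reg D \<epsilon> u - g_reg D \<epsilon> w - (s + \<Lambda> *\<^sub>R (w - y_ref D)) \<bullet> (u - w)
   = gobj D u - gobj D w - s \<bullet> (u - w) + \<Lambda> / 2 * (norm (u - w))\<^sup>2"
  unfolding g_reg_def quadratic_expansion[of u "y_ref D" w] by (simp add: inner_add_left algebra_simps)

lemma g_reg_subdifferential:
  assumes "s \<in> subdifferential (gobj D) w"
  shows "s + \<Lambda> *\<^sub>R (w - y_ref D) \<in> subdifferential (g_reg D \<epsilon>) w"
  unfolding subdifferential_def mem_Collect_eq
proof
  fix u
  have "0 \<le> gobj D u - gobj D w - s \<bullet> (u - w)" using assms by (simp add: subdifferential_def algebra_simps)
  moreover have "0 \<le> \<Lambda> / 2 * (norm (u - w))\<^sup>2" using lam_pos by simp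
  ultimately show "g_reg D \<epsilon> w + (s + \<Lambda> *\<^sub>R (w - y_ref D)) \<bullet> (u - w) \<le> g_reg D \<epsilon> u"
    using g_reg_expansion[of u w s] by linarith
qed

lemma g_reg_sub: "g_reg_sub D \<epsilon> y \<in> subdifferential (g_reg D \<epsilon>) y"
  unfolding g_reg_sub_def by (rule g_reg_subdifferential[OF g_sub])

lemma gs_sub: "gs \<in> subdifferential (g_reg D \<epsilon>) ys"
  unfolding g_reg_star_def by (rule g_reg_subdifferential[OF gstar_sub])

definition Df :: "real^'x \<Rightarrow> real" where "Df x = bregman (fobj D) fs x xs"
definition Dg :: "real^'y \<Rightarrow> real" where "Dg y = bregman (g_reg D \<epsilon>) gs y ys"

lemma Df_nonneg: "0 \<le> Df x" and Dg_nonneg: "0 \<le> Dg y"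
  unfolding Df_def Dg_def by (rule bregman_nonneg fs_sub gs_sub)+

lemma Df_strong: "x \<in> domX D \<Longrightarrow> mu_x D / 2 * (norm (x - xs))\<^sup>2 \<le> Df x"
  unfolding Df_def by (rule strongly_convex_bregman[OF f_strong _ saddle_mem(1) fs_sub])

lemma Dg_strong: "\<Lambda> / 2 * (norm (y - ys))\<^sup>2 \<le> Dg y"
proof -
  have "Dg y = bregman (gobj D) (g_star r) y ys + \<Lambda> / 2 * (norm (y - ys))\<^sup>2"
    unfolding Dg_def bregman_def g_reg_star_def by (rule g_reg_expansion)
  then show ?thesis using bregman_nonneg[OF gstar_sub, of y] by simp
qed

lemma Psi_eq: "Psi D \<epsilon> r (x, y)
   = \<delta> * (norm (x - xs))\<^sup>2 + \<Lambda> * (norm (y - ys))\<^sup>2 + 12 * Df x + 12 * Dg y"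
  by (simp add: Psi_def P_norm_sq_def Df_def Dg_def delta_y_reg_def)

text \<open>
  The two summands of \<open>p3\<close> at the saddle point, where \<open>B x* = g'(y*)\<close> and \<open>B^T y* = - f'(x*)\<close>: they
  measure how much the gradients at the starting point differ from those at the saddle point.  The
  weights \<open>1 / (4 L)\<close> in \<open>beta_x_reg\<close> and \<open>beta_y_reg\<close> turn cocoercivity into the factor \<open>1 / 4\<close>.
\<close>
lemma f_smooth_residual: "beta_y_reg D \<epsilon> / 2 * (norm (Bt *v ys + fsub D x))\<^sup>2 \<le> Df x / 4"
proof (cases "nu_x D = 1")
  case True
  have "(norm (fsub D x - fs))\<^sup>2 \<le> 2 * H_x D * Df x"
    unfolding Df_def by (rule cocoercive[OF f_sub f_lip[OF True] H_x_pos fs_sub])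
  moreover have eq: "Bt *v ys + fsub D x = fsub D x - fs" by (simp add: fs_eq)
  ultimately show ?thesis
    unfolding eq using True H_x_pos by (simp add: beta_y_reg_def beta_y_def field_simps)
next
  case False
  then show ?thesis using Df_nonneg by (simp add: beta_y_reg_def beta_y_def)
qed

lemma g_smooth_residual: "beta_x_reg D \<epsilon> / 2 * (norm (B *v xs - g_reg_sub D \<epsilon> y))\<^sup>2 \<le> Dg y / 4"
proof (cases "nu_y D = 1")
  case True
  have lip: "(H_y D + \<Lambda>)-lipschitz_on UNIV (g_reg_sub D \<epsilon>)"
  proof (rule lipschitz_onI)
    fix u v
    have "norm (g_reg_sub D \<epsilon> u - g_reg_sub D \<epsilon> v) = norm ((gsub D u - gsub D v) + \<Lambda> *\<^sub>R (u - v))"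
      by (simp add: g_reg_sub_def algebra_simps)
    also have "\<dots> \<le> norm (gsub D u - gsub D v) + \<Lambda> * norm (u - v)"
      using lam_pos by (intro norm_triangle_le) simp
    also have "\<dots> \<le> H_y D * norm (u - v) + \<Lambda> * norm (u - v)"
      using lipschitz_onD[OF g_lip[OF True], of u v] by (simp add: dist_norm)
    finally show "dist (g_reg_sub D \<epsilon> u) (g_reg_sub D \<epsilon> v) \<le> (H_y D + \<Lambda>) * dist u v"
      by (simp add: dist_norm distrib_right)
  qed (use H_y_pos lam_pos in simp)
  have pos: "0 < H_y D + \<Lambda>" using H_y_pos lam_pos by simp
  have "(norm (g_reg_sub D \<epsilon> y - gs))\<^sup>2 \<le> 2 * (H_y D + \<Lambda>) * Dg y"
    unfolding Dg_def by (rule cocoercive[OF g_reg_sub lip pos gs_sub])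
  moreover have "norm (B *v xs - g_reg_sub D \<epsilon> y) = norm (g_reg_sub D \<epsilon> y - gs)"
    unfolding gs_eq by (rule norm_minus_commute)
  ultimately show ?thesis
    using True pos by (simp add: beta_x_reg_def field_simps)
next
  case False
  then show ?thesis using Dg_nonneg by (simp add: beta_x_reg_def)
qed

definition Rx :: "(real^'x) set" where
  "Rx = (if inv_Rx D then range (\<lambda>v. Bt *v v) else UNIV)"

definition scal :: "(real^'x) \<times> (real^'y) \<Rightarrow> (real^'x) \<times> (real^'y)" where
  "scal z = (sqrt \<delta> *\<^sub>R fst z, sqrt \<Lambda> *\<^sub>R snd z)"

lemma norm_scal: "(norm (scal z))\<^sup>2 = P_norm_sq D \<epsilon> z"
  using del_pos lam_pos
  by (simp add: scal_def norm_Pair P_norm_sq_def delta_y_reg_def power_mult_distrib)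

lemma subspace_Rx: "subspace Rx"
  using linear_subspace_image[OF matrix_vector_mul_linear subspace_UNIV, of Bt]
  by (simp add: Rx_def)

text \<open>
  The orthogonal complement of the range of the transpose is the kernel of \<open>B\<close>, under which the
  domain is invariant.
\<close>
lemma Rx_orthogonal:
  assumes "\<And>u. u \<in> Rx \<Longrightarrow> k \<bullet> u = 0" and x: "x \<in> domX D"
  shows "x + k \<in> domX D"
proof (cases "inv_Rx D")
  case True
  have "(B *v k) \<bullet> v = 0" for v
    unfolding matrix_adjoint using assms(1) True by (simp add: Rx_def del: transpose_matrix_vector)
  then have "B *v k = 0" using inner_eq_zero_iff by blast
  moreover have "{x + k |x k. x \<in> domX D \<and> B *v k = 0} = domX D"
    using lower_spectrum True by (simp add: range_condition_def)
  ultimately show ?thesis using x by blast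
next
  case False
  then have "k \<bullet> k = 0" using assms(1) by (simp add: Rx_def)
  then show ?thesis using x by simp
qed

lemma fsub_Rx: "x \<in> domX D \<Longrightarrow> fsub D x \<in> Rx"
  using lower_spectrum f_sub unfolding Rx_def range_condition_def by (auto split: if_splits)

lemma Bt_Rx: "Bt *v v \<in> Rx"
  by (auto simp: Rx_def simp del: transpose_matrix_vector)

lemma mu_xy_bound:
  assumes "u \<in> Rx"
  shows "(mu_xy D)\<^sup>2 * (norm u)\<^sup>2 \<le> (norm (B *v u))\<^sup>2"
proof (cases "inv_Rx D")
  case True
  then show ?thesis using lower_spectrum assms
    by (intro lambda_min_pos_bound) (auto simp: range_condition_def Rx_def)
next
  case False
  then show ?thesis using lower_spectrum by (intro lambda_min_bound) auto
qed

sublocale prox_geometry "domZ D" scal "Rx \<times> UNIV" "(xs, ys)"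
proof (rule prox_geometry.intro)
  show "closed (domZ D)" "convex (domZ D)" "domZ D \<noteq> {}"
    using X_props Y_props by (auto simp: domZ_def intro: closed_Times convex_Times)
  show "linear scal"
    by (rule linearI) (simp_all add: scal_def algebra_simps)
  show "inj scal"
    using del_pos lam_pos by (auto simp: inj_def scal_def)
  show "subspace (Rx \<times> (UNIV :: (real^'y) set))"
    using subspace_Rx subspace_UNIV by (rule subspace_Times)
  fix k :: "(real^'x) \<times> (real^'y)" assume k: "\<And>u. u \<in> Rx \<times> UNIV \<Longrightarrow> k \<bullet> u = 0"
  have k1: "fst k \<bullet> u = 0" if "u \<in> Rx" for u
    using k[of "(u, 0)"] that by (simp add: inner_prod_def)
  have "snd k \<bullet> snd k = 0"
    using k[of "(0, snd k)"] subspace_0[OF subspace_Rx] by (simp add: inner_prod_def)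
  then have k2: "snd k = 0" by simp
  show "z + k \<in> domZ D" if z: "z \<in> domZ D" for z
    using z Rx_orthogonal[OF k1] k2 by (auto simp: domZ_def mem_Times_iff)
  show "scal u \<bullet> scal k = 0" if "u \<in> Rx \<times> UNIV" for u
    using that k1[of "fst u"] k2 by (auto simp: scal_def inner_prod_def inner_commute mem_Times_iff)
qed

lemma nsq_P: "nsq = P_norm_sq D \<epsilon>"
  by (simp add: fun_eq_iff nsq_def norm_scal)

lemma nsq_Pair: "nsq z = \<delta> * (norm (fst z))\<^sup>2 + \<Lambda> * (norm (snd z))\<^sup>2"
  by (simp add: nsq_P P_norm_sq_def delta_y_reg_def)

lemma ZR_iff: "z \<in> ZR \<longleftrightarrow> fst z \<in> domX D \<and> snd z \<in> domY D \<and> fst z - xs \<in> Rx"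
  unfolding ZR_def by (auto simp: domZ_def mem_Times_iff)

lemma star_ZR: "(xs, ys) \<in> ZR"
  unfolding ZR_iff using saddle_mem subspace_0[OF subspace_Rx] by simp

lemma init_ZR: "z_init D \<in> ZR"
  unfolding ZR_iff using z_init init_range by (auto simp: domZ_def Rx_def mem_Times_iff)

end

section \<open>One stage of the restarted algorithm\<close>

lemma iter_prod_eq: "iter_prod c b i = (\<Prod>l=1..i. iter_count c b l)"
  by (induction i) (simp_all add: iter_count_def)

lemma iter_prod_pos: "0 < iter_prod c b i"
  by (induction i) simp_all

text \<open>
  Rounding up gives at least \<open>c\<close> times the budget of the level, whatever the outer levels have done.
\<close>
lemma iter_prod_ge:
  assumes "1 \<le> i"
  shows "c * b i \<le> real (iter_prod c b i)"
proof -
  obtain j where i: "i = Suc j" using assms by (cases i) auto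
  define A where "A = iter_prod c b j"
  have A: "0 < real A" unfolding A_def using iter_prod_pos[of c b j] by simp
  have "c * b i = real A * (c * b i / real A)" using A by simp
  also have "\<dots> \<le> real A * real (max 1 (nat \<lceil>c * b i / real A\<rceil>))"
    using A by (intro mult_left_mono) linarith+
  also have "\<dots> = real (iter_prod c b i)" by (simp add: i A_def)
  finally show ?thesis .
qed

lemma step_size_prod_le:
  assumes "\<And>l. 1 \<le> T l"
  shows "(\<Prod>l=1..i. step_size (T l - 1)) \<le> 2 ^ i / (\<Prod>l=1..i. real (T l))"
proof (induction i)
  case (Suc i)
  have "step_size (T (Suc i) - 1) \<le> 2 / (real (T (Suc i) - 1) + 2)" by (rule step_size_le)
  also have "\<dots> \<le> 2 / real (T (Suc i))"
    using assms[of "Suc i"] by (intro divide_left_mono) auto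
  finally have "step_size (T (Suc i) - 1) \<le> 2 / real (T (Suc i))" .
  then have "(\<Prod>l=1..i. step_size (T l - 1)) * step_size (T (Suc i) - 1)
      \<le> 2 ^ i / (\<Prod>l=1..i. real (T l)) * (2 / real (T (Suc i)))"
    by (intro mult_mono Suc) (auto intro!: prod_nonneg less_imp_le[OF step_size_pos] divide_nonneg_nonneg)
  then show ?case by (simp add: mult.commute)
qed simp

text \<open>
  With \<open>e = (1 - \<nu>) / (1 + \<nu>)\<close> the numerical factor is \<open>(192 * e) powr e\<close>, which is at most \<open>192\<close>
  for all exponents.
\<close>
lemma holder_smooth_le:
  assumes \<nu>: "0 \<le> \<nu>" "\<nu> \<le> 1" and pos: "0 < H" "0 < \<Omega>" "0 < A"
  shows "holder_smooth H \<nu> H (\<Omega> / (384 * A))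
     \<le> 192 * ((A / \<Omega>) powr ((1 - \<nu>) / (1 + \<nu>)) * H powr (2 / (1 + \<nu>)))"
proof (cases "\<nu> = 1")
  case True then show ?thesis using pos by (simp add: holder_smooth_def)
next
  case False
  define e where "e = (1 - \<nu>) / (1 + \<nu>)"
  have e: "0 < e" "e \<le> 1" using \<nu> False by (auto simp: e_def)
  have "a / (2 * k * (\<Omega> / (384 * A))) = (192 * (a / k)) * (A / \<Omega>)" if "0 < k" for a k
    using that pos by (simp add: field_simps)
  from this[of "1 + \<nu>" "1 - \<nu>"]
  have eq: "(1 - \<nu>) / (2 * (1 + \<nu>) * (\<Omega> / (384 * A))) = (192 * e) * (A / \<Omega>)"
    using \<nu> unfolding e_def by linarith
  have "holder_smooth H \<nu> H (\<Omega> / (384 * A)) = (192 * e) powr e * (A / \<Omega>) powr e * H powr (2 / (1 + \<nu>))"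
    unfolding holder_smooth_def eq e_def[symmetric] using False by (simp only: powr_mult if_False)
  moreover have "(192 * e) powr e \<le> 192"
  proof -
    have "(192 * e) powr e \<le> 192 powr e" using e by (intro powr_mono2) auto
    also have "\<dots> \<le> 192 powr 1" using e by (intro powr_mono) auto
    finally show ?thesis by simp
  qed
  ultimately show ?thesis unfolding e_def[symmetric]
    by (simp add: mult.assoc mult_right_mono)
qed

text \<open>
  The smoothness constant grows with \<open>A powr e\<close>, since more iterations demand a smaller
  inexactness, but it is divided by \<open>A\<^sup>2\<close>; the budget is the size of \<open>A\<close> that balances the two.  The
  bound \<open>10 ^ 6\<close> on \<open>c\<close> absorbs the factor \<open>6144 = 192 * 8\<^sup>2 / 2\<close>.  Three terms below \<open>1 / 72\<close> sum to at
  most \<open>1 / 24\<close>, which is what the contraction of a stage tolerates.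
\<close>
lemma smooth_budget:
  assumes \<nu>: "0 \<le> \<nu>" "\<nu> \<le> 1" and pos: "0 < H" "0 < \<Omega>" "0 < \<delta>" and c: "10 ^ 6 \<le> c" and A1: "0 < A"
    and A: "c * ((H * \<delta> powr (- (1 + \<nu>) / 2)) powr (2 / (1 + 3 * \<nu>)) * \<Omega> powr (- ((1 - \<nu>) / (1 + 3 * \<nu>)))) \<le> A"
  shows "holder_smooth H \<nu> H (\<Omega> / (384 * A)) / \<delta> * (8 / A)\<^sup>2 / 2 \<le> 1 / 72"
proof -
  define e where "e = (1 - \<nu>) / (1 + \<nu>)"
  define f where "f = (1 + 3 * \<nu>) / (1 + \<nu>)"
  define X where "X = H powr (2 / (1 + \<nu>)) / \<delta>"
  have ef: "e - 2 = - f" using \<nu> by (simp add: e_def f_def field_simps)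
  have f: "1 \<le> f" using \<nu> by (simp add: f_def)
  have c1: "1 \<le> c" using c by simp
  have X: "0 < X" using pos by (simp add: X_def)
  have "(c * ((H * \<delta> powr (- (1 + \<nu>) / 2)) powr (2 / (1 + 3 * \<nu>)) * \<Omega> powr (- ((1 - \<nu>) / (1 + 3 * \<nu>))))) powr f \<le> A powr f"
    using A c1 f pos by (intro powr_mono2) auto
  moreover have "(c * ((H * \<delta> powr (- (1 + \<nu>) / 2)) powr (2 / (1 + 3 * \<nu>)) * \<Omega> powr (- ((1 - \<nu>) / (1 + 3 * \<nu>))))) powr f
      = c powr f * (X * \<Omega> powr (- e))"
  proof -
    have 1: "2 / (1 + 3 * \<nu>) * f = 2 / (1 + \<nu>)" "- ((1 - \<nu>) / (1 + 3 * \<nu>)) * f = - e"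
    proof -
      have cancel: "a / m * (m / k) = a / k" if "0 < m" for a m k :: real using that by simp
      have "0 < 1 + 3 * \<nu>" using \<nu> by simp
      then show "2 / (1 + 3 * \<nu>) * f = 2 / (1 + \<nu>)" "- ((1 - \<nu>) / (1 + 3 * \<nu>)) * f = - e"
        unfolding f_def e_def mult_minus_left by (simp_all only: cancel)
    qed
    have 2: "- (1 + \<nu>) / 2 * (2 / (1 + \<nu>)) = - 1" using \<nu> by (simp add: field_simps)
    have "(\<delta> powr (- (1 + \<nu>) / 2)) powr (2 / (1 + \<nu>)) = 1 / \<delta>"
      unfolding powr_powr 2 using pos by (simp add: powr_minus_divide)
    then have X: "(H * \<delta> powr (- (1 + \<nu>) / 2)) powr (2 / (1 + \<nu>)) = X"
      by (simp only: powr_mult X_def) simp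
    have split: "(c * (Y powr (2 / (1 + 3 * \<nu>)) * \<Omega> powr (- ((1 - \<nu>) / (1 + 3 * \<nu>))))) powr f
        = c powr f * (Y powr (2 / (1 + \<nu>)) * \<Omega> powr (- e))" for Y
      by (simp only: powr_mult powr_powr 1)
    show ?thesis unfolding split X ..
  qed
  ultimately have "c powr f * (X * \<Omega> powr (- e)) \<le> A powr f" by simp
  moreover have "c powr 1 \<le> c powr f" using c1 f by (intro powr_mono) auto
  then have "c * (X * \<Omega> powr (- e)) \<le> c powr f * (X * \<Omega> powr (- e))"
    using c1 X by (intro mult_right_mono) auto
  ultimately have "c * (X * \<Omega> powr (- e)) \<le> A powr f" by linarith
  then have "X * \<Omega> powr (- e) / A powr f \<le> 1 / c" using A1 c1 by (simp add: field_simps)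
  also have "X * \<Omega> powr (- e) / A powr f = X * ((A / \<Omega>) powr e) / A\<^sup>2"
  proof -
    have "A powr (- f) = A powr e / A\<^sup>2"
      unfolding ef[symmetric] using A1 by (simp add: powr_diff)
    moreover have "(A / \<Omega>) powr e = A powr e / \<Omega> powr e" using A1 pos by (simp add: powr_divide)
    moreover have "X * \<Omega> powr (- e) / A powr f = X * (1 / \<Omega> powr e) * A powr (- f)"
      by (simp add: powr_minus_divide)
    ultimately show ?thesis by simp
  qed
  finally have key: "X * ((A / \<Omega>) powr e) / A\<^sup>2 \<le> 1 / c" .
  have "holder_smooth H \<nu> H (\<Omega> / (384 * A)) / \<delta> * (8 / A)\<^sup>2 / 2
      \<le> 192 * ((A / \<Omega>) powr e * H powr (2 / (1 + \<nu>))) / \<delta> * (8 / A)\<^sup>2 / 2"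
    using holder_smooth_le[OF \<nu> pos(1,2) A1] pos unfolding e_def
    by (intro divide_right_mono mult_right_mono) auto
  also have "\<dots> = 6144 * (X * ((A / \<Omega>) powr e) / A\<^sup>2)"
    by (simp add: X_def power2_eq_square mult_ac)
  also have "\<dots> \<le> 6144 * (1 / c)" using key by (intro mult_left_mono) auto
  also have "\<dots> \<le> 1 / 72" using c by (simp add: field_simps)
  finally show ?thesis .
qed

lemma bilinear_budget:
  assumes "0 < \<kappa>" and c: "10 ^ 6 \<le> c" and A: "c * sqrt \<kappa> \<le> A"
  shows "(\<kappa> * (8 / A)\<^sup>2 + sqrt \<kappa> * (8 / A)) / 2 \<le> 1 / 72"
proof -
  define t where "t = sqrt \<kappa> / A"
  have c0: "0 < c" using c by simp
  have A0: "0 < A" using A assms(1) c0 by (smt (verit) mult_pos_pos real_sqrt_gt_0_iff)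
  have "t \<le> 1 / c" using A A0 c0 by (simp add: t_def field_simps)
  also have "1 / c \<le> 1 / 10 ^ 6" using c by (intro divide_left_mono) auto
  finally have t: "t \<le> 1 / 10 ^ 6" .
  have t0: "0 \<le> t" using A0 assms(1) by (simp add: t_def)
  have "t\<^sup>2 \<le> t" using t t0 by (simp add: power2_eq_square mult_left_le_one_le)
  moreover have "(\<kappa> * (8 / A)\<^sup>2 + sqrt \<kappa> * (8 / A)) / 2 = 32 * t\<^sup>2 + 4 * t"
    using assms(1) by (simp add: t_def power_divide mult.commute)
  ultimately show ?thesis using t by simp
qed

context regularized_problem
begin

text \<open>
  \<open>comp_fun\<close> are the convex functions whose subgradients the components of a stage return, and \<open>comp_tol\<close> is
  the inexactness with which they are smooth, zero in the Lipschitz case.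
\<close>
definition comp_fun :: "(real^'x) \<times> (real^'y) \<Rightarrow> nat \<Rightarrow> (real^'x) \<times> (real^'y) \<Rightarrow> real" where
  "comp_fun z_in j z =
     (if j = 1 then fobj D (fst z) else if j = 2 then g_reg D \<epsilon> (snd z) else p3 D \<epsilon> z_in z)"

definition comp_tol :: "real \<Rightarrow> real \<Rightarrow> (nat \<Rightarrow> nat) \<Rightarrow> nat \<Rightarrow> real" where
  "comp_tol c \<Omega> \<pi> j =
     (if j = 1 \<and> nu_x D \<noteq> 1 \<or> j = 2 \<and> nu_y D \<noteq> 1 then delta_tol D \<epsilon> c \<Omega> \<pi> j else 0)"

lemma f_holder_fsub:
  "x \<in> domX D \<Longrightarrow> u \<in> domX D \<Longrightarrow> norm (fsub D x - fsub D u) \<le> H_x D * rpow (norm (x - u)) (nu_x D)"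
  using f_holder f_sub unfolding holder_subgradients_on_def by blast

text \<open>
  For the gradient of the regularizer, which is Lipschitz and hence Hoelder continuous on a set of
  diameter \<open>m\<close>.
\<close>
lemma rpow_split:
  assumes "0 \<le> \<nu>" "\<nu> \<le> 1" "0 \<le> t" "t \<le> m"
  shows "t \<le> rpow m (1 - \<nu>) * rpow t \<nu>"
proof (cases "t = 0")
  case True
  then show ?thesis using assms by (simp add: rpow_nonneg)
next
  case False
  then have t: "0 < t" "0 < m" using assms by auto
  have "t = t powr (1 - \<nu>) * t powr \<nu>" using t by (simp flip: powr_add)
  also have "\<dots> \<le> m powr (1 - \<nu>) * t powr \<nu>"
    using assms t by (intro mult_right_mono powr_mono2) auto
  finally show ?thesis using t by (auto simp: rpow_def)
qed

lemma H_y_reg_pos: "0 < H_y_reg D \<epsilon>"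
  unfolding H_y_reg_def using H_y_pos lam_pos diameter_ge_0[OF Y_bounded]
  by (intro add_pos_nonneg mult_nonneg_nonneg rpow_nonneg) auto

lemma g_reg_holder:
  assumes "y \<in> domY D" "u \<in> domY D"
  shows "norm (g_reg_sub D \<epsilon> y - g_reg_sub D \<epsilon> u) \<le> H_y_reg D \<epsilon> * rpow (norm (y - u)) (nu_y D)"
proof -
  have "norm (g_reg_sub D \<epsilon> y - g_reg_sub D \<epsilon> u) = norm ((gsub D y - gsub D u) + \<Lambda> *\<^sub>R (y - u))"
    by (simp add: g_reg_sub_def algebra_simps)
  also have "\<dots> \<le> norm (gsub D y - gsub D u) + \<Lambda> * norm (y - u)"
    using lam_pos by (intro norm_triangle_le) simp
  also have "\<dots> \<le> H_y D * rpow (norm (y - u)) (nu_y D)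
      + \<Lambda> * (rpow (diameter (domY D)) (1 - nu_y D) * rpow (norm (y - u)) (nu_y D))"
  proof (intro add_mono mult_left_mono)
    show "norm (gsub D y - gsub D u) \<le> H_y D * rpow (norm (y - u)) (nu_y D)"
      using g_holder g_sub assms unfolding holder_subgradients_on_def by blast
    show "norm (y - u) \<le> rpow (diameter (domY D)) (1 - nu_y D) * rpow (norm (y - u)) (nu_y D)"
      using diameter_bounded_bound[OF Y_bounded assms] nu_y by (intro rpow_split) (auto simp: dist_norm)
  qed (use lam_pos in simp)
  finally show ?thesis by (simp add: H_y_reg_def distrib_right)
qed

lemma holder_smooth_y:
  "holder_smooth (H_y_reg D \<epsilon>) (nu_y D) (H_y D + \<Lambda>) t = holder_smooth (H_y_reg D \<epsilon>) (nu_y D) (H_y_reg D \<epsilon>) t"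
  by (simp add: holder_smooth_def H_y_reg_def rpow_def)

lemma delta_tol_pos: "0 < \<Omega> \<Longrightarrow> 0 < delta_tol D \<epsilon> c \<Omega> \<pi> j"
  unfolding delta_tol_def using iter_prod_pos by simp

lemma kappa_pos: "0 < kappa_xy D \<epsilon>"
  unfolding kappa_xy_def using L_xy_pos del_pos lam_pos by simp

lemma p3_expansion:
  "p3 D \<epsilon> z_in u = p3 D \<epsilon> z_in w + grad_p3 D \<epsilon> z_in w \<bullet> (u - w)
    + (beta_x_reg D \<epsilon> / 2 * (norm (B *v (fst u - fst w)))\<^sup>2
       + beta_y_reg D \<epsilon> / 2 * (norm (Bt *v (snd u - snd w)))\<^sup>2)"
proof -
  let ?b = "g_reg_sub D \<epsilon> (snd z_in)" and ?a = "- fsub D (fst z_in)"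
  have 1: "(norm (B *v fst u - ?b))\<^sup>2 = (norm (B *v fst w - ?b))\<^sup>2
      + 2 * ((Bt *v (B *v fst w - ?b)) \<bullet> (fst u - fst w)) + (norm (B *v (fst u - fst w)))\<^sup>2"
    unfolding quadratic_expansion[of "B *v fst u" ?b "B *v fst w"]
      matrix_vector_mult_diff_distrib[of B, symmetric] matrix_adjoint[of Bt] transpose_transpose by (rule refl)
  have 2: "(norm (Bt *v snd u - ?a))\<^sup>2 = (norm (Bt *v snd w - ?a))\<^sup>2
      + 2 * ((B *v (Bt *v snd w - ?a)) \<bullet> (snd u - snd w)) + (norm (Bt *v (snd u - snd w)))\<^sup>2"
    unfolding quadratic_expansion[of "Bt *v snd u" ?a "Bt *v snd w"]
      matrix_vector_mult_diff_distrib[of Bt, symmetric] matrix_adjoint[of B] by (rule refl)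
  show ?thesis
    unfolding p3_def grad_p3_def inner_prod_def fst_conv snd_conv inner_scaleR_left fst_diff snd_diff
    using 1 2 unfolding diff_minus_eq_add by (simp only: distrib_left)
qed

lemma p3_curvature:
  "beta_x_reg D \<epsilon> / 2 * (norm (B *v fst h))\<^sup>2 + beta_y_reg D \<epsilon> / 2 * (norm (Bt *v snd h))\<^sup>2
    \<le> kappa_xy D \<epsilon> / 2 * nsq h"
proof -
  have b: "beta_x_reg D \<epsilon> * \<Lambda> \<le> 1" "beta_y_reg D \<epsilon> * \<delta> \<le> 1"
    using compat by (simp_all add: compatible_def delta_y_reg_def)
  have "(norm (B *v fst h))\<^sup>2 \<le> (L_xy D * norm (fst h))\<^sup>2" "(norm (Bt *v snd h))\<^sup>2 \<le> (L_xy D * norm (snd h))\<^sup>2"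
    by (intro power_mono B_bound Bt_bound norm_ge_zero)+
  then have "beta_x_reg D \<epsilon> * (norm (B *v fst h))\<^sup>2 + beta_y_reg D \<epsilon> * (norm (Bt *v snd h))\<^sup>2
     \<le> beta_x_reg D \<epsilon> * (L_xy D * norm (fst h))\<^sup>2 + beta_y_reg D \<epsilon> * (L_xy D * norm (snd h))\<^sup>2"
    using beta_x_nonneg beta_y_nonneg by (intro add_mono mult_left_mono) auto
  also have "\<dots> = (beta_x_reg D \<epsilon> * \<Lambda>) * ((L_xy D * norm (fst h))\<^sup>2 / \<Lambda>)
      + (beta_y_reg D \<epsilon> * \<delta>) * ((L_xy D * norm (snd h))\<^sup>2 / \<delta>)"
    using lam_pos del_pos by simp
  also have "\<dots> \<le> 1 * ((L_xy D * norm (fst h))\<^sup>2 / \<Lambda>) + 1 * ((L_xy D * norm (snd h))\<^sup>2 / \<delta>)"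
    using lam_pos del_pos by (intro add_mono mult_right_mono b) auto
  also have "\<dots> = kappa_xy D \<epsilon> * nsq h"
    unfolding kappa_xy_def nsq_Pair using lam_pos del_pos by (simp add: field_simps power2_eq_square)
  finally show ?thesis by simp
qed

lemma bilinear_lipschitz:
  "(Bt *v snd a) \<bullet> fst h - (B *v fst a) \<bullet> snd h \<le> sqrt (kappa_xy D \<epsilon>) * norm (scal a) * norm (scal h)"
proof -
  define a1 a2 h1 h2 where "a1 = sqrt \<delta> * norm (fst a)" and "a2 = sqrt \<Lambda> * norm (snd a)"
    and "h1 = sqrt \<delta> * norm (fst h)" and "h2 = sqrt \<Lambda> * norm (snd h)"
  have s: "0 < sqrt \<delta>" "0 < sqrt \<Lambda>" using del_pos lam_pos by simp_all
  have \<kappa>: "sqrt (kappa_xy D \<epsilon>) = L_xy D / (sqrt \<delta> * sqrt \<Lambda>)"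
    using L_xy_pos by (simp add: kappa_xy_def real_sqrt_divide real_sqrt_mult)
  have "(Bt *v snd a) \<bullet> fst h - (B *v fst a) \<bullet> snd h
     \<le> norm (Bt *v snd a) * norm (fst h) + norm (B *v fst a) * norm (snd h)"
    using norm_cauchy_schwarz[of "Bt *v snd a" "fst h"] Cauchy_Schwarz_ineq2[of "B *v fst a" "snd h"]
    by linarith
  also have "\<dots> \<le> L_xy D * norm (snd a) * norm (fst h) + L_xy D * norm (fst a) * norm (snd h)"
    by (intro add_mono mult_right_mono B_bound Bt_bound norm_ge_zero)
  also have "\<dots> = sqrt (kappa_xy D \<epsilon>) * (a2 * h1 + a1 * h2)"
    unfolding \<kappa> a1_def a2_def h1_def h2_def using s by (simp add: field_simps)
  also have "a2 * h1 + a1 * h2 \<le> norm (scal a) * norm (scal h)"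
  proof (rule power2_le_imp_le)
    have n: "(norm (scal a))\<^sup>2 = a1\<^sup>2 + a2\<^sup>2" "(norm (scal h))\<^sup>2 = h1\<^sup>2 + h2\<^sup>2"
      using del_pos lam_pos
      by (simp_all add: norm_scal P_norm_sq_def delta_y_reg_def a1_def a2_def h1_def h2_def power_mult_distrib)
    have "(a2 * h1 + a1 * h2)\<^sup>2 + (a1 * h1 - a2 * h2)\<^sup>2 = (norm (scal a) * norm (scal h))\<^sup>2"
      unfolding power_mult_distrib[of "norm (scal a)"] n by (simp add: power2_eq_square algebra_simps)
    then show "(a2 * h1 + a1 * h2)\<^sup>2 \<le> (norm (scal a) * norm (scal h))\<^sup>2"
      by (smt (verit) zero_le_power2)
  qed simp
  finally show ?thesis using kappa_pos by (simp add: mult.assoc mult_left_mono)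
qed

lemma nsq_ge: "\<delta> * (norm (fst h))\<^sup>2 \<le> nsq h" "\<Lambda> * (norm (snd h))\<^sup>2 \<le> nsq h"
  unfolding nsq_Pair using del_pos lam_pos by simp_all

lemma component_properties:
  fixes c \<Omega> \<pi> z_in j
  defines "C \<equiv> stage_component D \<epsilon> c \<Omega> \<pi> z_in j"
  assumes \<Omega>: "0 < \<Omega>" and j: "j = 1 \<or> j = 2 \<or> j = 3"
  shows "0 < smooth_const C \<and> 0 \<le> lip_const C \<and> 0 \<le> comp_tol c \<Omega> \<pi> j \<and>
    (\<forall>w\<in>ZR. \<forall>u\<in>ZR. comp_fun z_in j w + fst (grad_oracle C w) \<bullet> (u - w) \<le> comp_fun z_in j u) \<and>
    (\<forall>w\<in>ZR. \<forall>u\<in>ZR. comp_fun z_in j u \<le> comp_fun z_in j w + fst (grad_oracle C w) \<bullet> (u - w)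
        + smooth_const C / 2 * nsq (u - w) + comp_tol c \<Omega> \<pi> j) \<and>
    (\<forall>w\<in>ZR. fst (grad_oracle C w) \<in> Rx \<times> UNIV) \<and> (\<forall>w\<in>ZR. fst (Q_oracle C w) \<in> Rx \<times> UNIV) \<and>
    (\<forall>u v. 0 \<le> (fst (Q_oracle C u) - fst (Q_oracle C v)) \<bullet> (u - v)) \<and>
    (\<forall>u v h. (fst (Q_oracle C u) - fst (Q_oracle C v)) \<bullet> h
        \<le> lip_const C * norm (scal (u - v)) * norm (scal h))" (is ?goal)
proof -
  note tol = delta_tol_pos[OF \<Omega>]
  have R0: "0 \<in> Rx" by (rule subspace_0[OF subspace_Rx])
  show ?goal using j
  proof (elim disjE)
    assume j: "j = 1"
    define L where "L = holder_smooth (H_x D) (nu_x D) (H_x D) (delta_tol D \<epsilon> c \<Omega> \<pi> 1)"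
    have C: "smooth_const C = L / \<delta>" "lip_const C = 0" "\<And>w. fst (grad_oracle C w) = (fsub D (fst w), 0)"
      "\<And>w. fst (Q_oracle C w) = 0"
      by (simp_all add: C_def stage_component_def j L_def)
    have L: "0 < L" unfolding L_def by (intro holder_smooth_pos H_x_pos tol nu_x)
    have sm: "fobj D (fst u) \<le> fobj D (fst w) + fsub D (fst w) \<bullet> (fst u - fst w)
        + L / \<delta> / 2 * nsq (u - w) + comp_tol c \<Omega> \<pi> 1" if m: "w \<in> ZR" "u \<in> ZR" for w u
    proof -
      have mem: "fst w \<in> domX D" "fst u \<in> domX D" using m by (auto simp: ZR_iff)
      have "fobj D (fst u) \<le> fobj D (fst w) + fsub D (fst w) \<bullet> (fst u - fst w)
         + L / 2 * (norm (fst u - fst w))\<^sup>2 + (if nu_x D = 1 then 0 else delta_tol D \<epsilon> c \<Omega> \<pi> 1)"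
        unfolding L_def
        by (rule holder_smooth_descent[OF X_props(3) _ f_holder_fsub nu_x H_x_pos mem tol])
          (use f_sub in \<open>auto simp: subdifferential_def\<close>)
      moreover have "L / 2 * (norm (fst u - fst w))\<^sup>2 \<le> L / \<delta> / 2 * nsq (u - w)"
        using mult_left_mono[OF nsq_ge(1)[of "u - w"], of "L / \<delta> / 2"] L del_pos by simp
      moreover have "comp_tol c \<Omega> \<pi> 1 = (if nu_x D = 1 then 0 else delta_tol D \<epsilon> c \<Omega> \<pi> 1)"
        by (simp add: comp_tol_def)
      ultimately show ?thesis by linarith
    qed
    have "fobj D (fst w) + fsub D (fst w) \<bullet> (fst u - fst w) \<le> fobj D (fst u)" for w u :: "(real^'x) \<times> (real^'y)"
      using f_sub by (simp add: subdifferential_def)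
    moreover have "0 \<le> comp_tol c \<Omega> \<pi> j" using tol by (simp add: comp_tol_def less_imp_le)
    ultimately show ?goal
      unfolding C using sm L del_pos fsub_Rx R0
      by (auto simp: comp_fun_def j inner_prod_def ZR_iff mem_Times_iff)
  next
    assume j: "j = 2"
    define L where "L = holder_smooth (H_y_reg D \<epsilon>) (nu_y D) (H_y_reg D \<epsilon>) (delta_tol D \<epsilon> c \<Omega> \<pi> 2)"
    have C: "smooth_const C = L / \<Lambda>" "lip_const C = 0" "\<And>w. fst (grad_oracle C w) = (0, g_reg_sub D \<epsilon> (snd w))"
      "\<And>w. fst (Q_oracle C w) = 0"
      by (simp_all add: C_def stage_component_def j L_def holder_smooth_y)
    have L: "0 < L" unfolding L_def by (intro holder_smooth_pos H_y_reg_pos tol nu_y)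
    have sm: "g_reg D \<epsilon> (snd u) \<le> g_reg D \<epsilon> (snd w) + g_reg_sub D \<epsilon> (snd w) \<bullet> (snd u - snd w)
        + L / \<Lambda> / 2 * nsq (u - w) + comp_tol c \<Omega> \<pi> 2" if m: "w \<in> ZR" "u \<in> ZR" for w u
    proof -
      have mem: "snd w \<in> domY D" "snd u \<in> domY D" using m by (auto simp: ZR_iff)
      have "g_reg D \<epsilon> (snd u) \<le> g_reg D \<epsilon> (snd w) + g_reg_sub D \<epsilon> (snd w) \<bullet> (snd u - snd w)
         + L / 2 * (norm (snd u - snd w))\<^sup>2 + (if nu_y D = 1 then 0 else delta_tol D \<epsilon> c \<Omega> \<pi> 2)"
        unfolding L_def
        by (rule holder_smooth_descent[OF Y_props(3) _ g_reg_holder nu_y H_y_reg_pos mem tol])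
          (use g_reg_sub in \<open>auto simp: subdifferential_def\<close>)
      moreover have "L / 2 * (norm (snd u - snd w))\<^sup>2 \<le> L / \<Lambda> / 2 * nsq (u - w)"
        using mult_left_mono[OF nsq_ge(2)[of "u - w"], of "L / \<Lambda> / 2"] L lam_pos by simp
      moreover have "comp_tol c \<Omega> \<pi> 2 = (if nu_y D = 1 then 0 else delta_tol D \<epsilon> c \<Omega> \<pi> 2)"
        by (simp add: comp_tol_def)
      ultimately show ?thesis by linarith
    qed
    have "g_reg D \<epsilon> (snd w) + g_reg_sub D \<epsilon> (snd w) \<bullet> (snd u - snd w) \<le> g_reg D \<epsilon> (snd u)"
      for w u :: "(real^'x) \<times> (real^'y)"
      using g_reg_sub by (simp add: subdifferential_def)
    moreover have "0 \<le> comp_tol c \<Omega> \<pi> j" using tol by (simp add: comp_tol_def less_imp_le)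
    ultimately show ?goal
      unfolding C using sm L lam_pos R0
      by (auto simp: comp_fun_def j inner_prod_def mem_Times_iff)
  next
    assume j: "j = 3"
    have C: "smooth_const C = kappa_xy D \<epsilon>" "lip_const C = sqrt (kappa_xy D \<epsilon>)"
      "\<And>w. fst (grad_oracle C w) = grad_p3 D \<epsilon> z_in w"
      "\<And>w. fst (Q_oracle C w) = (Bt *v snd w, - (B *v fst w))"
      by (simp_all add: C_def stage_component_def j)
    have cf: "comp_fun z_in j = p3 D \<epsilon> z_in" and ct: "comp_tol c \<Omega> \<pi> j = 0"
      by (simp_all add: fun_eq_iff comp_fun_def comp_tol_def j)
    have low: "p3 D \<epsilon> z_in w + grad_p3 D \<epsilon> z_in w \<bullet> (u - w) \<le> p3 D \<epsilon> z_in u" for w u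
      unfolding p3_expansion[of z_in u w] using beta_x_nonneg beta_y_nonneg by simp
    have up: "p3 D \<epsilon> z_in u \<le> p3 D \<epsilon> z_in w + grad_p3 D \<epsilon> z_in w \<bullet> (u - w)
        + kappa_xy D \<epsilon> / 2 * nsq (u - w)" for w u
      unfolding p3_expansion[of z_in u w] using p3_curvature[of "u - w"] by simp
    have dQ: "(Bt *v snd u, - (B *v fst u)) - (Bt *v snd v, - (B *v fst v))
        = (Bt *v snd (u - v), - (B *v fst (u - v)))" for u v :: "(real^'x) \<times> (real^'y)"
      by (simp add: matrix_vector_mult_diff_distrib del: transpose_matrix_vector)
    have skew: "(Bt *v snd a, - (B *v fst a)) \<bullet> h = (Bt *v snd a) \<bullet> fst h - (B *v fst a) \<bullet> snd h" for a h
      by (simp add: inner_prod_def)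
    have "(Bt *v snd a, - (B *v fst a)) \<bullet> a = 0" for a
      unfolding skew matrix_adjoint[of Bt] transpose_transpose by (simp add: inner_commute)
    moreover have "grad_p3 D \<epsilon> z_in w \<in> Rx \<times> UNIV" for w
      unfolding grad_p3_def by (auto intro!: subspace_scale[OF subspace_Rx] Bt_Rx simp del: transpose_matrix_vector)
    ultimately show ?goal
      unfolding C cf ct dQ using kappa_pos low up bilinear_lipschitz Bt_Rx
      by (auto simp: skew simp del: transpose_matrix_vector)
  qed
qed


text \<open>
  The sliding bound at the saddle point controls Bregman distances at the output plus the
  excess of \<open>p3\<close> over its value there.  The potential at the output is at most \<open>16\<close> times the resulting
  right-hand side, whose distance part has the factor \<open>16 / 24 = 2 / 3\<close>, whose residuals of \<open>p3\<close> cost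
  \<open>8 = 12 * 2 / 3\<close> times the Bregman distances at the start, and whose inexactness is
  \<open>16 * \<Omega> / 192 = \<Omega> / 12\<close>.  Together this is \<open>(2 / 3 + 1 / 12) * \<Omega> = 3 / 4 * \<Omega>\<close>.
\<close>
lemma stage_contraction:
  assumes c: "10 ^ 6 \<le> c" and \<Omega>: "0 < \<Omega>" and order: "level_order D \<epsilon> \<Omega> \<pi>"
    and z_in: "z_in \<in> ZR" and Psi_in: "Psi D \<epsilon> r z_in \<le> \<Omega>"
  shows "fst (stage D \<epsilon> c \<Omega> \<pi> z_in) \<in> ZR" "Psi D \<epsilon> r (fst (stage D \<epsilon> c \<Omega> \<pi> z_in)) \<le> 3 / 4 * \<Omega>"
proof -
  define b where "b = (\<lambda>l. budget D \<epsilon> \<Omega> (\<pi> l))"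
  define T where "T = iter_count c b"
  define lev where "lev l = stage_component D \<epsilon> c \<Omega> \<pi> z_in (\<pi> l)" for l
  have perm: "\<pi> permutes {1..3}" using order by (simp add: level_order_def)
  have \<pi>: "\<pi> i = 1 \<or> \<pi> i = 2 \<or> \<pi> i = 3" if "i \<in> {1..3}" for i
    using permutes_in_image[OF perm, of i] that by auto
  have inv: "inv \<pi> (\<pi> i) = i" for i using permutes_inverses(2)[OF perm] .
  interpret S: sliding_problem "domZ D" scal "Rx \<times> UNIV" "(xs, ys)" 3 lev T
    "\<lambda>i. comp_fun z_in (\<pi> i)" "\<lambda>i. comp_tol c \<Omega> \<pi> (\<pi> i)"
    unfolding lev_def
    using component_properties[OF \<Omega> \<pi>]
    by unfold_locales (blast | simp add: T_def iter_count_def)+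
  obtain zt calls where run: "sliding (domZ D) nsq 3 lev T z_in = (zt, calls)" by (rule prod.exhaust)
  have out: "fst (stage D \<epsilon> c \<Omega> \<pi> z_in) = zt"
    using run unfolding stage_def T_def b_def lev_def nsq_P by simp
  have zt: "zt \<in> ZR" by (rule S.sliding_bound(1)[OF z_in run])
  note bound = S.sliding_bound(2)[OF z_in run star_ZR]
  define N0 where "N0 = nsq (z_in - (xs, ys))"
  define A where "A i = real (iter_prod c b i)" for i
  have A_prod: "(\<Prod>l=1..i. real (T l)) = A i" for i
    by (simp add: A_def iter_prod_eq T_def)
  have A_pos: "0 < A i" for i using iter_prod_pos by (simp add: A_def)
  have A_ge: "c * budget D \<epsilon> \<Omega> (\<pi> i) \<le> A i" if "i \<in> {1..3}" for i
    using iter_prod_ge[of i c b] that by (simp add: A_def b_def)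
  have c0: "0 < c" using c by simp
  have coeff: "(smooth_const (lev i) * (\<Prod>l=1..i. (step_size (T l - 1))\<^sup>2)
      + lip_const (lev i) * (\<Prod>l=1..i. step_size (T l - 1))) / 2 \<le> 1 / 72" if i: "i \<in> {1..3}" for i
  proof -
    define P where "P = (\<Prod>l=1..i. step_size (T l - 1))"
    have "P \<le> 2 ^ i / A i"
      unfolding P_def A_prod[symmetric] by (rule step_size_prod_le) (rule S.T_pos)
    also have "\<dots> \<le> 2 ^ 3 / A i"
      using i A_pos by (intro divide_right_mono power_increasing) (auto simp: less_imp_le)
    finally have P: "P \<le> 8 / A i" by simp
    have P0: "0 \<le> P" unfolding P_def by (intro prod_nonneg) (simp add: less_imp_le[OF step_size_pos])
    have "smooth_const (lev i) * P\<^sup>2 + lip_const (lev i) * P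
        \<le> smooth_const (lev i) * (8 / A i)\<^sup>2 + lip_const (lev i) * (8 / A i)"
      using S.L_pos[OF i] S.M_nonneg[OF i] P P0 by (intro add_mono mult_left_mono power_mono) auto
    moreover have "(smooth_const (lev i) * (8 / A i)\<^sup>2 + lip_const (lev i) * (8 / A i)) / 2 \<le> 1 / 72"
      using \<pi>[OF i]
    proof (elim disjE)
      assume j: "\<pi> i = 1"
      then have inv1: "inv \<pi> 1 = i" using inv[of i] by simp
      have L: "smooth_const (lev i) = holder_smooth (H_x D) (nu_x D) (H_x D) (\<Omega> / (384 * A i)) / \<delta>"
        "lip_const (lev i) = 0"
        by (simp_all add: lev_def stage_component_def j delta_tol_def inv1[unfolded One_nat_def] A_def b_def)
      have "c * (H_x_tilde D \<epsilon> powr (2 / (1 + 3 * nu_x D)) * \<Omega> powr (- alpha_x D)) \<le> c * budget D \<epsilon> \<Omega> (\<pi> i)"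
        using c0 unfolding j by (intro mult_left_mono) (auto simp: budget_def)
      also note A_ge[OF i]
      finally show ?thesis unfolding L H_x_tilde_def alpha_x_def
        using smooth_budget[OF nu_x H_x_pos \<Omega> del_pos c A_pos] by simp
    next
      assume j: "\<pi> i = 2"
      then have inv2: "inv \<pi> 2 = i" using inv[of i] by simp
      have L: "smooth_const (lev i) = holder_smooth (H_y_reg D \<epsilon>) (nu_y D) (H_y_reg D \<epsilon>) (\<Omega> / (384 * A i)) / \<Lambda>"
        "lip_const (lev i) = 0"
        by (simp_all add: lev_def stage_component_def j delta_tol_def inv2 A_def b_def holder_smooth_y)
      have "c * ((H_y_reg D \<epsilon> * \<Lambda> powr (- (1 + nu_y D) / 2)) powr (2 / (1 + 3 * nu_y D))
          * \<Omega> powr (- alpha_y D)) \<le> c * budget D \<epsilon> \<Omega> (\<pi> i)"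
        using c0 unfolding j by (intro mult_left_mono) (auto simp: budget_def)
      also note A_ge[OF i]
      finally show ?thesis unfolding L alpha_y_def
        using smooth_budget[OF nu_y H_y_reg_pos \<Omega> lam_pos c A_pos] by simp
    next
      assume j: "\<pi> i = 3"
      have L: "smooth_const (lev i) = kappa_xy D \<epsilon>" "lip_const (lev i) = sqrt (kappa_xy D \<epsilon>)"
        by (simp_all add: lev_def stage_component_def j)
      have "c * sqrt (kappa_xy D \<epsilon>) \<le> c * budget D \<epsilon> \<Omega> (\<pi> i)"
        using c0 unfolding j by (intro mult_left_mono) (auto simp: budget_def)
      also note A_ge[OF i]
      finally show ?thesis unfolding L by (rule bilinear_budget[OF kappa_pos c])
    qed
    ultimately show ?thesis unfolding P_def prod_power_distrib by simp
  qed
  define e where "e j = (if j = 1 \<or> j = 2 then \<Omega> / 384 else 0)" for j :: nat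
  have tol: "comp_tol c \<Omega> \<pi> (\<pi> i) * (\<Prod>l=1..i. real (T l)) \<le> e (\<pi> i)" if i: "i \<in> {1..3}" for i
  proof -
    have "delta_tol D \<epsilon> c \<Omega> \<pi> (\<pi> i) * A i = \<Omega> / 384"
      using A_pos[of i] by (simp add: delta_tol_def inv A_def b_def)
    then show ?thesis unfolding A_prod comp_tol_def e_def using \<Omega> by auto
  qed
  define h where "h j = comp_fun z_in j zt - comp_fun z_in j (xs, ys)
     + fst (Q_oracle (stage_component D \<epsilon> c \<Omega> \<pi> z_in j) (xs, ys)) \<bullet> (zt - (xs, ys))" for j
  have N0: "0 \<le> N0" by (simp add: N0_def)
  have "(\<Sum>i=1..3. h (\<pi> i)) \<le> (\<Sum>i=1..3. 1 / 72 * N0 + e (\<pi> i))"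
    unfolding h_def lev_def[symmetric] N0_def
    by (rule order_trans[OF bound sum_mono]) (intro add_mono mult_right_mono coeff tol nsq_nonneg; assumption)
  also have "\<dots> = N0 / 24 + (\<Sum>i=1..3. e (\<pi> i))" by (simp add: sum.distrib)
  finally have "(\<Sum>i=1..3. h i) \<le> N0 / 24 + (\<Sum>i=1..3. e i)"
    using sum.permute[OF perm, of h] sum.permute[OF perm, of e] by (simp add: o_def)
  then have sum_h: "h 1 + h 2 + h 3 \<le> N0 / 24 + \<Omega> / 192"
    by (simp add: eval_nat_numeral e_def)
  define x y where "x = fst zt" and "y = snd zt"
  have zt_eq: "zt = (x, y)" by (simp add: x_def y_def)
  have h12: "h 1 = fobj D x - fobj D xs" "h 2 = g_reg D \<epsilon> y - g_reg D \<epsilon> ys"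
    by (simp_all add: h_def comp_fun_def stage_component_def x_def y_def)
  have h3: "h 3 = p3 D \<epsilon> z_in zt - p3 D \<epsilon> z_in (xs, ys) + (Bt *v ys) \<bullet> (x - xs) - (B *v xs) \<bullet> (y - ys)"
    by (simp add: h_def comp_fun_def stage_component_def x_def y_def inner_prod_def del: transpose_matrix_vector)
  have D: "Df x = fobj D x - fobj D xs + (Bt *v ys) \<bullet> (x - xs)"
      "Dg y = g_reg D \<epsilon> y - g_reg D \<epsilon> ys - (B *v xs) \<bullet> (y - ys)"
    by (simp_all add: Df_def Dg_def bregman_def fs_eq gs_eq)
  define P1 where "P1 = beta_x_reg D \<epsilon> / 2 * (norm (B *v xs - g_reg_sub D \<epsilon> (snd z_in)))\<^sup>2"
  define P2 where "P2 = beta_y_reg D \<epsilon> / 2 * (norm (Bt *v ys + fsub D (fst z_in)))\<^sup>2"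
  have P1: "P1 \<le> Dg (snd z_in) / 4" unfolding P1_def by (rule g_smooth_residual)
  have P2: "P2 \<le> Df (fst z_in) / 4" unfolding P2_def by (rule f_smooth_residual)
  have p3s: "p3 D \<epsilon> z_in (xs, ys) = P1 + P2" by (simp add: p3_def P1_def P2_def)
  define q where "q = beta_x_reg D \<epsilon> / 4 * (mu_xy D)\<^sup>2 * (norm (x - xs))\<^sup>2"
  have p3z: "q - P1 \<le> p3 D \<epsilon> z_in zt"
  proof -
    let ?g = "g_reg_sub D \<epsilon> (snd z_in)"
    have "x - xs \<in> Rx" using zt by (simp add: ZR_iff x_def)
    then have m: "(mu_xy D)\<^sup>2 * (norm (x - xs))\<^sup>2 \<le> (norm (B *v (x - xs)))\<^sup>2" by (rule mu_xy_bound)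
    have B_diff: "B *v (x - xs) = (B *v x - ?g) - (B *v xs - ?g)" by (simp add: matrix_vector_mult_diff_distrib)
    have par: "(norm (u - v))\<^sup>2 \<le> 2 * (norm u)\<^sup>2 + 2 * (norm v)\<^sup>2" for u v :: "real^'y"
    proof -
      have "0 \<le> (norm (u + v))\<^sup>2" by simp
      then show ?thesis
        by (simp add: power2_norm_eq_inner inner_diff_left inner_diff_right inner_add_left inner_add_right inner_commute)
    qed
    have "(norm (B *v (x - xs)))\<^sup>2 \<le> 2 * (norm (B *v x - ?g))\<^sup>2 + 2 * (norm (B *v xs - ?g))\<^sup>2"
      unfolding B_diff by (rule par)
    with m have "(mu_xy D)\<^sup>2 * (norm (x - xs))\<^sup>2 \<le> 2 * (norm (B *v x - ?g))\<^sup>2 + 2 * (norm (B *v xs - ?g))\<^sup>2"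
      by linarith
    then have "beta_x_reg D \<epsilon> / 4 * ((mu_xy D)\<^sup>2 * (norm (x - xs))\<^sup>2)
        \<le> beta_x_reg D \<epsilon> / 4 * (2 * (norm (B *v x - ?g))\<^sup>2 + 2 * (norm (B *v xs - ?g))\<^sup>2)"
      using beta_x_nonneg by (intro mult_left_mono) auto
    moreover have "beta_x_reg D \<epsilon> / 4 * (2 * (norm (B *v x - ?g))\<^sup>2 + 2 * (norm (B *v xs - ?g))\<^sup>2)
        = beta_x_reg D \<epsilon> / 2 * (norm (B *v x - ?g))\<^sup>2 + P1"
      by (simp add: P1_def distrib_left)
    moreover have "beta_x_reg D \<epsilon> / 2 * (norm (B *v x - ?g))\<^sup>2 \<le> p3 D \<epsilon> z_in zt"
      using beta_y_nonneg by (simp add: p3_def x_def)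
    ultimately show ?thesis unfolding q_def by (simp only: mult.assoc)
  qed
  have main: "Df x + Dg y + q \<le> N0 / 24 + \<Omega> / 192 + 2 * P1 + P2"
    using sum_h p3z unfolding h12 h3 D p3s by linarith
  have x_mem: "x \<in> domX D" using zt by (simp add: ZR_iff x_def)
  have "\<delta> * (norm (x - xs))\<^sup>2 = mu_x D * (norm (x - xs))\<^sup>2 + 16 * q"
    by (simp add: delta_x_reg_def q_def algebra_simps)
  then have "Psi D \<epsilon> r zt \<le> 14 * Df x + 14 * Dg y + 16 * q"
    unfolding zt_eq Psi_eq using Df_strong[OF x_mem] Dg_strong[of y] by linarith
  moreover have "0 \<le> P1" "0 \<le> P2" using beta_x_nonneg beta_y_nonneg by (simp_all add: P1_def P2_def)
  moreover have "N0 + 12 * Df (fst z_in) + 12 * Dg (snd z_in) \<le> \<Omega>"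
    using Psi_in Psi_eq[of "fst z_in" "snd z_in"] unfolding N0_def nsq_Pair by simp
  ultimately have "Psi D \<epsilon> r zt \<le> 3 / 4 * \<Omega>"
    using main P1 P2 Df_nonneg[of x] Dg_nonneg[of y] by linarith
  then show "fst (stage D \<epsilon> c \<Omega> \<pi> z_in) \<in> ZR" "Psi D \<epsilon> r (fst (stage D \<epsilon> c \<Omega> \<pi> z_in)) \<le> 3 / 4 * \<Omega>"
    using zt unfolding out by auto
qed

end

section \<open>From the potential to the duality gap\<close>

context regularized_problem
begin

lemma kappa_hat_pos: "0 < kappa_hat D \<epsilon>"
  unfolding kappa_hat_def using L_xy_pos del_pos lam_pos by simp

lemma kappa_hat_mu_pos: "0 < mu_x D \<Longrightarrow> 0 < kappa_hat_mu D \<epsilon>"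
  unfolding kappa_hat_mu_def using L_xy_pos lam_pos by simp

lemma eps_star_pos:
  assumes "0 < mu_x D \<or> bounded (domX D)"
  shows "0 < eps_star D \<epsilon>"
proof -
  have "0 < diameter (domX D)" if "diameter (domX D) \<noteq> 0" "bounded (domX D)"
    using diameter_ge_0[OF that(2)] that(1) by simp
  moreover have "0 < 1/6 + 1/2 * kappa_hat D \<epsilon>" using kappa_hat_pos by simp
  moreover have "0 < 1/6 + 1/2 * kappa_hat D \<epsilon> + 1/2 * kappa_hat_mu D \<epsilon>" if "0 < mu_x D"
    using kappa_hat_pos kappa_hat_mu_pos[OF that] by simp
  ultimately show ?thesis
    using assms \<epsilon> lam_pos L_xy_pos unfolding eps_star_def by (auto intro!: divide_pos_pos mult_pos_pos)
qed

lemma F_reg_expansion: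
  "F_reg D \<epsilon> x v = F_reg D \<epsilon> xs ys + Df x - Dg v + (v - ys) \<bullet> (B *v (x - xs))"
proof -
  have Df: "Df x = fobj D x - fobj D xs + ys \<bullet> (B *v (x - xs))"
  proof -
    have "(Bt *v ys) \<bullet> h = ys \<bullet> (B *v h)" for h
      using matrix_adjoint[of Bt ys h] unfolding transpose_transpose .
    then show ?thesis unfolding Df_def bregman_def fs_eq inner_minus_left by simp
  qed
  have Dg: "Dg v = g_reg D \<epsilon> v - g_reg D \<epsilon> ys - (B *v xs) \<bullet> (v - ys)"
    by (simp add: Dg_def bregman_def gs_eq)
  have Bd: "B *v (x - xs) = B *v x - B *v xs" by (rule matrix_vector_mult_diff_distrib)
  show ?thesis unfolding F_reg_def Df Dg Bd
    by (simp add: inner_diff_left inner_diff_right inner_commute)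
qed

lemma coupling_bound: "\<bar>v \<bullet> (B *v h)\<bar> \<le> L_xy D * norm v * norm h"
proof -
  have "\<bar>v \<bullet> (B *v h)\<bar> \<le> norm v * norm (B *v h)" by (rule Cauchy_Schwarz_ineq2)
  also have "\<dots> \<le> norm v * (L_xy D * norm h)" by (intro mult_left_mono B_bound norm_ge_zero)
  finally show ?thesis by (simp add: mult_ac)
qed

lemma young_scaled: "0 < m \<Longrightarrow> L * a * b \<le> m / 2 * a\<^sup>2 + L\<^sup>2 / (2 * m) * b\<^sup>2" for m L a b :: real
proof -
  assume m: "0 < m"
  have "0 \<le> (m * a - L * b)\<^sup>2 / (2 * m)" using m by simp
  also have "\<dots> = m / 2 * a\<^sup>2 + L\<^sup>2 / (2 * m) * b\<^sup>2 - L * a * b"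
    using m by (simp add: power2_eq_square field_simps)
  finally show ?thesis by simp
qed

lemma Fobj_eq: "Fobj D x v = F_reg D \<epsilon> x v + \<Lambda> / 2 * (norm (v - y_ref D))\<^sup>2"
  by (simp add: Fobj_def F_reg_def g_reg_def)

lemma Omega_bound: "v \<in> domY D \<Longrightarrow> \<Lambda> / 2 * (norm (v - y_ref D))\<^sup>2 \<le> \<epsilon> / 2"
proof -
  assume v: "v \<in> domY D"
  obtain K where K: "\<And>y. y \<in> domY D \<Longrightarrow> norm y \<le> K" using Y_bounded by (auto simp: bounded_iff)
  have "bdd_above ((\<lambda>y. (norm (y - y_ref D))\<^sup>2) ` domY D)"
    by (rule bdd_aboveI2[where M = "(K + norm (y_ref D))\<^sup>2"])
      (intro power_mono norm_ge_zero order_trans[OF norm_triangle_ineq4 add_right_mono[OF K]])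
  then have "(norm (v - y_ref D))\<^sup>2 \<le> Omega_y D"
    unfolding Omega_y_def using v by (rule cSUP_upper[rotated])
  then have "\<Lambda> / 2 * (norm (v - y_ref D))\<^sup>2 \<le> \<Lambda> / 2 * Omega_y D"
    using lam_pos by (intro mult_left_mono) auto
  then show ?thesis using Omega_pos by (simp add: lambda_y_def)
qed

text \<open>
  The gap is the excess of the Lagrangian at \<open>(x, v)\<close> over the saddle value plus its deficit at \<open>(u, y)\<close>.
  In the first, the strong convexity of the regularized \<open>g\<close> at \<open>v\<close> absorbs the coupling term.  In the
  second, this is done by the strong convexity of \<open>f\<close> at \<open>u\<close> or, failing that, by the bounded domain;
  these two ways give the two cases in the definition of \<open>eps_star\<close>.
\<close>
lemma gap_bound:
  assumes z: "z \<in> ZR" and Psi: "Psi D \<epsilon> r z \<le> eps_star D \<epsilon>" and mode: "0 < mu_x D \<or> bounded (domX D)"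
  shows "gap D z \<le> ereal \<epsilon>"
proof -
  define x y where "x = fst z" and "y = snd z"
  define X Y where "X = norm (x - xs)" and "Y = norm (y - ys)"
  define F where "F = F_reg D \<epsilon> xs ys"
  have Psi_eq': "Psi D \<epsilon> r z = \<delta> * X\<^sup>2 + \<Lambda> * Y\<^sup>2 + 12 * Df x + 12 * Dg y"
    using Psi_eq[of x y] by (simp add: x_def y_def X_def Y_def)
  have nn: "0 \<le> Df x" "0 \<le> Dg y" "0 \<le> \<delta> * X\<^sup>2" "0 \<le> \<Lambda> * Y\<^sup>2"
    using Df_nonneg Dg_nonneg del_pos lam_pos by auto
  define P where "P = Psi D \<epsilon> r z"
  have P: "12 * (Df x + Dg y) \<le> P" "\<delta> * X\<^sup>2 \<le> P" "\<Lambda> * Y\<^sup>2 \<le> P" "0 \<le> P"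
    unfolding P_def Psi_eq' using nn by auto
  have upper: "Fobj D x v \<le> F + Df x + kappa_hat D \<epsilon> / 2 * (\<delta> * X\<^sup>2) + \<epsilon> / 2" if v: "v \<in> domY D" for v
  proof -
    have "(v - ys) \<bullet> (B *v (x - xs)) \<le> L_xy D * norm (v - ys) * X"
      using coupling_bound[of "v - ys" "x - xs"] unfolding X_def by linarith
    also have "\<dots> \<le> \<Lambda> / 2 * (norm (v - ys))\<^sup>2 + (L_xy D)\<^sup>2 / (2 * \<Lambda>) * X\<^sup>2"
      by (rule young_scaled[OF lam_pos])
    also have "(L_xy D)\<^sup>2 / (2 * \<Lambda>) * X\<^sup>2 = kappa_hat D \<epsilon> / 2 * (\<delta> * X\<^sup>2)"
      using del_pos by (simp add: kappa_hat_def)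
    finally show ?thesis
      using F_reg_expansion[of x v] Fobj_eq[of x v] Dg_strong[of v] Omega_bound[OF v] unfolding F_def by linarith
  qed
  define E where "E = (if 0 < mu_x D then kappa_hat_mu D \<epsilon> / 2 * (\<Lambda> * Y\<^sup>2) else L_xy D * Y * diameter (domX D))"
  have lower: "F - Dg y - E \<le> Fobj D u y" if u: "u \<in> domX D" for u
  proof -
    have 1: "- (L_xy D * Y * norm (u - xs)) \<le> (y - ys) \<bullet> (B *v (u - xs))"
      using coupling_bound[of "y - ys" "u - xs"] unfolding Y_def by linarith
    have "L_xy D * Y * norm (u - xs) \<le> Df u + E"
    proof (cases "0 < mu_x D")
      case True
      have "L_xy D * norm (u - xs) * Y \<le> mu_x D / 2 * (norm (u - xs))\<^sup>2 + (L_xy D)\<^sup>2 / (2 * mu_x D) * Y\<^sup>2"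
        by (rule young_scaled[OF True])
      also have "(L_xy D)\<^sup>2 / (2 * mu_x D) * Y\<^sup>2 = E"
        using True lam_pos by (simp add: E_def kappa_hat_mu_def)
      also have "mu_x D / 2 * (norm (u - xs))\<^sup>2 \<le> Df u" by (rule Df_strong[OF u])
      finally show ?thesis by (simp add: mult_ac)
    next
      case False
      then have "norm (u - xs) \<le> diameter (domX D)"
        using mode diameter_bounded_bound[OF _ u saddle_mem(1)] by (simp add: dist_norm)
      then have "L_xy D * Y * norm (u - xs) \<le> E"
        using False L_xy_pos by (auto simp: E_def Y_def intro!: mult_left_mono)
      then show ?thesis using Df_nonneg[of u] by linarith
    qed
    moreover have "0 \<le> \<Lambda> / 2 * (norm (y - y_ref D))\<^sup>2" using lam_pos by simp
    ultimately show ?thesis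
      using 1 F_reg_expansion[of u y] Fobj_eq[of u y] unfolding F_def by linarith
  qed
  have total: "Df x + Dg y + kappa_hat D \<epsilon> / 2 * (\<delta> * X\<^sup>2) + E \<le> \<epsilon> / 2"
  proof (cases "0 < mu_x D")
    case True
    define k where "k = 1/6 + 1/2 * kappa_hat D \<epsilon> + 1/2 * kappa_hat_mu D \<epsilon>"
    have k: "0 < k" using kappa_hat_pos kappa_hat_mu_pos[OF True] by (simp add: k_def)
    have "Df x + Dg y + kappa_hat D \<epsilon> / 2 * (\<delta> * X\<^sup>2) + E
        \<le> 1 / 6 * P + kappa_hat D \<epsilon> / 2 * P + kappa_hat_mu D \<epsilon> / 2 * P"
      unfolding E_def if_P[OF True] using P kappa_hat_pos kappa_hat_mu_pos[OF True]
      by (intro add_mono mult_left_mono) auto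
    also have "\<dots> = k * P" by (simp add: k_def algebra_simps)
    also have "\<dots> \<le> k * (\<epsilon> / (2 * k))"
      using Psi k True unfolding P_def k_def eps_star_def by (intro mult_left_mono) auto
    finally show ?thesis using k by simp
  next
    case False
    then have bdd: "bounded (domX D)" using mode by simp
    define k where "k = 1/6 + 1/2 * kappa_hat D \<epsilon>"
    have k: "0 < k" using kappa_hat_pos by (simp add: k_def)
    define d where "d = diameter (domX D)"
    have d0: "0 \<le> d" unfolding d_def by (rule diameter_ge_0[OF bdd])
    have P1: "P \<le> \<epsilon> / (4 * k)"
      using Psi False unfolding P_def k_def eps_star_def by (simp split: if_splits)
    have "Df x + Dg y + kappa_hat D \<epsilon> / 2 * (\<delta> * X\<^sup>2) \<le> 1 / 6 * P + kappa_hat D \<epsilon> / 2 * P"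
      using P kappa_hat_pos by (intro add_mono mult_left_mono) auto
    also have "\<dots> = k * P" by (simp add: k_def algebra_simps)
    also have "\<dots> \<le> k * (\<epsilon> / (4 * k))" using P1 k by (intro mult_left_mono) auto
    finally have 1: "Df x + Dg y + kappa_hat D \<epsilon> / 2 * (\<delta> * X\<^sup>2) \<le> \<epsilon> / 4" using k by simp
    have "E \<le> \<epsilon> / 4"
    proof (cases "d = 0")
      case True
      then show ?thesis using False \<epsilon> by (simp add: E_def d_def)
    next
      case dn: False
      then have d: "0 < d" using d0 by simp
      have "\<Lambda> * Y\<^sup>2 \<le> \<Lambda> * \<epsilon>\<^sup>2 / (16 * (L_xy D)\<^sup>2 * d\<^sup>2)"
        using Psi P(3) False dn unfolding P_def eps_star_def d_def by simp
      then have "\<Lambda> * Y\<^sup>2 \<le> \<Lambda> * (\<epsilon>\<^sup>2 / (16 * (L_xy D)\<^sup>2 * d\<^sup>2))" by simp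
      then have "Y\<^sup>2 \<le> \<epsilon>\<^sup>2 / (16 * (L_xy D)\<^sup>2 * d\<^sup>2)"
        using lam_pos by (rule mult_left_le_imp_le)
      then have "(L_xy D * d)\<^sup>2 * Y\<^sup>2 \<le> (L_xy D * d)\<^sup>2 * (\<epsilon>\<^sup>2 / (16 * (L_xy D)\<^sup>2 * d\<^sup>2))"
        by (rule mult_left_mono) simp
      also have "\<dots> = (\<epsilon> / 4)\<^sup>2"
        using d L_xy_pos by (simp add: power_mult_distrib power_divide)
      also have "(L_xy D * d)\<^sup>2 * Y\<^sup>2 = (L_xy D * Y * d)\<^sup>2" by (simp add: power_mult_distrib)
      finally have "(L_xy D * Y * d)\<^sup>2 \<le> (\<epsilon> / 4)\<^sup>2" .
      then have "L_xy D * Y * d \<le> \<epsilon> / 4" by (rule power2_le_imp_le) (use \<epsilon> in simp)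
      then show ?thesis using False by (simp add: E_def d_def)
    qed
    then show ?thesis using 1 by linarith
  qed
  have "gap D z \<le> ereal (F + Df x + kappa_hat D \<epsilon> / 2 * (\<delta> * X\<^sup>2) + \<epsilon> / 2) - ereal (F - Dg y - E)"
    unfolding gap_def x_def[symmetric] y_def[symmetric]
    by (intro ereal_minus_mono SUP_least INF_greatest) (simp_all only: ereal_less_eq upper lower)
  also have "\<dots> \<le> ereal \<epsilon>"
    unfolding ereal_minus(1) ereal_less_eq(3) using total by linarith
  finally show ?thesis .
qed

text \<open>
  The last stage still has a target of at least \<open>eps_star\<close>, whence the geometric lower bound on all targets.
\<close>
lemma restarts_bound:
  assumes "eps_star D \<epsilon> < Psi0 D \<epsilon> r" and pos: "0 < eps_star D \<epsilon>"
  shows "(3 / 4) ^ restarts D \<epsilon> r * Psi0 D \<epsilon> r \<le> eps_star D \<epsilon>"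
    and "real (restarts D \<epsilon> r) \<le> ln (Psi0 D \<epsilon> r / eps_star D \<epsilon>) / ln (4 / 3) + 1"
    and "s < restarts D \<epsilon> r \<Longrightarrow> (4 / 3) ^ (restarts D \<epsilon> r - Suc s) * eps_star D \<epsilon> \<le> stage_Omega D \<epsilon> r s"
proof -
  define q where "q = Psi0 D \<epsilon> r / eps_star D \<epsilon>"
  define S where "S = restarts D \<epsilon> r"
  have q: "1 < q" using assms by (simp add: q_def)
  have l: "0 < ln (4 / 3 :: real)" by simp
  have S: "S = nat \<lceil>ln q / ln (4 / 3)\<rceil>" using assms by (simp add: S_def restarts_def q_def)
  have pos_q: "0 < ln q / ln (4 / 3)" using q l by simp
  have S1: "ln q / ln (4 / 3) \<le> real S" and S2: "real S < ln q / ln (4 / 3) + 1"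
    unfolding S using pos_q by linarith+
  show "real (restarts D \<epsilon> r) \<le> ln (Psi0 D \<epsilon> r / eps_star D \<epsilon>) / ln (4 / 3) + 1"
    using S2 unfolding S_def q_def by simp
  have pw: "ln ((4 / 3) ^ n) = real n * ln (4 / 3 :: real)" for n :: nat by (rule ln_realpow)
  have "ln q \<le> ln ((4 / 3) ^ S)" unfolding pw using S1 l by (simp add: field_simps)
  then have "q \<le> (4 / 3) ^ S" using q by simp
  then have "Psi0 D \<epsilon> r \<le> (4 / 3) ^ S * eps_star D \<epsilon>" using pos by (simp add: q_def field_simps)
  then have "(3 / 4) ^ S * Psi0 D \<epsilon> r \<le> (3 / 4) ^ S * ((4 / 3) ^ S * eps_star D \<epsilon>)" by (intro mult_left_mono) auto
  also have "\<dots> = ((3 / 4) * (4 / 3)) ^ S * eps_star D \<epsilon>"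
    unfolding power_mult_distrib by (rule mult.assoc[symmetric])
  also have "\<dots> = eps_star D \<epsilon>" by simp
  finally show "(3 / 4) ^ restarts D \<epsilon> r * Psi0 D \<epsilon> r \<le> eps_star D \<epsilon>" unfolding S_def .
  assume s: "s < restarts D \<epsilon> r"
  then have "real (S - 1) \<le> ln q / ln (4 / 3)" using S2 unfolding S_def by linarith
  then have "ln ((4 / 3) ^ (S - 1)) \<le> ln q" unfolding pw using l by (simp add: field_simps)
  then have "(4 / 3) ^ (S - 1) \<le> q" using q by simp
  then have "(4 / 3) ^ (S - 1) * eps_star D \<epsilon> \<le> Psi0 D \<epsilon> r" using pos by (simp add: q_def field_simps)
  then have "(3 / 4) ^ s * ((4 / 3) ^ (S - 1) * eps_star D \<epsilon>) \<le> (3 / 4) ^ s * Psi0 D \<epsilon> r"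
    by (intro mult_left_mono) auto
  moreover have "(3 / 4 :: real) ^ s * (4 / 3) ^ (S - 1) = (4 / 3) ^ (S - Suc s)"
  proof -
    have "S - 1 = s + (S - Suc s)" using s by (simp add: S_def)
    then have "(3 / 4 :: real) ^ s * (4 / 3) ^ (S - 1) = ((3 / 4) ^ s * (4 / 3) ^ s) * (4 / 3) ^ (S - Suc s)"
      by (simp add: power_add)
    also have "(3 / 4 :: real) ^ s * (4 / 3) ^ s = 1" unfolding power_mult_distrib[symmetric] by simp
    finally show ?thesis by simp
  qed
  ultimately show "(4 / 3) ^ (restarts D \<epsilon> r - Suc s) * eps_star D \<epsilon> \<le> stage_Omega D \<epsilon> r s"
    unfolding stage_Omega_def S_def by (simp only: mult.assoc[symmetric])
qed

lemma run_stages_contraction: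
  assumes c: "10 ^ 6 \<le> c" and pos: "0 < Psi0 D \<epsilon> r"
    and order: "\<And>s. s < S \<Longrightarrow> level_order D \<epsilon> (stage_Omega D \<epsilon> r s) (\<pi> s)"
  shows "s \<le> S \<Longrightarrow> fst (run_stages D \<epsilon> c r \<pi> s) \<in> ZR
     \<and> Psi D \<epsilon> r (fst (run_stages D \<epsilon> c r \<pi> s)) \<le> stage_Omega D \<epsilon> r s"
proof (induction s)
  case 0
  then show ?case using init_ZR by (simp add: stage_Omega_def Psi0_def)
next
  case (Suc s)
  define z where "z = fst (run_stages D \<epsilon> c r \<pi> s)"
  have IH: "z \<in> ZR" "Psi D \<epsilon> r z \<le> stage_Omega D \<epsilon> r s" using Suc by (auto simp: z_def)
  have "0 < stage_Omega D \<epsilon> r s" using pos by (simp add: stage_Omega_def)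
  note step = stage_contraction[OF c this order IH]
  have "fst (run_stages D \<epsilon> c r \<pi> (Suc s)) = fst (stage D \<epsilon> c (stage_Omega D \<epsilon> r s) (\<pi> s) z)"
    by (simp add: z_def Let_def case_prod_beta)
  moreover have "stage_Omega D \<epsilon> r (Suc s) = 3 / 4 * stage_Omega D \<epsilon> r s" by (simp add: stage_Omega_def)
  ultimately show ?case using step Suc.prems by simp
qed

theorem output_gap:
  assumes c: "10 ^ 6 \<le> c" and mode: "0 < mu_x D \<or> bounded (domX D)"
    and order: "\<And>s. s < restarts D \<epsilon> r \<Longrightarrow> level_order D \<epsilon> (stage_Omega D \<epsilon> r s) (\<pi> s)"
  shows "gap D (output_point D \<epsilon> c r \<pi>) \<le> ereal \<epsilon>"
proof (cases "Psi0 D \<epsilon> r \<le> eps_star D \<epsilon>")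
  case True
  then have "output_point D \<epsilon> c r \<pi> = z_init D"
    by (simp add: output_point_def restarted_sliding_def restarts_def)
  then show ?thesis using gap_bound[OF init_ZR _ mode] True by (simp add: Psi0_def)
next
  case False
  have pos: "0 < eps_star D \<epsilon>" by (rule eps_star_pos[OF mode])
  then have "0 < Psi0 D \<epsilon> r" using False by simp
  note run = run_stages_contraction[OF c this order order_refl]
  have "Psi D \<epsilon> r (output_point D \<epsilon> c r \<pi>) \<le> eps_star D \<epsilon>"
    using run restarts_bound(1)[OF _ pos] False
    unfolding output_point_def restarted_sliding_def stage_Omega_def by force
  then show ?thesis using run unfolding output_point_def restarted_sliding_def by (intro gap_bound mode) auto
qed

end

section \<open>Oracle calls of the restarted algorithm\<close>

lemma iter_prod_Suc_le:
  assumes "0 \<le> c * b (Suc i)"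
  shows "real (iter_prod c b (Suc i)) \<le> real (iter_prod c b i) + c * b (Suc i)"
proof -
  define A where "A = iter_prod c b i"
  have A: "0 < real A" unfolding A_def using iter_prod_pos[of c b i] by simp
  define x where "x = c * b (Suc i) / real A"
  have "0 \<le> x" using assms A by (simp add: x_def)
  then have "real (max 1 (nat \<lceil>x\<rceil>)) \<le> 1 + x" by linarith
  then have "real A * real (max 1 (nat \<lceil>x\<rceil>)) \<le> real A * (1 + x)" using A by (intro mult_left_mono) auto
  also have "\<dots> = real A + c * b (Suc i)" using A by (simp add: x_def distrib_left)
  finally show ?thesis by (simp add: A_def x_def)
qed

text \<open>
  Rounding up adds at most the previous product, so the product at level \<open>k\<close> is at most \<open>1\<close> plus
  \<open>c\<close> times the sum of the budgets up to \<open>k\<close>, of which the last is the largest.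
\<close>
lemma iter_prod_le:
  assumes c: "0 \<le> c" and b: "1 \<le> b 1" "b 1 \<le> b 2" "b 2 \<le> b 3" and k: "k \<in> {1..3}"
  shows "real (iter_prod c b k) \<le> (3 * c + 1) * b k"
proof -
  have b': "1 \<le> b (Suc 0)" "b (Suc 0) \<le> b (Suc (Suc 0))" "b (Suc (Suc 0)) \<le> b (Suc (Suc (Suc 0)))"
    using b by (simp_all add: eval_nat_numeral)
  have nn: "0 \<le> c * b (Suc 0)" "0 \<le> c * b (Suc (Suc 0))" "0 \<le> c * b (Suc (Suc (Suc 0)))"
    using c b' by (auto intro!: mult_nonneg_nonneg)
  have mono: "c * b (Suc 0) \<le> c * b (Suc (Suc 0))" "c * b (Suc (Suc 0)) \<le> c * b (Suc (Suc (Suc 0)))"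
    using c b' by (auto intro!: mult_left_mono)
  note s = iter_prod_Suc_le[of c b 0, OF nn(1)] iter_prod_Suc_le[of c b "Suc 0", OF nn(2)]
    iter_prod_Suc_le[of c b "Suc (Suc 0)", OF nn(3)]
  have i0: "real (iter_prod c b 0) = 1" by simp
  have expand: "(3 * c + 1) * x = 3 * (c * x) + x" for x by (simp add: algebra_simps)
  consider "k = Suc 0" | "k = Suc (Suc 0)" | "k = Suc (Suc (Suc 0))" using k by force
  then show ?thesis
  proof cases
    case 1
    show ?thesis unfolding 1 expand using s(1) i0 nn(1) b'(1) by linarith
  next
    case 2
    show ?thesis unfolding 2 expand using s(1,2) i0 nn(1,2) mono b' by linarith
  next
    case 3
    show ?thesis unfolding 3 expand using s i0 nn mono b' by linarith
  qed
qed

lemma calls_projections: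
  "fst (a + b) = fst a + fst b" "fst (snd (a + b)) = fst (snd a) + fst (snd b)"
  "snd (snd (a + b)) = snd (snd a) + snd (snd b)" for a b :: calls
  by simp_all

context
  fixes D :: "('x::finite, 'y::finite) saddle_data" and \<epsilon> c \<Omega> :: real and \<pi> :: "nat \<Rightarrow> nat"
  assumes order: "level_order D \<epsilon> \<Omega> \<pi>"
begin

lemma level_permutes: "\<pi> permutes {1..3}"
  using order by (simp add: level_order_def)

abbreviation "level_iters j \<equiv> iter_prod c (\<lambda>l. budget D \<epsilon> \<Omega> (\<pi> l)) (inv \<pi> j)"

lemma sliding_stage_calls:
  fixes \<phi> :: "calls \<Rightarrow> nat"
  assumes add: "\<And>a b. \<phi> (a + b) = \<phi> a + \<phi> b"
  shows "\<phi> (snd (stage D \<epsilon> c \<Omega> \<pi> z_in)) = level_iters 1 * \<phi> (1, 0, 0) + level_iters 2 * \<phi> (0, 1, 0)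
     + level_iters 3 * (\<phi> (0, 0, 4) + 2 * \<phi> (0, 0, 2)) + \<phi> (1, 1, 0)"
proof -
  define b where "b = (\<lambda>l. budget D \<epsilon> \<Omega> (\<pi> l))"
  define cg where "cg j = (if j = 1 then (1, 0, 0) else if j = 2 then (0, 1, 0) else (0, 0, 4) :: calls)" for j :: nat
  define cq where "cq j = (if j = 1 \<or> j = 2 then 0 else (0, 0, 2) :: calls)" for j :: nat
  have \<phi>0: "\<phi> 0 = 0" using add[of 0 0] by simp
  have "\<phi> (snd (sliding (domZ D) (P_norm_sq D \<epsilon>) 3 (\<lambda>l. stage_component D \<epsilon> c \<Omega> \<pi> z_in (\<pi> l)) (iter_count c b) z_in))
      = (\<Sum>i=1..3. (\<Prod>l=1..i. iter_count c b l) * (\<phi> (cg (\<pi> i)) + 2 * \<phi> (cq (\<pi> i))))"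
    by (rule sliding_calls[OF add]) (simp_all add: stage_component_def cg_def cq_def zero_prod_def)
  also have "\<dots> = (\<Sum>i=1..3. level_iters (\<pi> i) * (\<phi> (cg (\<pi> i)) + 2 * \<phi> (cq (\<pi> i))))"
    unfolding iter_prod_eq[symmetric] b_def permutes_inverses(2)[OF level_permutes] by (rule refl)
  also have "\<dots> = (\<Sum>j=1..3. level_iters j * (\<phi> (cg j) + 2 * \<phi> (cq j)))"
    using sum.permute[OF level_permutes, of "\<lambda>j. level_iters j * (\<phi> (cg j) + 2 * \<phi> (cq j))"] by (simp add: o_def)
  also have "\<dots> = level_iters 1 * \<phi> (1, 0, 0) + level_iters 2 * \<phi> (0, 1, 0)
     + level_iters 3 * (\<phi> (0, 0, 4) + 2 * \<phi> (0, 0, 2))"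
    by (simp add: eval_nat_numeral cg_def cq_def \<phi>0)
  finally show ?thesis
    unfolding stage_def Let_def b_def by (simp add: case_prod_beta add)
qed

lemma level_iters_le:
  assumes c: "0 \<le> c" and j: "j \<in> {1..3}"
  shows "real (level_iters j) \<le> (3 * c + 1) * budget D \<epsilon> \<Omega> j"
proof -
  have k: "inv \<pi> j \<in> {1..3}" using permutes_in_image[OF permutes_inv[OF level_permutes]] j by simp
  have one: "1 \<le> budget D \<epsilon> \<Omega> i" for i by (simp add: budget_def)
  have "real (level_iters j) \<le> (3 * c + 1) * budget D \<epsilon> \<Omega> (\<pi> (inv \<pi> j))"
    using order by (intro iter_prod_le[OF c _ _ _ k] one) (auto simp: level_order_def)
  then show ?thesis unfolding permutes_inverses(1)[OF level_permutes] .
qed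

lemma stage_calls_le:
  assumes c: "0 \<le> c"
  shows "real (fst (snd (stage D \<epsilon> c \<Omega> \<pi> z_in))) \<le> (24 * c + 8) * budget D \<epsilon> \<Omega> 1"
    and "real (fst (snd (snd (stage D \<epsilon> c \<Omega> \<pi> z_in)))) \<le> (24 * c + 8) * budget D \<epsilon> \<Omega> 2"
    and "real (snd (snd (snd (stage D \<epsilon> c \<Omega> \<pi> z_in)))) \<le> (24 * c + 8) * budget D \<epsilon> \<Omega> 3"
proof -
  have one: "1 \<le> budget D \<epsilon> \<Omega> i" for i by (simp add: budget_def)
  have cb: "0 \<le> c * budget D \<epsilon> \<Omega> i" for i using c one[of i] by simp
  note le = level_iters_le[OF c]
  have "fst (snd (stage D \<epsilon> c \<Omega> \<pi> z_in)) = level_iters 1 + 1"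
    by (subst sliding_stage_calls) (simp_all add: calls_projections)
  then show "real (fst (snd (stage D \<epsilon> c \<Omega> \<pi> z_in))) \<le> (24 * c + 8) * budget D \<epsilon> \<Omega> 1"
    using le[of 1] one[of 1] cb[of 1] by (simp add: distrib_right)
  have "fst (snd (snd (stage D \<epsilon> c \<Omega> \<pi> z_in))) = level_iters 2 + 1"
    by (subst sliding_stage_calls[of "\<lambda>k. fst (snd k)"]) (simp_all add: calls_projections)
  then show "real (fst (snd (snd (stage D \<epsilon> c \<Omega> \<pi> z_in)))) \<le> (24 * c + 8) * budget D \<epsilon> \<Omega> 2"
    using le[of 2] one[of 2] cb[of 2] by (simp add: distrib_right)
  have "snd (snd (snd (stage D \<epsilon> c \<Omega> \<pi> z_in))) = level_iters 3 * 8"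
    by (subst sliding_stage_calls[of "\<lambda>k. snd (snd k)"]) (simp_all add: calls_projections)
  then show "real (snd (snd (snd (stage D \<epsilon> c \<Omega> \<pi> z_in)))) \<le> (24 * c + 8) * budget D \<epsilon> \<Omega> 3"
    using le[of 3] by (simp add: distrib_right)
qed

end

lemma run_stages_calls_le:
  fixes \<phi> :: "calls \<Rightarrow> nat"
  assumes add: "\<And>a b. \<phi> (a + b) = \<phi> a + \<phi> b"
    and stage: "\<And>s z. s < S \<Longrightarrow> real (\<phi> (snd (stage D \<epsilon> c (stage_Omega D \<epsilon> r s) (\<pi> s) z))) \<le> B s"
  shows "s \<le> S \<Longrightarrow> real (\<phi> (snd (run_stages D \<epsilon> c r \<pi> s))) \<le> (\<Sum>t<s. B t)"
proof (induction s)
  case 0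
  have "\<phi> 0 = 0" using add[of 0 0] by simp
  then show ?case by simp
next
  case (Suc s)
  then show ?case using stage[of s "fst (run_stages D \<epsilon> c r \<pi> s)"]
    by (simp add: Let_def case_prod_beta add)
qed

lemma total_calls_le:
  assumes c: "0 \<le> c"
    and order: "\<And>s. s < restarts D \<epsilon> r \<Longrightarrow> level_order D \<epsilon> (stage_Omega D \<epsilon> r s) (\<pi> s)"
  shows "real (N_f_tot D \<epsilon> c r \<pi>) \<le> (24 * c + 8) * (\<Sum>s<restarts D \<epsilon> r. budget D \<epsilon> (stage_Omega D \<epsilon> r s) 1)"
    and "real (N_g_tot D \<epsilon> c r \<pi>) \<le> (24 * c + 8) * (\<Sum>s<restarts D \<epsilon> r. budget D \<epsilon> (stage_Omega D \<epsilon> r s) 2)"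
    and "real (N_B_tot D \<epsilon> c r \<pi>) \<le> (24 * c + 8) * (\<Sum>s<restarts D \<epsilon> r. budget D \<epsilon> (stage_Omega D \<epsilon> r s) 3)"
proof -
  note st = stage_calls_le[OF order c]
  show "real (N_f_tot D \<epsilon> c r \<pi>) \<le> (24 * c + 8) * (\<Sum>s<restarts D \<epsilon> r. budget D \<epsilon> (stage_Omega D \<epsilon> r s) 1)"
    unfolding N_f_tot_def restarted_sliding_def sum_distrib_left
    by (rule run_stages_calls_le[where \<phi> = fst, OF calls_projections(1) st(1) order_refl])
  show "real (N_g_tot D \<epsilon> c r \<pi>) \<le> (24 * c + 8) * (\<Sum>s<restarts D \<epsilon> r. budget D \<epsilon> (stage_Omega D \<epsilon> r s) 2)"
    unfolding N_g_tot_def restarted_sliding_def sum_distrib_left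
    by (rule run_stages_calls_le[where \<phi> = "\<lambda>k. fst (snd k)", OF calls_projections(2) st(2) order_refl])
  show "real (N_B_tot D \<epsilon> c r \<pi>) \<le> (24 * c + 8) * (\<Sum>s<restarts D \<epsilon> r. budget D \<epsilon> (stage_Omega D \<epsilon> r s) 3)"
    unfolding N_B_tot_def restarted_sliding_def sum_distrib_left
    by (rule run_stages_calls_le[where \<phi> = "\<lambda>k. snd (snd k)", OF calls_projections(3) st(3) order_refl])
qed


section \<open>Sums of the stage budgets\<close>

lemma ln_le_powr_div:
  assumes "0 < x" "0 < (\<alpha>::real)"
  shows "ln x \<le> x powr \<alpha> / \<alpha>"
proof -
  have "\<alpha> * ln x = ln (x powr \<alpha>)" using assms by (simp add: ln_powr)
  also have "\<dots> \<le> x powr \<alpha>" using ln_le_minus_one[of "x powr \<alpha>"] assms by simp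
  finally show ?thesis using assms by (simp add: field_simps)
qed

lemma max_one_le: "0 < h0 \<Longrightarrow> h0 \<le> h \<Longrightarrow> max h 1 \<le> (1 + 1 / h0) * h" for h h0 :: real
proof -
  assume h: "0 < h0" "h0 \<le> h"
  then have "1 \<le> h / h0" by simp
  moreover have "(1 + 1 / h0) * h = h + h / h0" by (simp add: distrib_right)
  ultimately show ?thesis using h by linarith
qed

context regularized_problem
begin

lemma eps_star_le:
  assumes "0 < mu_x D \<or> bounded (domX D)"
  shows "eps_star D \<epsilon> \<le> 3 * \<epsilon>"
proof -
  have 1: "\<epsilon> / k \<le> 3 * \<epsilon>" if "1 / 3 \<le> k" for k
    using that \<epsilon> by (simp add: field_simps)
  have "\<epsilon> / (2 * (1/6 + 1/2 * kappa_hat D \<epsilon> + 1/2 * kappa_hat_mu D \<epsilon>)) \<le> 3 * \<epsilon>" if "0 < mu_x D"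
    by (rule 1) (use kappa_hat_pos kappa_hat_mu_pos[OF that] in simp)
  moreover have "\<epsilon> / (4 * (1/6 + 1/2 * kappa_hat D \<epsilon>)) \<le> 3 * \<epsilon>"
    by (rule 1) (use kappa_hat_pos in simp)
  ultimately show ?thesis unfolding eps_star_def by (auto simp: min_le_iff_disj)
qed

lemma restarts_le_log_factor:
  assumes mode: "0 < mu_x D \<or> bounded (domX D)"
  shows "real (restarts D \<epsilon> r) \<le> (1 + 1 / ln (4 / 3)) * log_factor D \<epsilon> r"
proof (cases "Psi0 D \<epsilon> r \<le> eps_star D \<epsilon>")
  case True
  then show ?thesis by (simp add: restarts_def log_factor_def)
next
  case False
  have pos: "0 < eps_star D \<epsilon>" by (rule eps_star_pos[OF mode])
  have l: "0 < ln (4 / 3 :: real)" by simp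
  have eq: "Psi0 D \<epsilon> r * Gamma_ratio D \<epsilon> / \<epsilon> = Psi0 D \<epsilon> r / eps_star D \<epsilon>"
    using \<epsilon> by (simp add: Gamma_ratio_def)
  define t where "t = ln (Psi0 D \<epsilon> r / eps_star D \<epsilon>)"
  have t: "0 < t" using False pos by (simp add: t_def)
  have "real (restarts D \<epsilon> r) \<le> t / ln (4 / 3) + 1"
    using restarts_bound(2)[OF _ pos] False unfolding t_def by simp
  also have "\<dots> \<le> (1 + 1 / ln (4 / 3)) * (1 + t)" using t l by (simp add: distrib_right distrib_left)
  also have "1 + t = log_factor D \<epsilon> r" unfolding log_factor_def eq using t by (simp add: t_def)
  finally show ?thesis .
qed

lemma stage_Omega_pos:
  assumes "0 < mu_x D \<or> bounded (domX D)" "s < restarts D \<epsilon> r"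
  shows "0 < stage_Omega D \<epsilon> r s"
  using assms eps_star_pos[OF assms(1)] by (auto simp: stage_Omega_def restarts_def split: if_splits)

lemma sum_max_no_exponent:
  assumes mode: "0 < mu_x D \<or> bounded (domX D)" and h: "0 < h0" "h0 \<le> h"
  shows "(\<Sum>s<restarts D \<epsilon> r. max h 1) \<le> (1 + 1 / h0) * (1 + 1 / ln (4 / 3)) * (h * log_factor D \<epsilon> r)"
proof -
  have "(\<Sum>s<restarts D \<epsilon> r. max h 1) = real (restarts D \<epsilon> r) * max h 1" by simp
  also have "\<dots> \<le> ((1 + 1 / ln (4 / 3)) * log_factor D \<epsilon> r) * ((1 + 1 / h0) * h)"
    by (intro mult_mono restarts_le_log_factor[OF mode] max_one_le h) (auto simp: log_factor_def)
  finally show ?thesis by (simp add: mult_ac)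
qed

text \<open>
  Read backwards from the last stage, the terms decay geometrically with ratio \<open>(4 / 3) powr (- \<alpha>)\<close>.
\<close>
lemma sum_Omega_powr:
  assumes mode: "0 < mu_x D \<or> bounded (domX D)" and \<alpha>: "0 < \<alpha>"
  shows "(\<Sum>s<restarts D \<epsilon> r. stage_Omega D \<epsilon> r s powr (- \<alpha>))
     \<le> eps_star D \<epsilon> powr (- \<alpha>) / (1 - (4 / 3) powr (- \<alpha>))"
proof -
  define \<rho> :: real where "\<rho> = (4 / 3) powr (- \<alpha>)"
  define S where "S = restarts D \<epsilon> r"
  define e where "e = eps_star D \<epsilon>"
  have \<rho>: "0 < \<rho>" "\<rho> < 1" using \<alpha> by (simp_all add: \<rho>_def powr_less_one powr_minus_divide)
  have pos: "0 < e" unfolding e_def by (rule eps_star_pos[OF mode])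
  have "stage_Omega D \<epsilon> r s powr (- \<alpha>) \<le> e powr (- \<alpha>) * \<rho> ^ (S - Suc s)" if s: "s < S" for s
  proof -
    have big: "eps_star D \<epsilon> < Psi0 D \<epsilon> r" using s by (auto simp: S_def restarts_def split: if_splits)
    have "(4 / 3) ^ (S - Suc s) * e \<le> stage_Omega D \<epsilon> r s"
      using restarts_bound(3)[OF big] pos s unfolding S_def e_def by simp
    then have "stage_Omega D \<epsilon> r s powr (- \<alpha>) \<le> ((4 / 3) ^ (S - Suc s) * e) powr (- \<alpha>)"
      using pos \<alpha> by (intro powr_mono2') auto
    also have "\<dots> = e powr (- \<alpha>) * \<rho> ^ (S - Suc s)"
      by (simp add: powr_mult \<rho>_def powr_power powr_powr mult.commute flip: powr_realpow)
    finally show ?thesis .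
  qed
  then have "(\<Sum>s<S. stage_Omega D \<epsilon> r s powr (- \<alpha>)) \<le> (\<Sum>s<S. e powr (- \<alpha>) * \<rho> ^ (S - Suc s))"
    by (intro sum_mono) auto
  also have "\<dots> = e powr (- \<alpha>) * (\<Sum>s<S. \<rho> ^ s)"
    unfolding sum_distrib_left[symmetric] by (simp only: sum.nat_diff_reindex)
  also have "(\<Sum>s<S. \<rho> ^ s) \<le> 1 / (1 - \<rho>)"
    using \<rho> by (simp add: sum_gp_strict divide_right_mono)
  finally show ?thesis using pos unfolding S_def e_def \<rho>_def by (simp add: mult_left_mono)
qed

text \<open>
  A logarithm is dominated by any positive power, so the number of stages can be charged to the
  last budget when its exponent is positive.
\<close>
lemma restarts_le_powr:
  assumes mode: "0 < mu_x D \<or> bounded (domX D)" and \<alpha>: "0 < \<alpha>"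
    and K: "1 \<le> K" "Psi0 D \<epsilon> r \<le> K" and small: "\<epsilon> \<le> 1 / 3"
  shows "real (restarts D \<epsilon> r) \<le> (1 + (ln K + 1 / \<alpha>) / ln (4 / 3)) * eps_star D \<epsilon> powr (- \<alpha>)"
proof -
  define e where "e = eps_star D \<epsilon>"
  define p where "p = e powr (- \<alpha>)"
  have e: "0 < e" "e \<le> 1" using eps_star_pos[OF mode] eps_star_le[OF mode] small by (auto simp: e_def)
  have p: "1 \<le> p" using e \<alpha> by (simp add: p_def ge_one_powr_ge_zero powr_minus powr_le1 one_le_inverse)
  have l: "0 < ln (4 / 3 :: real)" by simp
  have lK: "0 \<le> ln K" using K by simp
  show ?thesis
  proof (cases "Psi0 D \<epsilon> r \<le> e")
    case True
    then show ?thesis using lK l \<alpha> by (simp add: restarts_def e_def)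
  next
    case False
    have "real (restarts D \<epsilon> r) \<le> ln (Psi0 D \<epsilon> r / e) / ln (4 / 3) + 1"
      using restarts_bound(2)[OF _ e(1)[unfolded e_def]] False unfolding e_def by simp
    also have "ln (Psi0 D \<epsilon> r / e) \<le> ln (K / e)"
      using K e False by (intro ln_mono divide_right_mono) auto
    also have "ln (K / e) = ln K + ln (1 / e)" using K e by (simp add: ln_div)
    also have "ln (1 / e) \<le> (1 / e) powr \<alpha> / \<alpha>" using e \<alpha> by (intro ln_le_powr_div) auto
    also have "(1 / e) powr \<alpha> = p" using e by (simp add: p_def powr_divide powr_minus_divide)
    finally have "real (restarts D \<epsilon> r) \<le> (ln K + p / \<alpha>) / ln (4 / 3) + 1"
      using l by (simp add: divide_right_mono)
    also have "\<dots> \<le> (ln K * p + p / \<alpha>) / ln (4 / 3) + p"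
      using l lK p \<alpha> by (intro add_mono divide_right_mono) (simp_all add: mult_le_cancel_left1)
    also have "\<dots> = (1 + (ln K + 1 / \<alpha>) / ln (4 / 3)) * p" by (simp add: algebra_simps add_divide_distrib)
    finally show ?thesis unfolding p_def e_def .
  qed
qed

lemma sum_max_exponent:
  assumes mode: "0 < mu_x D \<or> bounded (domX D)" and \<alpha>: "0 < \<alpha>"
    and K: "1 \<le> K" "Psi0 D \<epsilon> r \<le> K" and small: "\<epsilon> \<le> 1 / 3" and h: "0 < h0" "h0 \<le> h"
  shows "(\<Sum>s<restarts D \<epsilon> r. max (h * stage_Omega D \<epsilon> r s powr (- \<alpha>)) 1)
     \<le> (1 / (1 - (4 / 3) powr (- \<alpha>)) + (1 + (ln K + 1 / \<alpha>) / ln (4 / 3)) / h0) * (h * eps_star D \<epsilon> powr (- \<alpha>))"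
proof -
  define p where "p = eps_star D \<epsilon> powr (- \<alpha>)"
  define m where "m = 1 + (ln K + 1 / \<alpha>) / ln (4 / 3)"
  have m: "0 \<le> m" using K \<alpha> by (simp add: m_def)
  have p: "0 \<le> p" by (simp add: p_def)
  have "(\<Sum>s<restarts D \<epsilon> r. max (h * stage_Omega D \<epsilon> r s powr (- \<alpha>)) 1)
      \<le> (\<Sum>s<restarts D \<epsilon> r. h * stage_Omega D \<epsilon> r s powr (- \<alpha>) + 1)"
    using h by (intro sum_mono) auto
  also have "\<dots> = h * (\<Sum>s<restarts D \<epsilon> r. stage_Omega D \<epsilon> r s powr (- \<alpha>)) + real (restarts D \<epsilon> r)"
    by (simp add: sum.distrib sum_distrib_left)
  also have "\<dots> \<le> h * (p / (1 - (4 / 3) powr (- \<alpha>))) + m * p"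
    unfolding p_def m_def using h
    by (intro add_mono mult_left_mono sum_Omega_powr[OF mode \<alpha>] restarts_le_powr[OF mode \<alpha> K small]) auto
  also have "m * p \<le> m / h0 * (h * p)"
  proof -
    have "1 * (m * p) \<le> (h / h0) * (m * p)" using h m p by (intro mult_right_mono) auto
    then show ?thesis by (simp add: mult_ac)
  qed
  finally show ?thesis unfolding p_def m_def by (simp add: algebra_simps)
qed

end

section \<open>Complexity\<close>

context regularized_problem
begin

lemma lam_le: "\<epsilon> \<le> 1 \<Longrightarrow> \<Lambda> \<le> 1 / Omega_y D"
  using Omega_pos by (simp add: lambda_y_def divide_right_mono)

lemma fs_norm: "(\<And>y. y \<in> domY D \<Longrightarrow> norm y \<le> KY) \<Longrightarrow> norm fs \<le> L_xy D * KY"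
  unfolding fs_eq norm_minus_cancel
  by (rule order_trans[OF Bt_bound mult_left_mono]) (use saddle_mem L_xy_pos in auto)

text \<open>
  Without a bounded domain, strong monotonicity of the subgradients keeps the saddle point near \<open>x0\<close>:
  the subgradient at \<open>x_star\<close> is \<open>- B^T y_star\<close>, and \<open>y_star\<close> ranges over a bounded set.
\<close>
lemma x_star_dist:
  assumes KY: "\<And>y. y \<in> domY D \<Longrightarrow> norm y \<le> KY" and \<mu>: "0 < mu_x D"
  shows "norm (fst (z_init D) - xs) \<le> (norm (fsub D (fst (z_init D))) + L_xy D * KY) / mu_x D"
proof -
  define x0 where "x0 = fst (z_init D)"
  have x0: "x0 \<in> domX D" using z_init by (auto simp: x0_def domZ_def)
  have "mu_x D / 2 * (norm (x0 - xs))\<^sup>2 \<le> bregman (fobj D) fs x0 xs"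
    by (rule strongly_convex_bregman[OF f_strong x0 saddle_mem(1) fs_sub])
  moreover have "mu_x D / 2 * (norm (xs - x0))\<^sup>2 \<le> bregman (fobj D) (fsub D x0) xs x0"
    by (rule strongly_convex_bregman[OF f_strong saddle_mem(1) x0 f_sub])
  moreover have "bregman (fobj D) fs x0 xs + bregman (fobj D) (fsub D x0) xs x0 = (fsub D x0 - fs) \<bullet> (x0 - xs)"
    by (simp add: bregman_def inner_diff_left inner_diff_right)
  ultimately have "mu_x D * (norm (x0 - xs))\<^sup>2 \<le> (fsub D x0 - fs) \<bullet> (x0 - xs)"
    by (simp add: norm_minus_commute)
  also have "\<dots> \<le> norm (fsub D x0 - fs) * norm (x0 - xs)" by (rule norm_cauchy_schwarz)
  also have "\<dots> \<le> (norm (fsub D x0) + L_xy D * KY) * norm (x0 - xs)"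
    by (intro mult_right_mono order_trans[OF norm_triangle_ineq4 add_left_mono] fs_norm KY) auto
  finally have "(mu_x D * norm (x0 - xs)) * norm (x0 - xs) \<le> (norm (fsub D x0) + L_xy D * KY) * norm (x0 - xs)"
    by (simp add: power2_eq_square mult.assoc)
  then have "mu_x D * norm (x0 - xs) \<le> norm (fsub D x0) + L_xy D * KY" if "norm (x0 - xs) \<noteq> 0"
    using that by (simp add: mult_le_cancel_right)
  moreover have "0 \<le> norm (fsub D x0) + L_xy D * KY"
    using order_trans[OF norm_ge_zero fs_norm[OF KY]] by (simp add: add_nonneg_nonneg)
  ultimately have "mu_x D * norm (x0 - xs) \<le> norm (fsub D x0) + L_xy D * KY" by (cases "norm (x0 - xs) = 0") auto
  then show ?thesis using \<mu> unfolding x0_def by (simp add: pos_le_divide_eq mult.commute)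
qed

lemma Psi0_le:
  assumes KY: "\<And>y. y \<in> domY D \<Longrightarrow> norm y \<le> KY" and KX: "norm (fst (z_init D) - xs) \<le> KX" and small: "\<epsilon> \<le> 1"
  shows "Psi0 D \<epsilon> r \<le> delta_x D * KX\<^sup>2 + 1 / Omega_y D * (2 * KY)\<^sup>2
    + 12 * ((norm (fsub D (fst (z_init D))) + L_xy D * KY) * KX)
    + 12 * ((norm (gsub D (snd (z_init D))) + 1 / Omega_y D * norm (snd (z_init D) - y_ref D)
        + L_xy D * (norm (fst (z_init D)) + KX)) * (2 * KY))"
proof -
  define x0 y0 where "x0 = fst (z_init D)" and "y0 = snd (z_init D)"
  have y0: "y0 \<in> domY D" using z_init by (auto simp: y0_def domZ_def)
  have KX': "norm (x0 - xs) \<le> KX" using KX by (simp add: x0_def)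
  have KX0: "0 \<le> KX" using KX by (rule order_trans[OF norm_ge_zero])
  have Yd: "norm (y0 - ys) \<le> 2 * KY"
    using norm_triangle_ineq4[of y0 ys] KY[OF y0] KY[OF saddle_mem(2)] by linarith
  have KY0: "0 \<le> KY" using KY[OF y0] by (rule order_trans[OF norm_ge_zero])
  have a: "\<delta> * (norm (x0 - xs))\<^sup>2 \<le> delta_x D * KX\<^sup>2"
    using del_le delta_pos KX' by (intro mult_mono power_mono) auto
  have b: "\<Lambda> * (norm (y0 - ys))\<^sup>2 \<le> 1 / Omega_y D * (2 * KY)\<^sup>2"
    using lam_le[OF small] Omega_pos Yd by (intro mult_mono power_mono) auto
  have "Df x0 \<le> (fsub D x0 - fs) \<bullet> (x0 - xs)" unfolding Df_def by (rule bregman_le_inner[OF f_sub])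
  also have "\<dots> \<le> norm (fsub D x0 - fs) * norm (x0 - xs)" by (rule norm_cauchy_schwarz)
  also have "\<dots> \<le> (norm (fsub D x0) + L_xy D * KY) * KX"
    using KX' L_xy_pos KY0
    by (intro mult_mono order_trans[OF norm_triangle_ineq4 add_left_mono] fs_norm KY) auto
  finally have c: "Df x0 \<le> (norm (fsub D x0) + L_xy D * KY) * KX" .
  have "Dg y0 \<le> (g_reg_sub D \<epsilon> y0 - gs) \<bullet> (y0 - ys)" unfolding Dg_def by (rule bregman_le_inner[OF g_reg_sub])
  also have "\<dots> \<le> norm (g_reg_sub D \<epsilon> y0 - gs) * norm (y0 - ys)" by (rule norm_cauchy_schwarz)
  also have "\<dots> \<le> (norm (gsub D y0) + 1 / Omega_y D * norm (y0 - y_ref D) + L_xy D * (norm x0 + KX)) * (2 * KY)"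
  proof (intro mult_mono Yd)
    have "norm xs \<le> norm x0 + KX" using KX' norm_triangle_ineq4[of x0 "x0 - xs"] by simp
    then have "norm gs \<le> L_xy D * (norm x0 + KX)"
      unfolding gs_eq using L_xy_pos by (intro order_trans[OF B_bound mult_left_mono]) auto
    moreover have "norm (g_reg_sub D \<epsilon> y0) \<le> norm (gsub D y0) + \<Lambda> * norm (y0 - y_ref D)"
      unfolding g_reg_sub_def using lam_pos by (intro norm_triangle_le) simp
    moreover have "\<Lambda> * norm (y0 - y_ref D) \<le> 1 / Omega_y D * norm (y0 - y_ref D)"
      by (intro mult_right_mono lam_le[OF small]) auto
    ultimately show "norm (g_reg_sub D \<epsilon> y0 - gs)
        \<le> norm (gsub D y0) + 1 / Omega_y D * norm (y0 - y_ref D) + L_xy D * (norm x0 + KX)"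
      using norm_triangle_ineq4[of "g_reg_sub D \<epsilon> y0" gs] by linarith
    show "0 \<le> norm (gsub D y0) + 1 / Omega_y D * norm (y0 - y_ref D) + L_xy D * (norm x0 + KX)"
      using Omega_pos L_xy_pos KX0 by (intro add_nonneg_nonneg mult_nonneg_nonneg) auto
  qed auto
  finally have d: "Dg y0 \<le> (norm (gsub D y0) + 1 / Omega_y D * norm (y0 - y_ref D) + L_xy D * (norm x0 + KX)) * (2 * KY)" .
  have "Psi0 D \<epsilon> r = \<delta> * (norm (x0 - xs))\<^sup>2 + \<Lambda> * (norm (y0 - ys))\<^sup>2 + 12 * Df x0 + 12 * Dg y0"
    using Psi_eq[of x0 y0] by (simp add: Psi0_def x0_def y0_def)
  then show ?thesis using a b c d unfolding x0_def[symmetric] y0_def[symmetric] by linarith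
qed

lemma Gamma_powr:
  assumes mode: "0 < mu_x D \<or> bounded (domX D)"
  shows "Gamma_ratio D \<epsilon> powr \<alpha> * (h * \<epsilon> powr (- \<alpha>)) = h * eps_star D \<epsilon> powr (- \<alpha>)"
  unfolding Gamma_ratio_def using eps_star_pos[OF mode] \<epsilon>
  by (simp add: powr_divide powr_minus_divide)

lemma Gamma_pos: "0 < mu_x D \<or> bounded (domX D) \<Longrightarrow> 0 < Gamma_ratio D \<epsilon>"
  unfolding Gamma_ratio_def using eps_star_pos \<epsilon> by simp

text \<open>
  The lower bounds \<open>h0\<close> on the scale of a budget, here and below, do not depend on \<open>\<epsilon>\<close>; they allow
  absorbing the maximum with \<open>1\<close> into the budget.
\<close>
lemma H_x_tilde_ge: "H_x D * delta_x D powr (- (1 + nu_x D) / 2) \<le> H_x_tilde D \<epsilon>"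
  unfolding H_x_tilde_def using H_x_pos del_pos del_le nu_x
  by (intro mult_left_mono powr_mono2') auto

lemma f_budget_sum_nonsmooth:
  assumes mode: "0 < mu_x D \<or> bounded (domX D)" and \<nu>: "nu_x D < 1"
    and K: "1 \<le> K" "Psi0 D \<epsilon> r \<le> K" and small: "\<epsilon> \<le> 1 / 3"
    and h0: "h0 = (H_x D * delta_x D powr (- (1 + nu_x D) / 2)) powr (2 / (1 + 3 * nu_x D))"
  shows "(\<Sum>s<restarts D \<epsilon> r. budget D \<epsilon> (stage_Omega D \<epsilon> r s) 1)
     \<le> (1 / (1 - (4 / 3) powr (- alpha_x D)) + (1 + (ln K + 1 / alpha_x D) / ln (4 / 3)) / h0)
        * (Gamma_ratio D \<epsilon> powr alpha_x D * N_f D \<epsilon> r)"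
proof -
  have \<alpha>: "0 < alpha_x D" using \<nu> nu_x by (simp add: alpha_x_def)
  have h0p: "0 < h0" unfolding h0 using H_x_pos delta_pos by simp
  have h: "h0 \<le> H_x_tilde D \<epsilon> powr (2 / (1 + 3 * nu_x D))"
    unfolding h0 using nu_x H_x_pos delta_pos by (intro powr_mono2 H_x_tilde_ge) auto
  show ?thesis
    using sum_max_exponent[OF mode \<alpha> K small h0p h] \<nu>
    by (simp add: budget_def N_f_def Gamma_powr[OF mode])
qed

lemma f_budget_sum_smooth:
  assumes mode: "0 < mu_x D \<or> bounded (domX D)" and \<nu>: "nu_x D = 1"
    and h0: "h0 = sqrt (H_x D / delta_x D)"
  shows "(\<Sum>s<restarts D \<epsilon> r. budget D \<epsilon> (stage_Omega D \<epsilon> r s) 1)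
     \<le> (1 + 1 / h0) * (1 + 1 / ln (4 / 3)) * (Gamma_ratio D \<epsilon> powr alpha_x D * N_f D \<epsilon> r)"
proof -
  have h0p: "0 < h0" unfolding h0 using H_x_pos delta_pos by simp
  have h: "h0 \<le> sqrt (kappa_x D \<epsilon>)"
    unfolding h0 kappa_x_def using H_x_pos del_pos del_le
    by (intro real_sqrt_le_mono divide_left_mono) (auto intro: mult_pos_pos less_le_trans)
  have "H_x_tilde D \<epsilon> = kappa_x D \<epsilon>"
    using \<nu> del_pos by (simp add: H_x_tilde_def kappa_x_def powr_minus_divide)
  then have "H_x_tilde D \<epsilon> powr (2 / (1 + 3 * nu_x D)) = sqrt (kappa_x D \<epsilon>)"
    using \<nu> H_x_pos del_pos by (simp add: powr_half_sqrt kappa_x_def)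
  then have "(\<Sum>s<restarts D \<epsilon> r. budget D \<epsilon> (stage_Omega D \<epsilon> r s) 1) = (\<Sum>s<restarts D \<epsilon> r. max (sqrt (kappa_x D \<epsilon>)) 1)"
    using \<nu> stage_Omega_pos[OF mode] by (intro sum.cong refl) (force simp: budget_def alpha_x_def)
  also have "\<dots> \<le> (1 + 1 / h0) * (1 + 1 / ln (4 / 3)) * (sqrt (kappa_x D \<epsilon>) * log_factor D \<epsilon> r)"
    by (rule sum_max_no_exponent[OF mode h0p h])
  finally show ?thesis using \<nu> Gamma_pos[OF mode] by (simp add: N_f_def alpha_x_def)
qed

lemma g_budget_sum_nonsmooth:
  assumes mode: "0 < mu_x D \<or> bounded (domX D)" and \<nu>: "nu_y D < 1"
    and K: "1 \<le> K" "Psi0 D \<epsilon> r \<le> K" and small: "\<epsilon> \<le> 1 / 3"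
    and h0: "h0 = (H_y D * (1 / Omega_y D) powr (- (1 + nu_y D) / 2)) powr (2 / (1 + 3 * nu_y D))"
  shows "(\<Sum>s<restarts D \<epsilon> r. budget D \<epsilon> (stage_Omega D \<epsilon> r s) 2)
     \<le> (1 / (1 - (4 / 3) powr (- alpha_y D)) + (1 + (ln K + 1 / alpha_y D) / ln (4 / 3)) / h0)
        * (Gamma_ratio D \<epsilon> powr alpha_y D * N_g D \<epsilon> r)"
proof -
  define \<nu>y where "\<nu>y = nu_y D"
  define h where "h = (H_y_reg D \<epsilon> * \<Lambda> powr (- (1 + \<nu>y) / 2)) powr (2 / (1 + 3 * \<nu>y))"
  have \<nu>y: "0 \<le> \<nu>y" "\<nu>y < 1" using \<nu> nu_y by (simp_all add: \<nu>y_def)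
  have \<alpha>: "0 < alpha_y D" using \<nu> nu_y by (simp add: alpha_y_def)
  have h0p: "0 < h0" unfolding h0 using H_y_pos Omega_pos by simp
  have "H_y D \<le> H_y_reg D \<epsilon>"
    unfolding H_y_reg_def using lam_pos diameter_ge_0[OF Y_bounded] by (simp add: rpow_nonneg)
  moreover have "(1 / Omega_y D) powr (- (1 + \<nu>y) / 2) \<le> \<Lambda> powr (- (1 + \<nu>y) / 2)"
    using lam_le small lam_pos \<nu>y by (intro powr_mono2') auto
  ultimately have "H_y D * (1 / Omega_y D) powr (- (1 + \<nu>y) / 2) \<le> H_y_reg D \<epsilon> * \<Lambda> powr (- (1 + \<nu>y) / 2)"
    using H_y_reg_pos by (intro mult_mono) auto
  then have h: "h0 \<le> h"
    unfolding h0 h_def \<nu>y_def[symmetric] by (rule powr_mono2[rotated 2]) (use \<nu>y H_y_pos in auto)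
  have "N_g D \<epsilon> r = h * \<epsilon> powr (- alpha_y D)"
  proof -
    define p where "p = 2 / (1 + 3 * \<nu>y)"
    have "H_y_reg D \<epsilon> * Omega_y D powr ((1 + \<nu>y) / 2) / \<epsilon>
        = (H_y_reg D \<epsilon> * \<Lambda> powr (- (1 + \<nu>y) / 2)) * \<epsilon> powr (- (1 - \<nu>y) / 2)"
    proof -
      have 1: "\<Lambda> powr (- (1 + \<nu>y) / 2) = Omega_y D powr ((1 + \<nu>y) / 2) * \<epsilon> powr (- (1 + \<nu>y) / 2)"
      proof -
        have e: "- (1 + \<nu>y) / 2 = - ((1 + \<nu>y) / 2)" by (rule minus_divide_left[symmetric])
        show ?thesis unfolding e lambda_y_def using \<epsilon> Omega_pos by (simp add: powr_divide powr_minus_divide)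
      qed
      have 2: "\<epsilon> powr (- (1 + \<nu>y) / 2) * \<epsilon> powr (- (1 - \<nu>y) / 2) = 1 / \<epsilon>"
      proof -
        have e: "- (1 + \<nu>y) / 2 + - (1 - \<nu>y) / 2 = - 1" by (simp add: field_simps)
        show ?thesis unfolding powr_add[symmetric] e using \<epsilon> by (simp add: powr_minus_divide)
      qed
      have "(H_y_reg D \<epsilon> * \<Lambda> powr (- (1 + \<nu>y) / 2)) * \<epsilon> powr (- (1 - \<nu>y) / 2)
         = H_y_reg D \<epsilon> * Omega_y D powr ((1 + \<nu>y) / 2) * (\<epsilon> powr (- (1 + \<nu>y) / 2) * \<epsilon> powr (- (1 - \<nu>y) / 2))"
        unfolding 1 by (simp only: mult.assoc)
      then show ?thesis unfolding 2 by simp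
    qed
    moreover have "- (1 - \<nu>y) / 2 * p = - alpha_y D"
    proof -
      have cancel: "a / 2 * (2 / m) = a / m" for a m :: real by simp
      show ?thesis unfolding p_def alpha_y_def \<nu>y_def[symmetric] cancel
        by (rule minus_divide_left[symmetric])
    qed
    ultimately show ?thesis
      using \<nu> unfolding N_g_def \<nu>y_def[symmetric] p_def[symmetric] h_def
      by (simp only: if_True powr_mult powr_powr)
  qed
  then show ?thesis
    using sum_max_exponent[OF mode \<alpha> K small h0p h] \<nu>
    by (simp add: budget_def Gamma_powr[OF mode] h_def \<nu>y_def)
qed

lemma g_budget_sum_smooth:
  assumes mode: "0 < mu_x D \<or> bounded (domX D)" and \<nu>: "nu_y D = 1"
  shows "(\<Sum>s<restarts D \<epsilon> r. budget D \<epsilon> (stage_Omega D \<epsilon> r s) 2)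
     \<le> 2 * (1 + 1 / ln (4 / 3)) * (Gamma_ratio D \<epsilon> powr alpha_y D * N_g D \<epsilon> r)"
proof -
  define k where "k = 1 + H_y D * Omega_y D / \<epsilon>"
  have k: "1 \<le> sqrt k" using H_y_pos Omega_pos \<epsilon> by (simp add: k_def)
  have "H_y_reg D \<epsilon> * \<Lambda> powr (- (1 + nu_y D) / 2) = k"
    using \<nu> lam_pos \<epsilon> Omega_pos
    by (simp add: H_y_reg_def rpow_def powr_minus_divide k_def add_divide_distrib) (simp add: lambda_y_def)
  then have "(H_y_reg D \<epsilon> * \<Lambda> powr (- (1 + nu_y D) / 2)) powr (2 / (1 + 3 * nu_y D)) = sqrt k"
    using \<nu> k by (simp add: powr_half_sqrt)
  then have "(\<Sum>s<restarts D \<epsilon> r. budget D \<epsilon> (stage_Omega D \<epsilon> r s) 2) = (\<Sum>s<restarts D \<epsilon> r. max (sqrt k) 1)"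
    using \<nu> stage_Omega_pos[OF mode] by (intro sum.cong refl) (force simp: budget_def alpha_y_def)
  also have "\<dots> \<le> (1 + 1 / 1) * (1 + 1 / ln (4 / 3)) * (sqrt k * log_factor D \<epsilon> r)"
    by (rule sum_max_no_exponent[OF mode _ k]) simp
  finally show ?thesis using \<nu> Gamma_pos[OF mode] by (simp add: N_g_def alpha_y_def k_def)
qed

lemma B_budget_sum:
  assumes mode: "0 < mu_x D \<or> bounded (domX D)" and small: "\<epsilon> \<le> 1"
    and h0: "h0 = sqrt ((L_xy D)\<^sup>2 / (delta_x D * (1 / Omega_y D)))"
  shows "(\<Sum>s<restarts D \<epsilon> r. budget D \<epsilon> (stage_Omega D \<epsilon> r s) 3)
     \<le> (1 + 1 / h0) * (1 + 1 / ln (4 / 3)) * N_B D \<epsilon> r"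
proof -
  have h0p: "0 < h0" unfolding h0 using L_xy_pos delta_pos Omega_pos by simp
  have "\<delta> * \<Lambda> \<le> delta_x D * (1 / Omega_y D)"
    using del_le lam_le[OF small] del_pos lam_pos by (intro mult_mono) auto
  then have h: "h0 \<le> sqrt (kappa_xy D \<epsilon>)"
    unfolding h0 kappa_xy_def using del_pos lam_pos delta_pos Omega_pos
    by (intro real_sqrt_le_mono divide_left_mono) auto
  have "(\<Sum>s<restarts D \<epsilon> r. budget D \<epsilon> (stage_Omega D \<epsilon> r s) 3) = (\<Sum>s<restarts D \<epsilon> r. max (sqrt (kappa_xy D \<epsilon>)) 1)"
    by (simp add: budget_def)
  also have "\<dots> \<le> (1 + 1 / h0) * (1 + 1 / ln (4 / 3)) * (sqrt (kappa_xy D \<epsilon>) * log_factor D \<epsilon> r)"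
    by (rule sum_max_no_exponent[OF mode h0p h])
  also have "sqrt (kappa_xy D \<epsilon>) = L_xy D * sqrt (Omega_y D / (\<delta> * \<epsilon>))"
    using L_xy_pos by (simp add: kappa_xy_def lambda_y_def real_sqrt_divide real_sqrt_mult)
  finally show ?thesis by (simp add: N_B_def)
qed

end

lemma Psi0_bounded:
  assumes mixed: "mixed_regime D" and mode: "0 < mu_x D \<or> bounded (domX D)"
  shows "\<exists>K\<ge>1. \<forall>\<epsilon> r. regularized_problem D \<epsilon> r \<longrightarrow> \<epsilon> \<le> 1 \<longrightarrow> Psi0 D \<epsilon> r \<le> K"
proof -
  have "bounded (domY D)" using mixed by (simp add: mixed_regime_def)
  then obtain KY where KY: "\<And>y. y \<in> domY D \<Longrightarrow> norm y \<le> KY" by (auto simp: bounded_iff)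
  define KX where "KX = (if 0 < mu_x D then (norm (fsub D (fst (z_init D))) + L_xy D * KY) / mu_x D
     else diameter (domX D))"
  define K where "K = delta_x D * KX\<^sup>2 + 1 / Omega_y D * (2 * KY)\<^sup>2
    + 12 * ((norm (fsub D (fst (z_init D))) + L_xy D * KY) * KX)
    + 12 * ((norm (gsub D (snd (z_init D))) + 1 / Omega_y D * norm (snd (z_init D) - y_ref D)
        + L_xy D * (norm (fst (z_init D)) + KX)) * (2 * KY))"
  have "Psi0 D \<epsilon> r \<le> K" if rp: "regularized_problem D \<epsilon> r" and small: "\<epsilon> \<le> 1" for \<epsilon> r
  proof -
    interpret regularized_problem D \<epsilon> r by (rule rp)
    have "norm (fst (z_init D) - x_star r) \<le> KX"
    proof (cases "0 < mu_x D")
      case True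
      then show ?thesis using x_star_dist[OF KY True] by (simp add: KX_def)
    next
      case False
      then have "bounded (domX D)" using mode by simp
      moreover have "fst (z_init D) \<in> domX D" using z_init by (auto simp: domZ_def)
      ultimately show ?thesis
        using diameter_bounded_bound[of "domX D"] saddle_mem(1) False by (simp add: KX_def dist_norm)
    qed
    then show ?thesis unfolding K_def by (intro Psi0_le KY small)
  qed
  then show ?thesis by (intro exI[of _ "max 1 K"]) (auto simp: le_max_iff_disj)
qed

text \<open>
  The threshold \<open>1 / 3\<close> ensures \<open>eps_star \<le> 1\<close>, by \<open>eps_star_le\<close>.
\<close>
lemma bigo_near_zero:
  fixes f g :: "real \<Rightarrow> real"
  assumes "\<And>\<epsilon>. \<epsilon> \<in> E \<Longrightarrow> 0 < \<epsilon> \<and> 0 \<le> f \<epsilon>" and "\<And>\<epsilon>. \<epsilon> \<in> E \<Longrightarrow> \<epsilon> \<le> 1 / 3 \<Longrightarrow> f \<epsilon> \<le> C * g \<epsilon>"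
  shows "f \<in> O[at 0 within E](g)"
proof (rule bigoI[where c = "\<bar>C\<bar>"])
  have "norm (f \<epsilon>) \<le> \<bar>C\<bar> * norm (g \<epsilon>)" if "\<epsilon> \<in> E" "\<epsilon> \<le> 1 / 3" for \<epsilon>
  proof -
    have "f \<epsilon> \<le> \<bar>C * g \<epsilon>\<bar>" using assms(2)[OF that] by linarith
    then show ?thesis using assms(1)[OF that(1)] by (simp add: abs_mult)
  qed
  then show "\<forall>\<^sub>F \<epsilon> in at 0 within E. norm (f \<epsilon>) \<le> \<bar>C\<bar> * norm (g \<epsilon>)"
    unfolding eventually_at by (intro exI[of _ "1 / 3"]) (auto simp: dist_norm)
qed

text \<open>For \<open>nu_y < 1\<close> the regularization does not enter \<open>delta_x_reg\<close>, which is then \<open>mu_x\<close>.\<close>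
lemma Gamma_ratio_nonsmooth:
  assumes mixed: "mixed_regime D" and \<nu>: "nu_y D < 1"
  shows "0 < \<epsilon> \<Longrightarrow> kappa_hat_mu D \<epsilon> = kappa_xy D \<epsilon>"
    and "0 < \<epsilon> \<Longrightarrow> 0 < kappa_xy D \<epsilon> \<and> Gamma_ratio D \<epsilon> = 1 / 3 + 2 * kappa_xy D \<epsilon>"
proof -
  have \<delta>: "delta_x_reg D \<epsilon> = mu_x D" for \<epsilon> using \<nu> by (simp add: delta_x_reg_def beta_x_reg_def)
  have \<mu>: "0 < mu_x D" using mixed \<nu> by (simp add: mixed_regime_def delta_x_def beta_x_def)
  have \<Omega>: "0 < Omega_y D" and L: "0 < L_xy D"
    using mixed by (simp_all add: mixed_regime_def standing_assumptions_def)
  show mu: "kappa_hat_mu D \<epsilon> = kappa_xy D \<epsilon>" if "0 < \<epsilon>" for \<epsilon>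
    by (simp add: kappa_hat_mu_def kappa_xy_def \<delta>)
  assume \<epsilon>: "0 < \<epsilon>"
  then have k: "0 < kappa_xy D \<epsilon>" using \<mu> \<Omega> L by (simp add: kappa_xy_def \<delta> lambda_y_def)
  have "kappa_hat D \<epsilon> = kappa_xy D \<epsilon>" by (simp add: kappa_hat_def kappa_xy_def)
  moreover have "2 * (1 / 6 + 1 / 2 * k + 1 / 2 * k) = 1 / 3 + 2 * k" for k :: real by simp
  ultimately have "eps_star D \<epsilon> = \<epsilon> / (1 / 3 + 2 * kappa_xy D \<epsilon>)"
    unfolding eps_star_def mu[OF \<epsilon>] using \<mu> by (simp only: if_True)
  then show "0 < kappa_xy D \<epsilon> \<and> Gamma_ratio D \<epsilon> = 1 / 3 + 2 * kappa_xy D \<epsilon>"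
    using k \<epsilon> by (simp add: Gamma_ratio_def)
qed

lemma Gamma_ratio_theta:
  assumes mixed: "mixed_regime D" and \<nu>: "nu_y D < 1"
  shows "Gamma_ratio D \<in> \<Theta>[at_right 0](\<lambda>\<epsilon>. 1 + kappa_xy D \<epsilon>)"
proof (rule bigthetaI)
  have ev: "\<forall>\<^sub>F \<epsilon> in at_right (0::real). 0 < \<epsilon>" by (rule eventually_at_right_less)
  show "Gamma_ratio D \<in> O[at_right 0](\<lambda>\<epsilon>. 1 + kappa_xy D \<epsilon>)"
    by (rule bigoI[where c = 2], rule eventually_mono[OF ev])
      (use Gamma_ratio_nonsmooth(2)[OF assms] in force)
  show "Gamma_ratio D \<in> \<Omega>[at_right 0](\<lambda>\<epsilon>. 1 + kappa_xy D \<epsilon>)"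
    unfolding bigomega_iff_bigo
    by (rule bigoI[where c = 3], rule eventually_mono[OF ev])
      (use Gamma_ratio_nonsmooth(2)[OF assms] in force)
qed

theorem corollaryJ5:
  fixes D :: "('x::finite, 'y::finite) saddle_data"
    and c :: real
    and E :: "real set"
    and r :: "real \<Rightarrow> ('x, 'y) saddle_ref"
    and \<pi> :: "real \<Rightarrow> nat \<Rightarrow> nat \<Rightarrow> nat"
  assumes "mixed_regime D"
    and "10 ^ 6 \<le> c"
    and "\<And>\<epsilon>. \<epsilon> \<in> E \<Longrightarrow> 0 < \<epsilon>"
    and "\<And>\<epsilon>. \<epsilon> \<in> E \<Longrightarrow> regularized_saddle D \<epsilon> (r \<epsilon>)"
    and "\<And>\<epsilon>. \<epsilon> \<in> E \<Longrightarrow> compatible D \<epsilon> (r \<epsilon>)"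
    and "\<And>\<epsilon>. \<epsilon> \<in> E \<Longrightarrow> xi_star (r \<epsilon>) = 0 \<and> zeta_star (r \<epsilon>) = 0"
    and "0 < mu_x D \<or> bounded (domX D)"
    and "\<And>\<epsilon> s. \<epsilon> \<in> E \<Longrightarrow> s < restarts D \<epsilon> (r \<epsilon>) \<Longrightarrow>
           level_order D \<epsilon> (stage_Omega D \<epsilon> (r \<epsilon>) s) (\<pi> \<epsilon> s)"
  shows "(\<forall>\<epsilon>\<in>E. gap D (output_point D \<epsilon> c (r \<epsilon>) (\<pi> \<epsilon>)) \<le> ereal \<epsilon>)
    \<and> (\<lambda>\<epsilon>. real (restarts D \<epsilon> (r \<epsilon>)))
        \<in> O[at 0 within E](\<lambda>\<epsilon>. 1 + max 0 (ln (Psi0 D \<epsilon> (r \<epsilon>) * Gamma_ratio D \<epsilon> / \<epsilon>)))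
    \<and> (\<lambda>\<epsilon>. real (N_f_tot D \<epsilon> c (r \<epsilon>) (\<pi> \<epsilon>)))
        \<in> O[at 0 within E](\<lambda>\<epsilon>. Gamma_ratio D \<epsilon> powr alpha_x D * N_f D \<epsilon> (r \<epsilon>))
    \<and> (\<lambda>\<epsilon>. real (N_g_tot D \<epsilon> c (r \<epsilon>) (\<pi> \<epsilon>)))
        \<in> O[at 0 within E](\<lambda>\<epsilon>. Gamma_ratio D \<epsilon> powr alpha_y D * N_g D \<epsilon> (r \<epsilon>))
    \<and> (\<lambda>\<epsilon>. real (N_B_tot D \<epsilon> c (r \<epsilon>) (\<pi> \<epsilon>)))
        \<in> O[at 0 within E](\<lambda>\<epsilon>. N_B D \<epsilon> (r \<epsilon>))
    \<and> (nu_x D = 1 \<and> nu_y D = 1 \<longrightarrow> alpha_x D = 0 \<and> alpha_y D = 0)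
    \<and> (nu_y D < 1 \<longrightarrow>
         (\<forall>\<epsilon>>0. kappa_hat D \<epsilon> = kappa_xy D \<epsilon> \<and> kappa_hat_mu D \<epsilon> = kappa_xy D \<epsilon>)
         \<and> Gamma_ratio D \<in> \<Theta>[at_right 0](\<lambda>\<epsilon>. 1 + kappa_xy D \<epsilon>))"
proof -
  note mixed = assms(1) and c = assms(2) and E = assms(3) and mode = assms(7) and order = assms(8)
  have reg: "regularized_problem D \<epsilon> (r \<epsilon>)" if "\<epsilon> \<in> E" for \<epsilon>
    using mixed E assms(4-6) that by (intro regularized_problem.intro) auto
  have c0: "0 \<le> c" using c by simp
  obtain K where K: "1 \<le> K" "\<And>\<epsilon> r. regularized_problem D \<epsilon> r \<Longrightarrow> \<epsilon> \<le> 1 \<Longrightarrow> Psi0 D \<epsilon> r \<le> K"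
    using Psi0_bounded[OF mixed mode] by blast
  have \<nu>: "nu_x D \<le> 1" "nu_y D \<le> 1"
    using mixed by (simp_all add: mixed_regime_def standing_assumptions_def)
  have Kr: "Psi0 D \<epsilon> (r \<epsilon>) \<le> K" if "\<epsilon> \<in> E" "\<epsilon> \<le> 1 / 3" for \<epsilon>
    using K(2)[OF reg[OF that(1)]] that by simp
  note tot = total_calls_le[OF c0 order]
  have calls_bigo: "(\<lambda>\<epsilon>. real (N \<epsilon>)) \<in> O[at 0 within E](g)"
    if N: "\<And>\<epsilon>. \<epsilon> \<in> E \<Longrightarrow> real (N \<epsilon>) \<le> (24 * c + 8) * R \<epsilon>"
      and R: "\<And>\<epsilon>. \<epsilon> \<in> E \<Longrightarrow> \<epsilon> \<le> 1 / 3 \<Longrightarrow> R \<epsilon> \<le> C * g \<epsilon>" for N R C g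
  proof (rule bigo_near_zero[where C = "(24 * c + 8) * C"])
    have c8: "0 \<le> 24 * c + 8" using c0 by simp
    show "real (N \<epsilon>) \<le> (24 * c + 8) * C * g \<epsilon>" if "\<epsilon> \<in> E" "\<epsilon> \<le> 1 / 3" for \<epsilon>
      using order_trans[OF N[OF that(1)] mult_left_mono[OF R[OF that] c8]] by (simp only: mult.assoc)
  qed (use E in auto)
  have gap: "\<forall>\<epsilon>\<in>E. gap D (output_point D \<epsilon> c (r \<epsilon>) (\<pi> \<epsilon>)) \<le> ereal \<epsilon>"
    by (intro ballI regularized_problem.output_gap[OF reg] c mode order)
  have S: "(\<lambda>\<epsilon>. real (restarts D \<epsilon> (r \<epsilon>)))
        \<in> O[at 0 within E](\<lambda>\<epsilon>. 1 + max 0 (ln (Psi0 D \<epsilon> (r \<epsilon>) * Gamma_ratio D \<epsilon> / \<epsilon>)))"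
    unfolding log_factor_def[symmetric]
    by (rule bigo_near_zero[where C = "1 + 1 / ln (4 / 3)"])
      (use E regularized_problem.restarts_le_log_factor[OF reg mode] in auto)
  have "\<exists>C. \<forall>\<epsilon>\<in>E. \<epsilon> \<le> 1 / 3 \<longrightarrow> (\<Sum>s<restarts D \<epsilon> (r \<epsilon>). budget D \<epsilon> (stage_Omega D \<epsilon> (r \<epsilon>) s) 1)
       \<le> C * (Gamma_ratio D \<epsilon> powr alpha_x D * N_f D \<epsilon> (r \<epsilon>))"
  proof (cases "nu_x D = 1")
    case True
    show ?thesis using regularized_problem.f_budget_sum_smooth[OF reg mode True refl] by blast
  next
    case False
    then have "nu_x D < 1" using \<nu> by simp
    then show ?thesis using regularized_problem.f_budget_sum_nonsmooth[OF reg mode _ K(1) Kr _ refl] by blast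
  qed
  then obtain Cf where Cf: "\<And>\<epsilon>. \<epsilon> \<in> E \<Longrightarrow> \<epsilon> \<le> 1 / 3 \<Longrightarrow>
      (\<Sum>s<restarts D \<epsilon> (r \<epsilon>). budget D \<epsilon> (stage_Omega D \<epsilon> (r \<epsilon>) s) 1)
       \<le> Cf * (Gamma_ratio D \<epsilon> powr alpha_x D * N_f D \<epsilon> (r \<epsilon>))" by blast
  have Nf: "(\<lambda>\<epsilon>. real (N_f_tot D \<epsilon> c (r \<epsilon>) (\<pi> \<epsilon>)))
        \<in> O[at 0 within E](\<lambda>\<epsilon>. Gamma_ratio D \<epsilon> powr alpha_x D * N_f D \<epsilon> (r \<epsilon>))"
    by (rule calls_bigo[OF tot(1) Cf])
  have "\<exists>C. \<forall>\<epsilon>\<in>E. \<epsilon> \<le> 1 / 3 \<longrightarrow> (\<Sum>s<restarts D \<epsilon> (r \<epsilon>). budget D \<epsilon> (stage_Omega D \<epsilon> (r \<epsilon>) s) 2)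
       \<le> C * (Gamma_ratio D \<epsilon> powr alpha_y D * N_g D \<epsilon> (r \<epsilon>))"
  proof (cases "nu_y D = 1")
    case True
    show ?thesis using regularized_problem.g_budget_sum_smooth[OF reg mode True] by blast
  next
    case False
    then have "nu_y D < 1" using \<nu> by simp
    then show ?thesis using regularized_problem.g_budget_sum_nonsmooth[OF reg mode _ K(1) Kr _ refl] by blast
  qed
  then obtain Cg where Cg: "\<And>\<epsilon>. \<epsilon> \<in> E \<Longrightarrow> \<epsilon> \<le> 1 / 3 \<Longrightarrow>
      (\<Sum>s<restarts D \<epsilon> (r \<epsilon>). budget D \<epsilon> (stage_Omega D \<epsilon> (r \<epsilon>) s) 2)
       \<le> Cg * (Gamma_ratio D \<epsilon> powr alpha_y D * N_g D \<epsilon> (r \<epsilon>))" by blast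
  have Ng: "(\<lambda>\<epsilon>. real (N_g_tot D \<epsilon> c (r \<epsilon>) (\<pi> \<epsilon>)))
        \<in> O[at 0 within E](\<lambda>\<epsilon>. Gamma_ratio D \<epsilon> powr alpha_y D * N_g D \<epsilon> (r \<epsilon>))"
    by (rule calls_bigo[OF tot(2) Cg])
  define CB where "CB = (1 + 1 / sqrt ((L_xy D)\<^sup>2 / (delta_x D * (1 / Omega_y D)))) * (1 + 1 / ln (4 / 3))"
  have CB: "(\<Sum>s<restarts D \<epsilon> (r \<epsilon>). budget D \<epsilon> (stage_Omega D \<epsilon> (r \<epsilon>) s) 3) \<le> CB * N_B D \<epsilon> (r \<epsilon>)"
    if "\<epsilon> \<in> E" "\<epsilon> \<le> 1 / 3" for \<epsilon>
    unfolding CB_def by (rule regularized_problem.B_budget_sum[OF reg mode _ refl]) (use that in auto)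
  have NB: "(\<lambda>\<epsilon>. real (N_B_tot D \<epsilon> c (r \<epsilon>) (\<pi> \<epsilon>))) \<in> O[at 0 within E](\<lambda>\<epsilon>. N_B D \<epsilon> (r \<epsilon>))"
    by (rule calls_bigo[OF tot(3) CB])
  have \<alpha>: "nu_x D = 1 \<and> nu_y D = 1 \<longrightarrow> alpha_x D = 0 \<and> alpha_y D = 0"
    by (simp add: alpha_x_def alpha_y_def)
  have \<Gamma>: "nu_y D < 1 \<longrightarrow>
         (\<forall>\<epsilon>>0. kappa_hat D \<epsilon> = kappa_xy D \<epsilon> \<and> kappa_hat_mu D \<epsilon> = kappa_xy D \<epsilon>)
         \<and> Gamma_ratio D \<in> \<Theta>[at_right 0](\<lambda>\<epsilon>. 1 + kappa_xy D \<epsilon>)"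
    using Gamma_ratio_nonsmooth(1)[OF mixed] Gamma_ratio_theta[OF mixed]
    by (simp add: kappa_hat_def kappa_xy_def)
  show ?thesis
    by (intro conjI gap S Nf Ng NB \<alpha> \<Gamma>)
qed

end
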